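(* The left earthquake deformation about $\alpha$ in trace coordinates is precisely the continuous flow extension of the left Dehn twist about $\alpha$ on the component $\mathcal{T}_{\mathrm{tr}}$: $$E_\alpha^{\mathrm{tr}}(\mathbf{v})=F_\alpha^{\mathrm{tr}}(\mathbf{v})\qquad\text{for all }\mathbf{v}\in\mathcal{T}_{\mathrm{tr}},$$ as maps of $r\in\mathbb{R}$.
   Context: $\mathbb{R}_+$ denotes the positive reals. $S_{1,1}$ is the once-punctured torus, with $\pi_1(S_{1,1})$ free on the simple closed curves $\alpha,\beta$. The Teichm\"uller space of marked complete finite-area hyperbolic structures on $S_{1,1}$ is identified with $\mathcal{T}_{\mathrm{tr}}=\{(x,y,z)\in\mathbb{R}_+^3: x^2+y^2+z^2-xyz-2=-2\}$ via trace coordinates $(x,y,z)=(\mathrm{tr}\,\rho(\alpha),\mathrm{tr}\,\rho(\beta),\mathrm{tr}\,\rho(\alpha\beta))$ of the holonomy $\rho$ (lifted to $\mathrm{SL}_2(\mathbb{R})$ with positive traces). The length of the geodesic in the class of $\gamma$ is $\ell(\gamma)=2\cosh^{-1}(\mathrm{tr}\,\rho(\gamma)/2)$ (positive trace). $E_\alpha^{\mathrm{tr}}(\mathbf{v})(r)$ denotes the trace coordinates of the hyperbolic structure obtained from the one with trace coordinates $\mathbf{v}$ by the time-$r$ left earthquake about $\alpha$: cut along the geodesic $\alpha$, twist to the left along $\alpha$ by distance $r\,\ell(\alpha)$ (in the opposite direction if $r<0$), and reglue. Orientations are chosen so that the time-$1$ left earthquake is the left Dehn twist about $\alpha$, which acts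 in trace coordinates by $\tilde T_\alpha(x,y,z)=(x,xy-z,y)$. For $\mathbf{v}=(x,y,z)\in\mathcal{T}_{\mathrm{tr}}$ (where $x\neq2$), $F_\alpha^{\mathrm{tr}}(\mathbf{v})(r)=(x,y_\alpha(r),y_\alpha(r-1))$ with $y_\alpha(r)=C_+S_+^r+C_-S_-^r$, $C_\pm=\dfrac{y(x^2-4)\pm(xy-2z)\sqrt{x^2-4}}{2(x^2-4)}$, $S_\pm=\dfrac{x\pm\sqrt{x^2-4}}{2}$. *)

theory Defs
  imports "HOL-Analysis.Analysis"
begin

section \<open>The hyperbolic plane and its orientation preserving isometries\<close>

text \<open>
  The hyperbolic plane is the upper half-plane with its usual orientation.  Elements of
  SL(2,R) act on it by Moebius transformations; this action induces an isomorphism of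
  PSL(2,R) with the group of orientation preserving isometries.
\<close>

type_synonym mat2 = "real^2^2"

definition upper_half_plane :: "complex set" where
  "upper_half_plane = {z. Im z > 0}"

definition SL2 :: "mat2 set" where
  "SL2 = {M. det M = 1}"

definition moebius :: "mat2 \<Rightarrow> complex \<Rightarrow> complex" where
  "moebius M z = (of_real (M $ 1 $ 1) * z + of_real (M $ 1 $ 2)) /
                 (of_real (M $ 2 $ 1) * z + of_real (M $ 2 $ 2))"

text \<open>
  \<^term>\<open>transl t\<close> acts by \<open>z \<mapsto> exp t * z\<close>: it is the hyperbolic translation by the (signed)
  hyperbolic distance \<open>t\<close> along the imaginary axis, which is oriented upwards.
\<close>

definition transl :: "real \<Rightarrow> mat2" where
  "transl t = vector [vector [exp (t/2), 0], vector [0, exp (- t/2)]]"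

text \<open>
  An element \<open>g\<close> of SL(2,R) encodes the oriented geodesic that is the image under \<open>g\<close> of the
  upwards oriented imaginary axis (every oriented geodesic arises in this way, and \<open>g\<close> is
  unique up to sign and up to right multiplication by some \<^term>\<open>transl t\<close>).  The complement of
  this geodesic consists of a left and a right half-plane.
\<close>

definition geodesic :: "mat2 \<Rightarrow> complex set" where
  "geodesic g = moebius g ` {z \<in> upper_half_plane. Re z = 0}"

definition left_side :: "mat2 \<Rightarrow> complex set" where
  "left_side g = moebius g ` {z \<in> upper_half_plane. Re z < 0}"

definition right_side :: "mat2 \<Rightarrow> complex set" where
  "right_side g = moebius g ` {z \<in> upper_half_plane. Re z > 0}"

definition transl_along :: "mat2 \<Rightarrow> real \<Rightarrow> mat2" where
  "transl_along g t = g ** transl t ** matrix_inv g"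

definition geodesic_length :: "mat2 \<Rightarrow> real" where
  "geodesic_length M = 2 * arcosh (trace M / 2)"

text \<open>
  For hyperbolic \<open>M\<close> with positive trace: \<open>g\<close> encodes the axis of \<open>M\<close>, oriented in the
  direction in which \<open>M\<close> translates.
\<close>

definition is_axis :: "mat2 \<Rightarrow> mat2 \<Rightarrow> bool" where
  "is_axis M g \<longleftrightarrow> g \<in> SL2 \<and> trace M > 2 \<and> M = transl_along g (geodesic_length M)"

definition parabolic :: "mat2 \<Rightarrow> bool" where
  "parabolic M \<longleftrightarrow> M \<in> SL2 \<and> \<bar>trace M\<bar> = 2 \<and> M \<noteq> mat 1 \<and> M \<noteq> - mat 1"

section \<open>Marked hyperbolic structures on the once-punctured torus\<close>

text \<open>
  Elements of the free group on \<open>\<alpha>, \<beta>\<close> are given by words; the flag of a letter tells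
  whether it is the generator (True) or its inverse (False).  A homomorphism \<open>\<rho>\<close> from the free
  group to SL(2,R) is given by the pair \<open>A = \<rho>(\<alpha>), B = \<rho>(\<beta>)\<close>.
\<close>

datatype generator = Alpha | Beta

type_synonym gword = "(generator \<times> bool) list"

fun letter_hol :: "mat2 \<Rightarrow> mat2 \<Rightarrow> generator \<times> bool \<Rightarrow> mat2" where
  "letter_hol A B (Alpha, True) = A"
| "letter_hol A B (Alpha, False) = matrix_inv A"
| "letter_hol A B (Beta, True) = B"
| "letter_hol A B (Beta, False) = matrix_inv B"

fun hol :: "mat2 \<Rightarrow> mat2 \<Rightarrow> gword \<Rightarrow> mat2" where
  "hol A B [] = mat 1"
| "hol A B (l # w) = letter_hol A B l ** hol A B w"

definition reduced :: "gword \<Rightarrow> bool" where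
  "reduced w \<longleftrightarrow> successively (\<lambda>k l. \<not> (fst k = fst l \<and> snd k \<noteq> snd l)) w"

text \<open>
  The axis of \<open>B\<close> crosses the axis of \<open>A\<close> from right to left.  (The two axes are
  parametrised so that their crossing point is the image of \<open>\<i>\<close>.)
\<close>

definition positively_crossing :: "mat2 \<Rightarrow> mat2 \<Rightarrow> bool" where
  "positively_crossing A B \<longleftrightarrow>
     (\<exists>g k. is_axis A g \<and> is_axis B k \<and> moebius g \<i> = moebius k \<i> \<and>
       (\<forall>t>0. moebius (k ** transl t) \<i> \<in> left_side g) \<and>
       (\<forall>t<0. moebius (k ** transl t) \<i> \<in> right_side g))"

text \<open>
  A marked complete finite-area hyperbolic structure on the once-punctured torus is given by
  its holonomy, lifted to SL(2,R) with positive traces: a discrete and faithful representation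
  (faithful also as a representation to PSL(2,R)) that maps the peripheral class
  \<open>[\<alpha>, \<beta>]\<close> to a parabolic element.  Parabolicity says that the end of the quotient surface is
  a cusp, i.e. that the complete structure has finite area.  The surface is oriented so that
  \<open>\<alpha>\<close> and \<open>\<beta>\<close> have algebraic intersection number +1; the last conjunct says that the marking
  respects the orientation (without it, one would also admit the mirror image of each
  structure, which has the same traces).
\<close>

definition marked_structure :: "mat2 \<Rightarrow> mat2 \<Rightarrow> bool" where
  "marked_structure A B \<longleftrightarrow>
     A \<in> SL2 \<and> B \<in> SL2 \<and>
     trace A > 0 \<and> trace B > 0 \<and> trace (A ** B) > 0 \<and>
     discrete (range (hol A B)) \<and>
     (\<forall>w. reduced w \<and> w \<noteq> [] \<longrightarrow> hol A B w \<noteq> mat 1 \<and> hol A B w \<noteq> - mat 1) \<and>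
     parabolic (A ** B ** matrix_inv A ** matrix_inv B) \<and>
     positively_crossing A B"

definition trace_coords :: "mat2 \<Rightarrow> mat2 \<Rightarrow> real \<times> real \<times> real" where
  "trace_coords A B = (trace A, trace B, trace (A ** B))"

definition T_tr :: "(real \<times> real \<times> real) set" where
  "T_tr = {(x, y, z). x > 0 \<and> y > 0 \<and> z > 0 \<and> x^2 + y^2 + z^2 - x*y*z - 2 = -2}"

section \<open>The left earthquake about \<open>\<alpha>\<close>\<close>

text \<open>
  The lifts to the universal cover of the closed geodesic in the class of \<open>\<alpha>\<close>, which are the
  translates of the axis of \<open>A\<close> under the holonomy group, oriented like \<open>\<alpha>\<close>.
\<close>

definition lifts_alpha :: "mat2 \<Rightarrow> mat2 \<Rightarrow> mat2 set" where
  "lifts_alpha A B = {hol A B w ** g |w g. is_axis A g}"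

definition cut_plane :: "mat2 \<Rightarrow> mat2 \<Rightarrow> complex set" where
  "cut_plane A B = upper_half_plane - (\<Union>g\<in>lifts_alpha A B. geodesic g)"

text \<open>
  Cutting along \<open>\<alpha>\<close>, twisting to the left by distance \<open>r * \<ell>(\<alpha>)\<close> and regluing, seen in the
  universal cover.  The map \<open>E\<close> is a (discontinuous) lift of the map from the surface
  \<open>(A, B)\<close>, cut along \<open>\<alpha>\<close>, to the surface \<open>(A', B')\<close>:
  away from the lifts of \<open>\<alpha>\<close> it is a local isometry (the pieces are not deformed);
  at a point of a lift \<open>g\<close> of \<open>\<alpha>\<close>, the isometries on the two sides of \<open>g\<close> differ by the
  translation along \<open>g\<close> by distance \<open>r * \<ell>(\<alpha>)\<close>, such that for an observer on one side facing
  \<open>g\<close>, the other side is moved to the left; and it is equivariant with respect to the two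
  holonomy representations, i.e. compatible with the markings.  An observer on the right
  side of \<open>g\<close> who faces \<open>g\<close> has the backward direction of \<open>g\<close> on the left, hence the minus
  sign below; an observer on the left side sees the same relative motion as one to the left.
\<close>

definition earthquake_map ::
    "real \<Rightarrow> mat2 \<Rightarrow> mat2 \<Rightarrow> mat2 \<Rightarrow> mat2 \<Rightarrow> (complex \<Rightarrow> complex) \<Rightarrow> bool" where
  "earthquake_map r A B A' B' E \<longleftrightarrow>
     (\<forall>z\<in>cut_plane A B. \<exists>M\<in>SL2. \<forall>\<^sub>F u in nhds z. E u = moebius M u) \<and>
     (\<forall>g\<in>lifts_alpha A B. \<forall>z\<in>geodesic g. \<exists>M\<in>SL2. \<forall>\<^sub>F u in nhds z.
        (u \<in> right_side g \<longrightarrow> E u = moebius M u) \<and>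
        (u \<in> left_side g \<longrightarrow>
           E u = moebius (M ** transl_along g (- (r * geodesic_length A))) u)) \<and>
     (\<forall>w. \<forall>z\<in>cut_plane A B. E (moebius (hol A B w) z) = moebius (hol A' B' w) (E z))"

definition left_earthquake :: "real \<Rightarrow> mat2 \<Rightarrow> mat2 \<Rightarrow> mat2 \<Rightarrow> mat2 \<Rightarrow> bool" where
  "left_earthquake r A B A' B' \<longleftrightarrow>
     marked_structure A B \<and> marked_structure A' B' \<and> (\<exists>E. earthquake_map r A B A' B' E)"

definition earthquake_tr :: "real \<times> real \<times> real \<Rightarrow> real \<Rightarrow> real \<times> real \<times> real" where
  "earthquake_tr v r =
     (THE v'. \<exists>A B A' B'. left_earthquake r A B A' B' \<and>
        trace_coords A B = v \<and> trace_coords A' B' = v')"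

section \<open>The flow extending the left Dehn twist about \<open>\<alpha>\<close>\<close>

definition C_plus :: "real \<Rightarrow> real \<Rightarrow> real \<Rightarrow> real" where
  "C_plus x y z = (y * (x^2 - 4) + (x*y - 2*z) * sqrt (x^2 - 4)) / (2 * (x^2 - 4))"

definition C_minus :: "real \<Rightarrow> real \<Rightarrow> real \<Rightarrow> real" where
  "C_minus x y z = (y * (x^2 - 4) - (x*y - 2*z) * sqrt (x^2 - 4)) / (2 * (x^2 - 4))"

definition S_plus :: "real \<Rightarrow> real" where
  "S_plus x = (x + sqrt (x^2 - 4)) / 2"

definition S_minus :: "real \<Rightarrow> real" where
  "S_minus x = (x - sqrt (x^2 - 4)) / 2"

definition y_alpha :: "real \<times> real \<times> real \<Rightarrow> real \<Rightarrow> real" where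
  "y_alpha v r = (case v of (x, y, z) \<Rightarrow>
     C_plus x y z * S_plus x powr r + C_minus x y z * S_minus x powr r)"

definition F_tr :: "real \<times> real \<times> real \<Rightarrow> real \<Rightarrow> real \<times> real \<times> real" where
  "F_tr v r = (fst v, y_alpha v r, y_alpha v (r - 1))"

end

theory Submission
  imports Defs
begin

text \<open>
  A marked structure with \<open>\<ell>(\<alpha>) = L\<close> is, up to conjugation, the pair
  \<open>A = transl L\<close>, \<open>B = transl t ** B\<^sub>0\<close>, where \<open>B\<^sub>0\<close> is the translation along the unit circle for
  which the traces of \<open>A\<close> and \<open>B\<^sub>0\<close> satisfy the equation of the cusp; the only remaining
  parameter is the twist \<open>t\<close>.  Its trace coordinates \<open>coords L t\<close> run through all of
  \<open>\<T>\<^sub>t\<^sub>r\<close>, and the formula for \<open>F\<close> says exactly that the flow replaces \<open>t\<close> by \<open>t - r L\<close>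
  (\<open>T_tr_coords\<close>, \<open>F_tr_coords\<close>).  So the claim is that the time-\<open>r\<close> left earthquake multiplies
  the holonomy of \<open>\<beta>\<close> by the translation by \<open>- r L\<close> along the axis of \<open>A\<close>.

  The geometry behind this is the tessellation obtained by cutting the punctured torus along the
  ideal arc disjoint from \<open>\<alpha>\<close>.  What is left is an annulus around \<open>\<alpha>\<close>, and its universal cover is
  a region \<open>cell\<close> around the imaginary axis (the axis of \<open>A\<close>): the complement of infinitely many
  half-discs, which \<open>A\<close> permutes in two orbits, one on the right and one on the left of the axis.
  \<open>B\<close> carries the outside of a right half-disc to the inside of a left one.  Four facts follow.
  By ping-pong (\<open>ping_pong\<close>, \<open>escape\<close>) the pair generates a discrete free group, so every twist
  parameter gives a marked structure.  By the same argument two cells meet at most along an edge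
  (\<open>cell_transition\<close>), so a cell meets no lift of \<open>\<alpha>\<close> other than the imaginary axis.  Each edge is
  equidistant from two neighbouring lifts, so that moving to the neighbouring cell brings a point
  nearer to the axis; discreteness makes this descent stop, hence the cells cover the plane
  (\<open>covering\<close>).  And the cells are locally finite.

  Existence of the earthquake: use the identity on the right half of the basic cell and
  multiplication by \<open>exp (- r L)\<close> on its left half, and extend equivariantly.  The two definitions
  agree across every edge, because the two holonomies of \<open>\<beta>\<close> differ by just this multiplication
  (\<open>ex_earthquake_map\<close>).

  Uniqueness of its trace coordinates: if \<open>g\<close> is the axis of \<open>A\<close>, then \<open>g\<close> and \<open>B\<^sup>-\<^sup>1 g\<close> are
  neighbouring lifts, which a path can join without meeting another lift.  Along this path
  an earthquake map is therefore a single Moebius transformation \<open>M\<close>.  Comparing its values near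
  the two ends of the path by equivariance gives \<open>A' = \<plusminus> M A M\<^sup>-\<^sup>1\<close> and
  \<open>B' = \<plusminus> M transl (- r L) B M\<^sup>-\<^sup>1\<close>, and the traces are positive (\<open>earthquake_trace_coords\<close>).
\<close>

section \<open>Real 2-by-2 matrices and Moebius transformations\<close>

definition mat22 :: "real \<Rightarrow> real \<Rightarrow> real \<Rightarrow> real \<Rightarrow> mat2" where
  "mat22 a b c d = vector [vector [a, b], vector [c, d]]"

lemma mat22_nth [simp]:
  "mat22 a b c d $ 1 $ 1 = a" "mat22 a b c d $ 1 $ 2 = b"
  "mat22 a b c d $ 2 $ 1 = c" "mat22 a b c d $ 2 $ 2 = d"
  by (simp_all add: mat22_def)

lemma mat2_eq_iff:
  "M = N \<longleftrightarrow> M$1$1 = N$1$1 \<and> M$1$2 = N$1$2 \<and> M$2$1 = N$2$1 \<and> M$2$2 = N$2$2" for M N :: mat2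
  by (auto simp: vec_eq_iff forall_2)

lemma mat22_eta: "M = mat22 (M$1$1) (M$1$2) (M$2$1) (M$2$2)"
  by (simp add: mat2_eq_iff)

lemma mat22_eq_iff [simp]:
  "mat22 a b c d = mat22 a' b' c' d' \<longleftrightarrow> a = a' \<and> b = b' \<and> c = c' \<and> d = d'"
  by (simp add: mat2_eq_iff)

lemma mat22_mult [simp]:
  "mat22 a b c d ** mat22 a' b' c' d' =
     mat22 (a*a' + b*c') (a*b' + b*d') (c*a' + d*c') (c*b' + d*d')"
  by (simp add: mat2_eq_iff matrix_matrix_mult_def sum_2)

lemma mat_1_eq_mat22: "mat 1 = mat22 1 0 0 1"
  by (simp add: mat2_eq_iff mat_def)

lemma uminus_mat22 [simp]: "- mat22 a b c d = mat22 (-a) (-b) (-c) (-d)"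
  by (simp add: mat2_eq_iff)

lemma det_mat22 [simp]: "det (mat22 a b c d) = a*d - b*c"
  by (simp add: det_2)

lemma trace_mat22 [simp]: "trace (mat22 a b c d) = a + d"
  by (simp add: trace_def sum_2)

lemma trace_uminus: "trace (- M) = - trace M" for M :: mat2
  by (simp add: trace_def sum_negf)

lemma transl_eq_mat22: "transl t = mat22 (exp (t/2)) 0 0 (exp (-t/2))"
  by (simp add: transl_def mat22_def)

lemma SL2_mat22 [simp]: "mat22 a b c d \<in> SL2 \<longleftrightarrow> a*d - b*c = 1"
  by (simp add: SL2_def)

lemma SL2_cases:
  assumes "M \<in> SL2"
  obtains a b c d where "M = mat22 a b c d" "a*d - b*c = 1"
  using assms mat22_eta[of M] by (metis SL2_mat22)

lemma mat_1_SL2 [simp]: "mat 1 \<in> SL2"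
  by (simp add: mat_1_eq_mat22)

lemma SL2_mult [simp]: "M \<in> SL2 \<Longrightarrow> N \<in> SL2 \<Longrightarrow> M ** N \<in> SL2"
  by (simp add: SL2_def det_mul)

lemma transl_SL2 [simp]: "transl t \<in> SL2"
  by (simp add: transl_eq_mat22 exp_minus)

lemma matrix_inv_eqI:
  fixes M N :: mat2
  assumes "M ** N = mat 1" "N ** M = mat 1"
  shows "matrix_inv M = N"
proof -
  have "\<exists>N'. M ** N' = mat 1 \<and> N' ** M = mat 1" using assms by blast
  then have "matrix_inv M ** M = mat 1" unfolding matrix_inv_def by (rule someI2_ex) blast
  then show ?thesis by (metis assms(1) matrix_mul_assoc matrix_mul_lid matrix_mul_rid)
qed

lemma matrix_inv_SL2:
  assumes "a*d - b*c = 1"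
  shows "matrix_inv (mat22 a b c d) = mat22 d (-b) (-c) a"
proof (rule matrix_inv_eqI)
  show "mat22 a b c d ** mat22 d (-b) (-c) a = mat 1"
    using assms by (simp add: mat_1_eq_mat22 mult.commute)
  show "mat22 d (-b) (-c) a ** mat22 a b c d = mat 1"
    using assms by (simp add: mat_1_eq_mat22 mult.commute)
qed

lemma SL2_inverse [simp]:
  assumes "M \<in> SL2"
  shows "matrix_inv M \<in> SL2" "M ** matrix_inv M = mat 1" "matrix_inv M ** M = mat 1"
    "matrix_inv (matrix_inv M) = M"
proof -
  obtain a b c d where M: "M = mat22 a b c d" "a*d - b*c = 1" using assms by (rule SL2_cases)
  have M': "d*a - (-b)*(-c) = 1"
    using M(2) mult.commute[of d a] minus_mult_minus[of b c] by linarith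
  note [simp] = M(1) matrix_inv_SL2[OF M(2)] matrix_inv_SL2[OF M']
  show "matrix_inv M \<in> SL2" "M ** matrix_inv M = mat 1" "matrix_inv M ** M = mat 1"
    "matrix_inv (matrix_inv M) = M"
    using M(2) M' by (simp_all add: mat_1_eq_mat22 mult.commute)
qed

lemma SL2_cancel:
  assumes "M \<in> SL2"
  shows "M ** (matrix_inv M ** N) = N" "matrix_inv M ** (M ** N) = N"
  using assms by (simp_all add: matrix_mul_assoc)

lemma matrix_inv_mult_SL2:
  assumes "M \<in> SL2" "N \<in> SL2"
  shows "matrix_inv (M ** N) = matrix_inv N ** matrix_inv M"
  using assms by (intro matrix_inv_eqI)
    (simp_all add: SL2_cancel flip: matrix_mul_assoc)

lemma trace_conj:
  assumes "M \<in> SL2"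
  shows "trace (M ** N ** matrix_inv M) = trace N"
  using assms by (metis SL2_inverse(3) matrix_mul_assoc matrix_mul_lid trace_mul_sym)

lemma transl_add: "transl s ** transl t = transl (s + t)"
  by (simp add: transl_eq_mat22 exp_add[symmetric] add_divide_distrib)

lemma transl_0: "transl 0 = mat 1"
  by (simp add: transl_eq_mat22 mat_1_eq_mat22)

lemma matrix_inv_transl: "matrix_inv (transl t) = transl (-t)"
  by (simp add: transl_eq_mat22 matrix_inv_SL2 exp_minus)

lemma moebius_mat22:
  "moebius (mat22 a b c d) z = (of_real a * z + of_real b) / (of_real c * z + of_real d)"
  by (simp add: moebius_def)

lemma moebius_denom_nonzero:
  assumes "a*d - b*c = 1" "Im z > 0"
  shows "complex_of_real c * z + of_real d \<noteq> 0"
proof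
  assume "complex_of_real c * z + of_real d = 0"
  then have "Im (complex_of_real c * z + of_real d) = 0" "Re (complex_of_real c * z + of_real d) = 0"
    by simp_all
  with assms show False by auto
qed

lemma Im_moebius:
  assumes "a*d - b*c = 1"
  shows "Im (moebius (mat22 a b c d) z) = Im z / (cmod (of_real c * z + of_real d))\<^sup>2"
proof -
  have "(a * Im z) * (c * Re z + d) - (a * Re z + b) * (c * Im z) = (a*d - b*c) * Im z"
    by (simp add: algebra_simps)
  with assms show ?thesis
    by (simp add: moebius_mat22 Im_divide cmod_power2)
qed

lemma moebius_upper [simp]:
  assumes "M \<in> SL2" "Im z > 0"
  shows "Im (moebius M z) > 0"
  using assms(1)
proof (rule SL2_cases)
  fix a b c d assume "M = mat22 a b c d" and det: "a*d - b*c = 1"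
  then show ?thesis
    using moebius_denom_nonzero[OF det assms(2)] assms(2) by (simp add: Im_moebius)
qed

lemma moebius_mult:
  assumes "M \<in> SL2" "N \<in> SL2" "Im z > 0"
  shows "moebius (M ** N) z = moebius M (moebius N z)"
proof -
  obtain a b c d where M: "M = mat22 a b c d" "a*d - b*c = 1" using assms(1) by (rule SL2_cases)
  obtain a' b' c' d' where N: "N = mat22 a' b' c' d'" "a'*d' - b'*c' = 1"
    using assms(2) by (rule SL2_cases)
  let ?n = "complex_of_real c' * z + of_real d'"
  have nz: "?n \<noteq> 0" using moebius_denom_nonzero[OF N(2) assms(3)] .
  have *: "\<And>p q. complex_of_real p * moebius N z + of_real q =
      (of_real p * (of_real a' * z + of_real b') + of_real q * ?n) / ?n"
    unfolding N(1) moebius_mat22 using nz by (metis (no_types) add_divide_distrib nonzero_mult_div_cancel_right times_divide_eq_right)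
  have "moebius M (moebius N z) =
     (of_real a * (of_real a' * z + of_real b') + of_real b * ?n) /
     (of_real c * (of_real a' * z + of_real b') + of_real d * ?n)"
    unfolding M(1) moebius_mat22 * using nz by simp
  then show ?thesis by (simp add: M N moebius_mat22 algebra_simps)
qed

lemma moebius_1 [simp]: "moebius (mat 1) z = z"
  by (simp add: mat_1_eq_mat22 moebius_mat22)

lemma moebius_uminus [simp]: "moebius (- M) z = moebius M z"
proof -
  have "moebius (- M) z = (- (of_real (M$1$1) * z + of_real (M$1$2))) / (- (of_real (M$2$1) * z + of_real (M$2$2)))"
    by (simp add: moebius_def)
  then show ?thesis by (simp only: minus_divide_divide moebius_def)
qed

lemma moebius_inverse [simp]:
  assumes "M \<in> SL2" "Im z > 0"
  shows "moebius M (moebius (matrix_inv M) z) = z" "moebius (matrix_inv M) (moebius M z) = z"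
  using assms by (simp_all flip: moebius_mult)

lemma moebius_transl: "moebius (transl t) z = of_real (exp t) * z"
proof -
  have "exp t = exp (t/2) / exp (-t/2)" by (simp flip: exp_diff)
  then show ?thesis by (simp add: transl_eq_mat22 moebius_mat22)
qed

lemma continuous_moebius:
  assumes "M \<in> SL2" "Im z > 0"
  shows "isCont (moebius M) z"
proof -
  obtain a b c d where M: "M = mat22 a b c d" "a*d - b*c = 1" using assms(1) by (rule SL2_cases)
  show ?thesis unfolding M(1) moebius_mat22[abs_def]
    by (intro continuous_intros moebius_denom_nonzero[OF M(2) assms(2)])
qed

lemma eventually_moebius:
  assumes "M \<in> SL2" "Im z > 0" "\<forall>\<^sub>F u in nhds (moebius M z). P u"
  shows "\<forall>\<^sub>F u in nhds z. P (moebius M u)"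
  using continuous_moebius[OF assms(1,2)] assms(3)
  by (metis eventually_compose_filterlim filterlim_iff isCont_def tendsto_at_iff_tendsto_nhds)

lemma eventually_isCont_gt:
  fixes f :: "complex \<Rightarrow> real"
  assumes "isCont f z" "f z > a"
  shows "\<forall>\<^sub>F v in nhds z. f v > a"
  using assms by (intro order_tendstoD(1)[of f "f z"]) (simp_all add: isCont_def tendsto_at_iff_tendsto_nhds)

lemma eventually_upper:
  assumes "Im z > 0"
  shows "\<forall>\<^sub>F u in nhds z. Im u > 0"
  using assms by (intro eventually_nhds_in_open[of "{u. Im u > 0}", simplified] open_halfspace_Im_gt)

text \<open>
  A fixed point of a real Moebius transformation solves a real quadratic equation, which has at
  most one root in the upper half-plane.
\<close>

lemma moebius_two_fixed_points:
  assumes "M \<in> SL2" "Im u > 0" "Im v > 0" "u \<noteq> v" "moebius M u = u" "moebius M v = v"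
  shows "M = mat 1 \<or> M = - mat 1"
proof -
  obtain a b c d where M: "M = mat22 a b c d" "a*d - b*c = 1" using assms(1) by (rule SL2_cases)
  have quad: "complex_of_real c * w * w + of_real (d - a) * w - of_real b = 0"
    if "Im w > 0" "moebius M w = w" for w
    using that moebius_denom_nonzero[OF M(2) that(1)]
    by (simp add: M(1) moebius_mat22 divide_eq_eq algebra_simps)
  have Im: "c * (2 * Re w) + (d - a) = 0" and Re: "c * ((Re w)\<^sup>2 + (Im w)\<^sup>2) = - b"
    if "Im w > 0" "moebius M w = w" for w
  proof -
    have "Im (complex_of_real c * w * w + of_real (d - a) * w - of_real b) = 0"
      using quad[OF that] by simp
    then have "Im w * (c * (2 * Re w) + (d - a)) = 0" by (simp add: algebra_simps)
    with that show *: "c * (2 * Re w) + (d - a) = 0" by simp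
    have "Re (complex_of_real c * w * w + of_real (d - a) * w - of_real b) = 0"
      using quad[OF that] by simp
    then have "c * ((Re w)\<^sup>2 - (Im w)\<^sup>2) + (d - a) * Re w = b" by (simp add: algebra_simps power2_eq_square)
    moreover have "(d - a) * Re w = - c * (2 * Re w) * Re w"
      using * by (metis add.commute eq_neg_iff_add_eq_0 mult_minus_left)
    ultimately show "c * ((Re w)\<^sup>2 + (Im w)\<^sup>2) = - b" by (simp add: algebra_simps power2_eq_square)
  qed
  have "c = 0"
  proof (rule ccontr)
    assume c: "c \<noteq> 0"
    have "c * (2 * Re u) = c * (2 * Re v)"
      using Im[OF assms(2,5)] Im[OF assms(3,6)] by linarith
    with c have eq: "Re u = Re v" by simp
    have "c * ((Re u)\<^sup>2 + (Im u)\<^sup>2) = c * ((Re v)\<^sup>2 + (Im v)\<^sup>2)" using Re[of u] Re[of v] assms by simp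
    with c eq have "(Im u)\<^sup>2 = (Im v)\<^sup>2" by simp
    with assms have "Im u = Im v" by (simp add: power2_eq_iff_nonneg)
    with eq assms show False by (simp add: complex_eq_iff)
  qed
  with Im[of u] Re[of u] assms have "d = a" "b = 0" by auto
  with M \<open>c = 0\<close> show ?thesis by (auto simp: mat_1_eq_mat22 square_eq_1_iff)
qed

lemma moebius_eq_on_open:
  assumes "M \<in> SL2" "N \<in> SL2" "open S" "z \<in> S" "Im z > 0"
    and eq: "\<And>u. u \<in> S \<Longrightarrow> Im u > 0 \<Longrightarrow> moebius M u = moebius N u"
  shows "M = N \<or> M = - N"
proof -
  have "open (S \<inter> {u. Im u > 0})" using assms by (simp add: open_Int open_halfspace_Im_gt)
  then obtain e where e: "e > 0" "ball z e \<subseteq> S \<inter> {u. Im u > 0}"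
    using assms open_contains_ball by (metis IntI mem_Collect_eq)
  define v where "v = z + of_real (e/2)"
  have v: "v \<in> S" "Im v > 0" "v \<noteq> z" using e by (auto simp: v_def dist_norm subset_iff)
  have fixed: "moebius (matrix_inv N ** M) u = u" if "u \<in> S" "Im u > 0" for u
    using eq[OF that] that assms by (simp add: moebius_mult)
  have "matrix_inv N ** M = mat 1 \<or> matrix_inv N ** M = - mat 1"
    using assms v fixed by (intro moebius_two_fixed_points[of _ z v]) auto
  then have "N ** (matrix_inv N ** M) = N \<or> N ** (matrix_inv N ** M) = - N"
    by (elim disjE) (simp_all add: mat2_eq_iff matrix_matrix_mult_def sum_2 mat_1_eq_mat22)
  then show ?thesis using assms by (simp add: SL2_cancel)
qed

text \<open>
  Since two Moebius transformations that agree on an open set are equal, a map that agrees with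
  some Moebius transformation near each point of a connected set agrees with a single one there.
\<close>

lemma locally_moebius_connected:
  assumes "connected J" "J \<noteq> {}" "\<And>z. z \<in> J \<Longrightarrow> Im z > 0"
    and loc: "\<And>z. z \<in> J \<Longrightarrow> \<exists>M\<in>SL2. \<forall>\<^sub>F u in nhds z. E u = moebius M u"
  obtains M where "M \<in> SL2" "\<And>z. z \<in> J \<Longrightarrow> \<forall>\<^sub>F u in nhds z. E u = moebius M u"
proof -
  obtain z0 where z0: "z0 \<in> J" using assms by blast
  obtain M where M: "M \<in> SL2" "\<forall>\<^sub>F u in nhds z0. E u = moebius M u" using loc[OF z0] by blast
  have "\<forall>\<^sub>F u in nhds z. E u = moebius M u" if "z \<in> J" for z
  proof (rule connected_induction_simple[where P = "\<lambda>z. \<forall>\<^sub>F u in nhds z. E u = moebius M u",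
        OF \<open>connected J\<close> z0 that M(2)])
    fix a assume "a \<in> J"
    then obtain N where N: "N \<in> SL2" "\<forall>\<^sub>F u in nhds a. E u = moebius N u" using loc by blast
    then obtain S where S: "open S" "a \<in> S" "\<And>u. u \<in> S \<Longrightarrow> E u = moebius N u"
      unfolding eventually_nhds by blast
    have "\<forall>\<^sub>F u in nhds y. E u = moebius M u"
      if xy: "x \<in> S \<inter> J" "y \<in> S \<inter> J" "\<forall>\<^sub>F u in nhds x. E u = moebius M u" for x y
    proof -
      obtain T where T: "open T" "x \<in> T" "\<And>u. u \<in> T \<Longrightarrow> E u = moebius M u"
        using xy(3) unfolding eventually_nhds by blast
      have "M = N \<or> M = - N"
      proof (rule moebius_eq_on_open[OF M(1) N(1)])
        show "open (S \<inter> T)" using S(1) T(1) by (rule open_Int)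
        show "x \<in> S \<inter> T" using xy(1) T(2) by simp
        show "Im x > 0" using xy(1) assms(3) by simp
        show "moebius M u = moebius N u" if "u \<in> S \<inter> T" for u
          using S(3)[of u] T(3)[of u] that by simp
      qed
      then have "\<And>u. moebius M u = moebius N u" using moebius_uminus by metis
      then have "\<And>u. u \<in> S \<Longrightarrow> E u = moebius M u" using S(3) by simp
      with xy(2) S(1) show ?thesis unfolding eventually_nhds by blast
    qed
    then show "\<exists>T. openin (top_of_set J) T \<and> a \<in> T \<and>
        (\<forall>x\<in>T. \<forall>y\<in>T. (\<forall>\<^sub>F u in nhds x. E u = moebius M u) \<longrightarrow> (\<forall>\<^sub>F u in nhds y. E u = moebius M u))"
      using S(2) \<open>a \<in> J\<close> openin_open_Int[OF S(1), of J] by (metis IntI inf_commute)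
  qed
  with M(1) that show thesis by blast
qed

section \<open>Words in the free group\<close>

lemma letter_hol_SL2 [simp]: "A \<in> SL2 \<Longrightarrow> B \<in> SL2 \<Longrightarrow> letter_hol A B l \<in> SL2"
  by (cases "(A, B, l)" rule: letter_hol.cases) auto

lemma hol_SL2 [simp]: "A \<in> SL2 \<Longrightarrow> B \<in> SL2 \<Longrightarrow> hol A B w \<in> SL2"
  by (induction w) auto

lemma hol_append: "hol A B (v @ w) = hol A B v ** hol A B w"
  by (induction v) (auto simp: matrix_mul_assoc)

fun inv_letter :: "generator \<times> bool \<Rightarrow> generator \<times> bool" where
  "inv_letter (g, b) = (g, \<not> b)"

definition inv_word :: "gword \<Rightarrow> gword" where
  "inv_word w = rev (map inv_letter w)"

lemma letter_hol_inv_letter: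
  assumes "A \<in> SL2" "B \<in> SL2"
  shows "letter_hol A B (inv_letter l) = matrix_inv (letter_hol A B l)"
  using assms by (cases "(A, B, l)" rule: letter_hol.cases) auto

lemma hol_inv_word:
  assumes "A \<in> SL2" "B \<in> SL2"
  shows "hol A B (inv_word w) = matrix_inv (hol A B w)"
proof (induction w)
  case Nil
  have "matrix_inv (mat 1 :: mat2) = mat 1" by (intro matrix_inv_eqI) simp_all
  then show ?case by (simp add: inv_word_def)
next
  case (Cons l w)
  then show ?case using assms
    by (simp add: inv_word_def hol_append matrix_inv_mult_SL2 letter_hol_inv_letter)
qed

lemma reduced_Cons:
  "reduced (k # w) \<longleftrightarrow> reduced w \<and> (w = [] \<or> k \<noteq> inv_letter (hd w))"
  unfolding reduced_def by (cases w; cases k) (auto simp: prod_eq_iff)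

lemma reduced_appendD: "reduced (v @ w) \<Longrightarrow> reduced v \<and> reduced w"
  unfolding reduced_def by (simp add: successively_append_iff)

text \<open>
  Free reduction does not depend on the representation.  The reduced word has to serve the old and
  the new holonomy of the earthquake at the same time.
\<close>

lemma ex_reduced_word:
  "\<exists>w'. reduced w' \<and> (\<forall>A\<in>SL2. \<forall>B\<in>SL2. hol A B w' = hol A B w)"
proof (induction w)
  case Nil
  show ?case by (intro exI[of _ "[]"]) (simp add: reduced_def)
next
  case (Cons l w)
  then obtain w' where w': "reduced w'" "\<And>A B. A \<in> SL2 \<Longrightarrow> B \<in> SL2 \<Longrightarrow> hol A B w' = hol A B w"
    by blast
  show ?case
  proof (cases "w' \<noteq> [] \<and> l = inv_letter (hd w')")
    case True
    then obtain w'' where w'': "w' = hd w' # w''" by (metis list.collapse)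
    have "hol A B w'' = hol A B (l # w)" if AB: "A \<in> SL2" "B \<in> SL2" for A B
    proof -
      have "hol A B w = letter_hol A B (hd w') ** hol A B w''"
        using w'(2)[OF AB] w'' by (metis hol.simps(2))
      then show ?thesis using True AB by (simp add: letter_hol_inv_letter SL2_cancel)
    qed
    moreover have "reduced w''" using w'(1) w'' by (metis reduced_Cons)
    ultimately show ?thesis by blast
  next
    case False
    then have "reduced (l # w')" using w' by (auto simp: reduced_Cons)
    with w' show ?thesis by (intro exI[of _ "l # w'"]) simp
  qed
qed

lemma hol_conj:
  assumes "A \<in> SL2" "B \<in> SL2" "P \<in> SL2"
  shows "hol (P ** A ** matrix_inv P) (P ** B ** matrix_inv P) w = P ** hol A B w ** matrix_inv P"
proof (induction w)
  case Nil
  then show ?case using assms by simp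
next
  case (Cons l w)
  have "letter_hol (P ** A ** matrix_inv P) (P ** B ** matrix_inv P) l =
      P ** letter_hol A B l ** matrix_inv P"
    using assms by (cases "(A, B, l)" rule: letter_hol.cases)
      (auto simp: matrix_inv_mult_SL2 simp flip: matrix_mul_assoc)
  with Cons assms show ?case by (simp add: SL2_cancel flip: matrix_mul_assoc)
qed

definition apow :: "int \<Rightarrow> gword" where
  "apow n = replicate (nat \<bar>n\<bar>) (Alpha, n \<ge> 0)"

lemma hol_replicate_Alpha:
  "hol (transl s) B (replicate n (Alpha, b)) = transl ((if b then s else - s) * of_nat n)"
  by (induction n) (auto simp: transl_0 matrix_inv_transl transl_add algebra_simps)

lemma hol_apow: "hol (transl s) B (apow n) = transl (s * of_int n)"
  by (auto simp: apow_def hol_replicate_Alpha)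

lemma reduced_Alpha_word:
  assumes "reduced w" "\<And>l. l \<in> set w \<Longrightarrow> fst l = Alpha"
  shows "\<exists>b. w = replicate (length w) (Alpha, b)"
  using assms
proof (induction w)
  case (Cons l w)
  have "reduced w" using Cons.prems(1) by (simp add: reduced_Cons)
  moreover have "fst k = Alpha" if "k \<in> set w" for k using Cons.prems(2) that by simp
  ultimately obtain b where b: "w = replicate (length w) (Alpha, b)" using Cons.IH by blast
  have "fst l = Alpha" using Cons.prems(2) by simp
  then obtain b' where l: "l = (Alpha, b')" by (metis prod.collapse)
  show ?case
  proof (cases "w = []")
    case True
    with l show ?thesis by (intro exI[of _ b']) simp
  next
    case False
    then have "hd w = (Alpha, b)" using b by (metis hd_replicate length_0_conv)
    moreover have "l \<noteq> inv_letter (hd w)" using Cons.prems(1) False by (simp add: reduced_Cons)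
    ultimately have "b' = b" unfolding l by simp
    then have "l # w = (Alpha, b) # replicate (length w) (Alpha, b)" unfolding l by (subst b) simp
    then show ?thesis by (intro exI[of _ b]) simp
  qed
qed simp

lemma hol_snoc:
  assumes "A \<in> SL2" "B \<in> SL2" "Im u > 0"
  shows "moebius (hol A B (w @ [l])) u = moebius (hol A B w) (moebius (letter_hol A B l) u)"
  using assms by (simp add: hol_append moebius_mult)

lemma hol_append_moebius:
  assumes "A \<in> SL2" "B \<in> SL2" "Im u > 0"
  shows "moebius (hol A B (v @ w)) u = moebius (hol A B v) (moebius (hol A B w) u)"
  using assms by (simp add: hol_append moebius_mult)

section \<open>The normal form and its basic cell\<close>

text \<open>
  This is \<open>transl t ** B\<^sub>0\<close>, where \<open>B\<^sub>0\<close> translates along the unit circle, from right to left across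
  the imaginary axis.  The translation length of \<open>B\<^sub>0\<close> is determined by the condition that its
  commutator with \<open>transl L\<close> be parabolic.
\<close>

definition genB :: "real \<Rightarrow> real \<Rightarrow> mat2" where
  "genB L t = mat22 (exp (t/2) * cosh (L/2) / sinh (L/2)) (- exp (t/2) / sinh (L/2))
     (- exp (-t/2) / sinh (L/2)) (exp (-t/2) * cosh (L/2) / sinh (L/2))"

text \<open>
  The form is negative on the open half-disc around \<open>c * cosh (L/2)\<close> of radius
  \<open>\<bar>c\<bar> * sinh (L/2)\<close>.  This half-disc lies to the right of the imaginary axis if \<open>c > 0\<close> and to its
  left if \<open>c < 0\<close>, and \<open>transl s\<close> carries the half-disc of \<open>c\<close> to that of \<open>exp s * c\<close>; one real
  parameter thus describes all edges.
\<close>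

definition edge_form :: "real \<Rightarrow> real \<Rightarrow> complex \<Rightarrow> real" where
  "edge_form L c u = (cmod u)\<^sup>2 + c\<^sup>2 - 2 * cosh (L/2) * c * Re u"

definition edges :: "real \<Rightarrow> real \<Rightarrow> real set" where
  "edges L t = range (\<lambda>n::int. exp (L * of_int n)) \<union> range (\<lambda>n::int. - exp (t + L * of_int n))"

text \<open>
  Every half-disc has the endpoints \<open>c * exp (L/2)\<close> and \<open>c * exp (- L/2)\<close>, so that on each side of
  the axis consecutive half-discs touch in an ideal point: the cell is an ideal polygon with
  infinitely many sides.
\<close>

definition cell :: "real \<Rightarrow> real \<Rightarrow> complex set" where
  "cell L t = {u. Im u > 0 \<and> (\<forall>c\<in>edges L t. edge_form L c u \<ge> 0)}"

abbreviation rep :: "real \<Rightarrow> real \<Rightarrow> gword \<Rightarrow> mat2" where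
  "rep L t \<equiv> hol (transl L) (genB L t)"

text \<open>
  This is \<open>sinh\<close> of the hyperbolic distance from the imaginary axis.
\<close>

definition tilt :: "complex \<Rightarrow> real" where
  "tilt u = \<bar>Re u\<bar> / Im u"

text \<open>
  The region into which a reduced word with first letter \<open>l\<close> moves the points outside the
  half-discs: for \<open>\<beta>\<close> and its inverse a single half-disc, for \<open>\<alpha>\<close> and its inverse the images of
  the two basic half-discs under the positive or the negative powers of \<open>transl L\<close>.
\<close>

fun zone :: "real \<Rightarrow> real \<Rightarrow> generator \<times> bool \<Rightarrow> complex \<Rightarrow> bool" where
  "zone L t (Beta, True) u \<longleftrightarrow> edge_form L (- exp t) u < 0"
| "zone L t (Beta, False) u \<longleftrightarrow> edge_form L 1 u < 0"
| "zone L t (Alpha, True) u \<longleftrightarrow> (\<exists>n::int. n \<ge> 1 \<and>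
     (edge_form L (exp (L * of_int n)) u < 0 \<or> edge_form L (- exp (t + L * of_int n)) u < 0))"
| "zone L t (Alpha, False) u \<longleftrightarrow> (\<exists>n::int. n \<le> -1 \<and>
     (edge_form L (exp (L * of_int n)) u < 0 \<or> edge_form L (- exp (t + L * of_int n)) u < 0))"

locale translation_length =
  fixes L :: real
  assumes L_pos: "L > 0"
begin

lemma sinh_pos: "sinh (L/2) > 0" and cosh_gt_1: "cosh (L/2) > 1"
  and cosh_sq: "(cosh (L/2))\<^sup>2 = (sinh (L/2))\<^sup>2 + 1"
proof -
  show "sinh (L/2) > 0" using L_pos by simp
  show "cosh (L/2) > 1" using L_pos cosh_real_ge_1[of "L/2"] cosh_real_one_iff[of "L/2"] by linarith
  show "(cosh (L/2))\<^sup>2 = (sinh (L/2))\<^sup>2 + 1" by (rule cosh_square_eq)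
qed

lemma exp_half_mult: "exp (t/2) * exp (-t/2) = (1::real)"
  by (simp flip: exp_add)

lemma genB_SL2 [simp]: "genB L t \<in> SL2"
proof -
  have "(exp (t/2) * cosh (L/2) / sinh (L/2)) * (exp (-t/2) * cosh (L/2) / sinh (L/2)) -
      (- exp (t/2) / sinh (L/2)) * (- exp (-t/2) / sinh (L/2)) =
      (exp (t/2) * exp (-t/2)) * ((cosh (L/2))\<^sup>2 - 1) / (sinh (L/2))\<^sup>2"
    using sinh_pos by (simp add: field_simps power2_eq_square)
  also have "\<dots> = 1" using sinh_pos unfolding exp_half_mult cosh_sq by simp
  finally show ?thesis by (simp add: genB_def)
qed

lemma transl_genB: "transl s ** genB L t = genB L (s + t)"
proof -
  have "exp ((s + t) / 2) = exp (s/2) * exp (t/2)" "exp (- (s + t) / 2) = exp (-s/2) * exp (-t/2)"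
    by (simp_all add: add_divide_distrib diff_divide_distrib flip: exp_add)
  then show ?thesis by (simp add: genB_def transl_eq_mat22)
qed

lemma moebius_genB:
  "moebius (genB L t) u =
     of_real (exp t) * ((of_real (cosh (L/2)) * u - 1) / (of_real (cosh (L/2)) - u))"
proof -
  have *: "complex_of_real (exp (t/2)) = of_real (exp t) * of_real (exp (-t/2))"
    by (simp flip: of_real_mult exp_add)
  have "moebius (genB L t) u =
     (complex_of_real (exp (t/2) / sinh (L/2)) * (of_real (cosh (L/2)) * u - 1)) /
     (complex_of_real (exp (-t/2) / sinh (L/2)) * (of_real (cosh (L/2)) - u))"
    by (simp add: genB_def moebius_mat22 algebra_simps diff_divide_distrib)
  also have "complex_of_real (exp (t/2) / sinh (L/2)) =
      of_real (exp t) * complex_of_real (exp (-t/2) / sinh (L/2))"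
    using * by simp
  finally show ?thesis using sinh_pos by simp
qed

lemma Re_moebius_genB:
  "Re (moebius (genB L t) u) = exp t * (((cosh (L/2))\<^sup>2 + 1) * Re u - cosh (L/2) * ((cmod u)\<^sup>2 + 1)) /
     ((cosh (L/2) - Re u)\<^sup>2 + (Im u)\<^sup>2)"
  and Im_moebius_genB:
  "Im (moebius (genB L t) u) = exp t * ((sinh (L/2))\<^sup>2 * Im u) /
     ((cosh (L/2) - Re u)\<^sup>2 + (Im u)\<^sup>2)"
proof -
  let ?C = "cosh (L/2)"
  define q where "q = (of_real ?C * u - 1) / (of_real ?C - u)"
  have q: "moebius (genB L t) u = of_real (exp t) * q" by (simp add: q_def moebius_genB)
  have "(?C * Re u - 1) * (?C - Re u) - ?C * Im u * Im u = (?C\<^sup>2 + 1) * Re u - ?C * ((cmod u)\<^sup>2 + 1)"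
    unfolding cmod_power2 by (simp add: algebra_simps power2_eq_square)
  then have "Re q = ((?C\<^sup>2 + 1) * Re u - ?C * ((cmod u)\<^sup>2 + 1)) / ((?C - Re u)\<^sup>2 + (Im u)\<^sup>2)"
    by (simp add: q_def Re_divide)
  then show "Re (moebius (genB L t) u) = exp t * ((?C\<^sup>2 + 1) * Re u - ?C * ((cmod u)\<^sup>2 + 1)) /
     ((?C - Re u)\<^sup>2 + (Im u)\<^sup>2)"
    by (simp add: q)
  have "?C * Im u * (?C - Re u) + (?C * Re u - 1) * Im u = (sinh (L/2))\<^sup>2 * Im u"
    using cosh_sq by (simp add: algebra_simps power2_eq_square)
  then have "Im q = (sinh (L/2))\<^sup>2 * Im u / ((?C - Re u)\<^sup>2 + (Im u)\<^sup>2)"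
    by (simp add: q_def Im_divide)
  then show "Im (moebius (genB L t) u) = exp t * ((sinh (L/2))\<^sup>2 * Im u) /
     ((?C - Re u)\<^sup>2 + (Im u)\<^sup>2)"
    by (simp add: q)
qed

lemma edge_form_scale:
  "edge_form L (exp s * c) (of_real (exp s) * u) = exp (2 * s) * edge_form L c u"
proof -
  have "exp (2 * s) = (exp s)\<^sup>2" by (simp add: exp_double)
  then show ?thesis by (simp add: edge_form_def norm_mult algebra_simps power2_eq_square)
qed

lemma edge_form_minus_cnj: "edge_form L c (- cnj u) = edge_form L (- c) u"
  by (simp add: edge_form_def)

text \<open>
  The sign change is what makes ping-pong work: \<open>genB L t\<close> carries the edge \<open>1\<close> to the edge
  \<open>- exp t\<close> and exchanges the two sides.
\<close>

lemma edge_form_genB: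
  assumes "Im u > 0"
  obtains k where "k > 0" "edge_form L (- exp t) (moebius (genB L t) u) = - k * edge_form L 1 u"
proof
  let ?C = "cosh (L/2)" and ?S = "sinh (L/2)"
  let ?D = "(?C - Re u)\<^sup>2 + (Im u)\<^sup>2"
  have D: "?D > 0" using assms by (intro add_nonneg_pos) auto
  show "exp (2 * t) * ?S\<^sup>2 / ?D > 0" using D sinh_pos by simp
  define b where "b = moebius (genB L 0) u"
  have b: "moebius (genB L t) u = of_real (exp t) * b" by (simp add: b_def moebius_genB)
  let ?N = "(?C\<^sup>2 + 1) * Re u - ?C * ((cmod u)\<^sup>2 + 1)"
  have Re: "Re b = ?N / ?D" by (simp add: b_def Re_moebius_genB)
  have "(cmod b)\<^sup>2 = ((?C * Re u - 1)\<^sup>2 + (?C * Im u)\<^sup>2) / ?D"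
    by (simp add: b_def moebius_genB norm_divide power_divide cmod_power2)
  then have "edge_form L (-1) b = (((?C * Re u - 1)\<^sup>2 + (?C * Im u)\<^sup>2) + ?D + 2 * ?C * ?N) / ?D"
    using less_imp_neq[OF D] unfolding edge_form_def Re by (simp add: add_divide_distrib)
  also have "((?C * Re u - 1)\<^sup>2 + (?C * Im u)\<^sup>2) + ?D + 2 * ?C * ?N = (1 - ?C\<^sup>2) * edge_form L 1 u"
    unfolding edge_form_def cmod_power2 by (simp add: algebra_simps power2_eq_square)
  also have "1 - ?C\<^sup>2 = - (?S\<^sup>2)" using cosh_sq by simp
  finally have "edge_form L (-1) b = - (?S\<^sup>2 / ?D) * edge_form L 1 u" by simp
  then show "edge_form L (- exp t) (moebius (genB L t) u) = - (exp (2 * t) * ?S\<^sup>2 / ?D) * edge_form L 1 u"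
    using edge_form_scale[of t "-1" b] b by simp
qed

lemma edge_form_genB_inv:
  assumes "Im u > 0"
  obtains k where "k > 0"
    "edge_form L 1 (moebius (matrix_inv (genB L t)) u) = - k * edge_form L (- exp t) u"
proof -
  have "Im (moebius (matrix_inv (genB L t)) u) > 0" using assms by simp
  then obtain k where "k > 0"
    "edge_form L (- exp t) (moebius (genB L t) (moebius (matrix_inv (genB L t)) u)) =
      - k * edge_form L 1 (moebius (matrix_inv (genB L t)) u)"
    by (rule edge_form_genB)
  then show thesis using assms by (intro that[of "1 / k"]) simp_all
qed

lemma tilt_scale: "tilt (of_real (exp s) * u) = tilt u"
  by (simp add: tilt_def abs_mult)

text \<open>
  The edge \<open>1\<close> is the locus of points equidistant from the imaginary axis and from its image under
  the inverse of \<open>genB L t\<close>.  A point inside the half-disc is closer to the latter, so \<open>genB L t\<close>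
  brings it closer to the imaginary axis.
\<close>

lemma tilt_genB_less:
  assumes "Im u > 0" "edge_form L 1 u < 0"
  shows "tilt (moebius (genB L t) u) < tilt u"
proof -
  let ?C = "cosh (L/2)" and ?S = "sinh (L/2)"
  let ?D = "(?C - Re u)\<^sup>2 + (Im u)\<^sup>2"
  let ?N = "(?C\<^sup>2 + 1) * Re u - ?C * ((cmod u)\<^sup>2 + 1)"
  have D: "?D > 0" using assms by (intro add_nonneg_pos) auto
  have q: "(cmod u)\<^sup>2 + 1 < 2 * ?C * Re u" using assms(2) by (simp add: edge_form_def)
  have "0 < 2 * ?C * Re u" using q zero_le_power2[of "cmod u"] by linarith
  then have Re: "Re u > 0" using cosh_gt_1 by (simp add: zero_less_mult_iff)
  have "?C * ((cmod u)\<^sup>2 + 1) < ?C * (2 * ?C * Re u)"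
    using q cosh_gt_1 by (intro mult_strict_left_mono) auto
  then have lower: "?N > - ((?C\<^sup>2 - 1) * Re u)" by (simp add: algebra_simps power2_eq_square)
  have "(Re u - 1)\<^sup>2 + (Im u)\<^sup>2 > 0" using assms by (intro add_nonneg_pos) auto
  then have "(cmod u)\<^sup>2 + 1 > 2 * Re u" unfolding cmod_power2 by (simp add: algebra_simps power2_eq_square)
  then have "?C * ((cmod u)\<^sup>2 + 1) > 1 * (2 * Re u)"
    using cosh_gt_1 Re by (intro mult_strict_mono) auto
  then have upper: "?N < (?C\<^sup>2 - 1) * Re u" by (simp add: algebra_simps)
  have "\<bar>?N\<bar> < ?S\<^sup>2 * Re u" using lower upper cosh_sq by (simp add: abs_less_iff)
  have "tilt (moebius (genB L t) u) = \<bar>?N\<bar> / (?S\<^sup>2 * Im u)"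
    using D by (simp add: tilt_def Re_moebius_genB Im_moebius_genB abs_mult)
  also have "\<dots> < (?S\<^sup>2 * Re u) / (?S\<^sup>2 * Im u)"
    using \<open>\<bar>?N\<bar> < ?S\<^sup>2 * Re u\<close> assms(1) sinh_pos by (intro divide_strict_right_mono) simp_all
  also have "\<dots> = tilt u" using Re sinh_pos by (simp add: tilt_def)
  finally show ?thesis .
qed

text \<open>
  Reflection in the imaginary axis conjugates \<open>genB L 0\<close> to its inverse.
\<close>

lemma moebius_genB_inv_reflect:
  "moebius (matrix_inv (genB L t)) u = - cnj (moebius (genB L 0) (- cnj (of_real (exp (- t)) * u)))"
proof -
  let ?C = "cosh (L/2)" and ?S = "sinh (L/2)"
  have det: "(exp (t/2) * ?C / ?S) * (exp (-t/2) * ?C / ?S) -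
      (- exp (t/2) / ?S) * (- exp (-t/2) / ?S) = 1"
    using genB_SL2[of t] unfolding genB_def SL2_mat22 .
  define k where "k = complex_of_real (exp (t/2)) / of_real ?S"
  have k: "k \<noteq> 0" using sinh_pos by (simp add: k_def)
  have e: "complex_of_real (exp (-t/2)) = of_real (exp (t/2)) * of_real (exp (- t))"
    by (simp flip: of_real_mult exp_add)
  have "moebius (matrix_inv (genB L t)) u =
     (of_real (exp (-t/2)) * of_real ?C / of_real ?S * u + of_real (exp (t/2)) / of_real ?S) /
     (of_real (exp (-t/2)) / of_real ?S * u + of_real (exp (t/2)) * of_real ?C / of_real ?S)"
    unfolding genB_def matrix_inv_SL2[OF det] moebius_mat22 by simp
  also have "\<dots> = (k * (of_real ?C * (of_real (exp (- t)) * u) + 1)) /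
     (k * (of_real (exp (- t)) * u + of_real ?C))"
    unfolding e k_def by (rule arg_cong2[where f = "(/)"]; simp add: algebra_simps add_divide_distrib)
  also have "\<dots> = (of_real ?C * (of_real (exp (- t)) * u) + 1) / (of_real (exp (- t)) * u + of_real ?C)"
    using k by (rule mult_divide_mult_cancel_left)
  also have "\<dots> = - cnj (moebius (genB L 0) (- cnj (of_real (exp (- t)) * u)))"
    by (simp add: moebius_genB add.commute minus_divide_left del: minus_divide_left[symmetric])
  finally show ?thesis .
qed

lemma tilt_genB_inv_less:
  assumes "Im u > 0" "edge_form L (- exp t) u < 0"
  shows "tilt (moebius (matrix_inv (genB L t)) u) < tilt u"
proof -
  define v where "v = - cnj (of_real (exp (- t)) * u)"
  have "edge_form L 1 v = edge_form L (- 1) (of_real (exp (- t)) * u)"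
    unfolding v_def by (rule edge_form_minus_cnj)
  also have "\<dots> = exp (2 * (- t)) * edge_form L (- exp t) u"
    using edge_form_scale[of "-t" "- exp t" u] by (simp flip: exp_add)
  finally have "edge_form L 1 v = exp (2 * (- t)) * edge_form L (- exp t) u" .
  then have "edge_form L 1 v < 0" using assms by (simp add: mult_pos_neg)
  moreover have "Im v > 0" using assms by (simp add: v_def)
  ultimately have "tilt (moebius (genB L 0) v) < tilt v" by (intro tilt_genB_less)
  moreover have "tilt (- cnj w) = tilt w" for w by (simp add: tilt_def)
  moreover have "tilt v = tilt u" unfolding v_def by (simp add: tilt_def abs_mult)
  ultimately show ?thesis unfolding moebius_genB_inv_reflect v_def[symmetric] by simp
qed

lemma edges_nonzero: "c \<in> edges L t \<Longrightarrow> c \<noteq> 0"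
  by (auto simp: edges_def)

lemma one_in_edges: "1 \<in> edges L t"
  unfolding edges_def by (intro UnI1 range_eqI[of _ _ 0]) simp

lemma minus_exp_in_edges: "- exp t \<in> edges L t"
  unfolding edges_def by (intro UnI2 range_eqI[of _ _ 0]) simp

text \<open>
  A point of the half-disc with parameter \<open>c\<close> has modulus strictly between \<open>\<bar>c\<bar> * exp (- L/2)\<close> and
  \<open>\<bar>c\<bar> * exp (L/2)\<close>, since \<open>cosh (ln \<bar>u\<bar> - ln \<bar>c\<bar>) < cosh (L/2)\<close>.
\<close>

lemma edge_form_nonpos_imp:
  assumes "Im u > 0" "c \<noteq> 0" "edge_form L c u \<le> 0"
  shows "c * Re u > 0" "\<bar>ln (cmod u) - ln \<bar>c\<bar>\<bar> < L/2"
proof -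
  let ?C = "cosh (L/2)"
  have u: "cmod u > 0" using assms by auto
  have q: "(cmod u)\<^sup>2 + c\<^sup>2 \<le> 2 * ?C * (c * Re u)" using assms(3) by (simp add: edge_form_def)
  have "0 < (cmod u)\<^sup>2 + c\<^sup>2" using u by (simp add: add_pos_nonneg)
  then have "0 < 2 * ?C * (c * Re u)" using q by linarith
  then show pos: "c * Re u > 0" using cosh_gt_1 by (simp add: zero_less_mult_iff)
  have "\<bar>Re u\<bar>\<^sup>2 < (cmod u)\<^sup>2" using assms(1) by (simp add: cmod_power2)
  then have "\<bar>Re u\<bar> < cmod u" by (rule power2_less_imp_less) simp
  then have "c * Re u < \<bar>c\<bar> * cmod u"
    using assms(2) pos by (metis abs_mult abs_of_pos mult_strict_left_mono zero_less_abs_iff)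
  then have "(cmod u)\<^sup>2 + c\<^sup>2 < 2 * ?C * (\<bar>c\<bar> * cmod u)"
    using q cosh_gt_1 by (smt (verit) mult_strict_left_mono)
  moreover define a b where "a = ln (cmod u)" and "b = ln \<bar>c\<bar>"
  have ab: "cmod u = exp a" "\<bar>c\<bar> = exp b" using u assms(2) by (simp_all add: a_def b_def)
  moreover have "c\<^sup>2 = (exp b)\<^sup>2" using ab(2) by (metis power2_abs)
  ultimately have "exp a ^ 2 + exp b ^ 2 < 2 * ?C * (exp b * exp a)" by simp
  moreover have "exp (a + b) * (exp (a - b) + exp (b - a)) = exp a ^ 2 + exp b ^ 2"
    by (simp add: distrib_left power2_eq_square flip: exp_add)
  moreover have "exp (a + b) * (2 * ?C) = 2 * ?C * (exp b * exp a)"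
    by (simp add: exp_add)
  ultimately have "exp (a + b) * (exp (a - b) + exp (b - a)) < exp (a + b) * (2 * ?C)" by linarith
  then have "cosh (a - b) < ?C" by (simp add: cosh_field_def)
  then have "cosh \<bar>a - b\<bar> < ?C" by simp
  then have "\<bar>a - b\<bar> < L/2" using L_pos by (subst (asm) cosh_real_nonneg_less_iff) auto
  then show "\<bar>ln (cmod u) - ln \<bar>c\<bar>\<bar> < L/2" by (simp add: a_def b_def)
qed

text \<open>
  The parameters of different edges on one side have logarithms at distance at least \<open>L\<close>, so the
  annuli that contain the half-discs are disjoint.
\<close>

lemma edge_unique:
  assumes "Im u > 0" "c \<in> edges L t" "c' \<in> edges L t" "edge_form L c u \<le> 0" "edge_form L c' u \<le> 0"
  shows "c = c'"
proof -
  note c = edge_form_nonpos_imp[OF assms(1) edges_nonzero[OF assms(2)] assms(4)]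
  note c' = edge_form_nonpos_imp[OF assms(1) edges_nonzero[OF assms(3)] assms(5)]
  have close: "\<bar>ln \<bar>c\<bar> - ln \<bar>c'\<bar>\<bar> < L" using c(2) c'(2) by linarith
  have sgn: "c * c' > 0" using c(1) c'(1) by (auto simp: zero_less_mult_iff)
  have int: "m = n" if "\<bar>L * of_int m - L * of_int n\<bar> < L" for m n :: int
  proof -
    have "L * \<bar>of_int (m - n)\<bar> < L * 1" using that L_pos by (simp add: abs_mult flip: right_diff_distrib)
    then have "\<bar>real_of_int (m - n)\<bar> < 1" using L_pos by (subst (asm) mult_less_cancel_left_pos)
    then show ?thesis by linarith
  qed
  from assms(2,3) sgn consider m n :: int where "c = exp (L * of_int m)" "c' = exp (L * of_int n)"
    | m n :: int where "c = - exp (t + L * of_int m)" "c' = - exp (t + L * of_int n)"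
    unfolding edges_def by (auto simp: zero_less_mult_iff)
  then show ?thesis using close by cases (auto dest!: int)
qed

lemma edges_scale: "exp (L * of_int n) * c \<in> edges L t \<longleftrightarrow> c \<in> edges L t" for n :: int
proof -
  have *: "exp (L * of_int n) * c \<in> edges L t" if "c \<in> edges L t" for n :: int and c
    using that unfolding edges_def
  proof (elim UnE rangeE)
    fix m :: int assume "c = exp (L * of_int m)"
    then have "exp (L * of_int n) * c = exp (L * of_int (n + m))"
      by (simp add: distrib_left flip: exp_add)
    then show "exp (L * of_int n) * c \<in> range (\<lambda>n::int. exp (L * of_int n)) \<union>
      range (\<lambda>n::int. - exp (t + L * of_int n))" by blast
  next
    fix m :: int assume "c = - exp (t + L * of_int m)"
    then have "exp (L * of_int n) * c = - exp (t + L * of_int (n + m))"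
      by (simp add: algebra_simps flip: exp_add)
    then show "exp (L * of_int n) * c \<in> range (\<lambda>n::int. exp (L * of_int n)) \<union>
      range (\<lambda>n::int. - exp (t + L * of_int n))" by blast
  qed
  have "exp (L * of_int (- n)) * (exp (L * of_int n) * c) = c"
    by (simp flip: exp_add mult.assoc)
  then show ?thesis using * by metis
qed

lemma edge_form_scale_edges:
  fixes n :: int
  assumes "c \<in> edges L t"
  obtains d k where "d \<in> edges L t" "k > 0"
    "edge_form L c (of_real (exp (L * of_int n)) * u) = k * edge_form L d u"
proof
  define d where "d = exp (L * of_int (- n)) * c"
  show "d \<in> edges L t" using assms unfolding d_def edges_scale .
  have "c = exp (L * of_int n) * d"
    by (simp add: d_def flip: exp_add mult.assoc)
  then show "edge_form L c (of_real (exp (L * of_int n)) * u) = exp (2 * (L * of_int n)) * edge_form L d u"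
    using edge_form_scale[of "L * of_int n" d u] by simp
qed simp

lemma cell_scale:
  fixes n :: int
  assumes "u \<in> cell L t"
  shows "of_real (exp (L * of_int n)) * u \<in> cell L t"
proof -
  have "edge_form L c (of_real (exp (L * of_int n)) * u) \<ge> 0" if c: "c \<in> edges L t" for c
  proof -
    obtain d k where "d \<in> edges L t" "k > 0"
      "edge_form L c (of_real (exp (L * of_int n)) * u) = k * edge_form L d u"
      using c by (rule edge_form_scale_edges)
    with assms show ?thesis by (simp add: cell_def)
  qed
  with assms show ?thesis by (simp add: cell_def)
qed

lemma zone_edge:
  assumes "zone L t k u"
  obtains c where "c \<in> edges L t" "edge_form L c u < 0" "k \<noteq> (Beta, False) \<Longrightarrow> c \<noteq> 1"
    "k \<noteq> (Beta, True) \<Longrightarrow> c \<noteq> - exp t"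
proof -
  note witness = that
  have neg: "x \<noteq> - exp s" "- exp s \<noteq> x" if "x > 0" for s x :: real
    using exp_gt_zero[of s] that by linarith+
  have neq: "- exp t \<noteq> 1" "1 \<noteq> - exp t" "- exp (t + L * of_int n) \<noteq> 1" "exp (L * of_int n) \<noteq> - exp t" for n :: int
    by (rule neg, simp)+
  have *: ?thesis if "n \<noteq> 0" "k = (Alpha, b)"
    "edge_form L (exp (L * of_int n)) u < 0 \<or> edge_form L (- exp (t + L * of_int n)) u < 0" for n :: int and b
    using that(3)
  proof
    assume "edge_form L (exp (L * of_int n)) u < 0"
    with that(1,2) neq L_pos show ?thesis
      by (intro witness[of "exp (L * of_int n)"]) (auto simp: edges_def)
  next
    assume "edge_form L (- exp (t + L * of_int n)) u < 0"
    with that(1,2) neq L_pos show ?thesis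
      by (intro witness[of "- exp (t + L * of_int n)"]) (auto simp: edges_def)
  qed
  show ?thesis
  proof (cases "(L, t, k, u)" rule: zone.cases)
    case (1 L' t' u') with assms neq show ?thesis by (intro witness[OF minus_exp_in_edges]) auto
  next
    case (2 L' t' u') with assms neq show ?thesis by (intro witness[OF one_in_edges]) auto
  next
    case (3 L' t' u')
    then obtain n :: int where "n \<ge> 1" "edge_form L (exp (L * of_int n)) u < 0 \<or>
      edge_form L (- exp (t + L * of_int n)) u < 0" using assms by auto
    with 3 show ?thesis by (intro *[of n True]) auto
  next
    case (4 L' t' u')
    then obtain n :: int where "n \<le> -1" "edge_form L (exp (L * of_int n)) u < 0 \<or>
      edge_form L (- exp (t + L * of_int n)) u < 0" using assms by auto
    with 4 show ?thesis by (intro *[of n False]) auto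
  qed
qed

lemma edge_form_scale_L:
  "edge_form L (exp (L * of_int (n + 1))) (of_real (exp L) * u) = exp (2 * L) * edge_form L (exp (L * of_int n)) u"
  "edge_form L (- exp (t + L * of_int (n + 1))) (of_real (exp L) * u) =
     exp (2 * L) * edge_form L (- exp (t + L * of_int n)) u"
  "edge_form L (exp (L * of_int (n - 1))) (of_real (exp (-L)) * u) = exp (2 * (-L)) * edge_form L (exp (L * of_int n)) u"
  "edge_form L (- exp (t + L * of_int (n - 1))) (of_real (exp (-L)) * u) =
     exp (2 * (-L)) * edge_form L (- exp (t + L * of_int n)) u" for n :: int
  unfolding edge_form_scale[symmetric]
  by (rule arg_cong2[where f = "edge_form L"]; simp add: algebra_simps flip: exp_add)+

lemma enter_zone:
  assumes "Im u > 0" "b \<Longrightarrow> edge_form L 1 u > 0" "\<not> b \<Longrightarrow> edge_form L (- exp t) u > 0"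
  shows "zone L t (Beta, b) (moebius (letter_hol (transl L) (genB L t) (Beta, b)) u)"
proof (cases b)
  case True
  obtain k where "k > 0" "edge_form L (- exp t) (moebius (genB L t) u) = - k * edge_form L 1 u"
    using edge_form_genB[OF assms(1)] by blast
  with True assms(2) show ?thesis by (simp add: mult_pos_pos)
next
  case False
  obtain k where "k > 0" "edge_form L 1 (moebius (matrix_inv (genB L t)) u) = - k * edge_form L (- exp t) u"
    using edge_form_genB_inv[OF assms(1)] by blast
  with False assms(3) show ?thesis by (simp add: mult_pos_pos)
qed

text \<open>
  The zone of \<open>k\<close> avoids the half-disc that the letter \<open>l\<close> turns inside out, because \<open>l\<close> does not
  cancel \<open>k\<close>.
\<close>

lemma zone_step:
  assumes "Im u > 0" "zone L t k u" "l \<noteq> inv_letter k"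
  shows "zone L t l (moebius (letter_hol (transl L) (genB L t) l) u)"
proof -
  obtain c where c: "c \<in> edges L t" "edge_form L c u < 0" "k \<noteq> (Beta, False) \<Longrightarrow> c \<noteq> 1"
    "k \<noteq> (Beta, True) \<Longrightarrow> c \<noteq> - exp t"
    using zone_edge[OF assms(2)] by metis
  have other: "edge_form L c' u > 0" if "c' \<in> edges L t" "c \<noteq> c'" for c'
    using edge_unique[OF assms(1) c(1) that(1)] c(2) that(2) by (meson less_imp_le not_le_imp_less)
  have shift: "\<exists>n::int. P n \<and> (edge_form L (exp (L * of_int n)) u < 0 \<or> edge_form L (- exp (t + L * of_int n)) u < 0)"
    if "P 0" "k = (Alpha, True) \<Longrightarrow> \<forall>n\<ge>1. P n" 
      "k = (Alpha, False) \<Longrightarrow> \<forall>n\<le>-1. P n" for P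
  proof (cases "(L, t, k, u)" rule: zone.cases)
    case 1 with assms that show ?thesis by (intro exI[of _ 0]) auto
  next
    case 2 with assms that show ?thesis by (intro exI[of _ 0]) auto
  next
    case 3 with assms that show ?thesis by auto
  next
    case 4 with assms that show ?thesis by auto
  qed
  show ?thesis
  proof (cases "(L, t, l, u)" rule: zone.cases)
    case (1 L' t' u')
    then have "k \<noteq> (Beta, False)" using assms(3) by auto
    then have "c \<noteq> 1" by (rule c(3))
    then have "edge_form L 1 u > 0" using other one_in_edges by blast
    with assms(1) 1 show ?thesis using enter_zone[of u True t] by simp
  next
    case (2 L' t' u')
    then have "k \<noteq> (Beta, True)" using assms(3) by auto
    then have "c \<noteq> - exp t" by (rule c(4))
    then have "edge_form L (- exp t) u > 0" using other minus_exp_in_edges by blast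
    with assms(1) 2 show ?thesis using enter_zone[of u False t] by simp
  next
    case (3 L' t' u')
    then have "k \<noteq> (Alpha, False)" using assms(3) by auto
    then obtain n :: int where "n \<ge> 0"
      "edge_form L (exp (L * of_int n)) u < 0 \<or> edge_form L (- exp (t + L * of_int n)) u < 0"
      using shift[of "\<lambda>n. n \<ge> 0"] by auto
    then have "n + 1 \<ge> 1" "edge_form L (exp (L * of_int (n + 1))) (of_real (exp L) * u) < 0 \<or>
        edge_form L (- exp (t + L * of_int (n + 1))) (of_real (exp L) * u) < 0"
      unfolding edge_form_scale_L by (auto simp: mult_pos_neg)
    then show ?thesis using 3 by (auto simp only: letter_hol.simps zone.simps moebius_transl prod.inject)
  next
    case (4 L' t' u')
    then have "k \<noteq> (Alpha, True)" using assms(3) by auto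
    then obtain n :: int where "n \<le> 0"
      "edge_form L (exp (L * of_int n)) u < 0 \<or> edge_form L (- exp (t + L * of_int n)) u < 0"
      using shift[of "\<lambda>n. n \<le> 0"] by auto
    then have "n - 1 \<le> -1" "edge_form L (exp (L * of_int (n - 1))) (of_real (exp (-L)) * u) < 0 \<or>
        edge_form L (- exp (t + L * of_int (n - 1))) (of_real (exp (-L)) * u) < 0"
      unfolding edge_form_scale_L by (auto simp: mult_pos_neg)
    then show ?thesis using 4
      by (auto simp only: letter_hol.simps zone.simps moebius_transl prod.inject matrix_inv_transl)
  qed
qed

lemma ping_pong:
  assumes "reduced (w @ [l])" "Im u > 0" "zone L t l u"
  shows "zone L t (hd (w @ [l])) (moebius (rep L t w) u)"
  using assms(1)
proof (induction w)
  case Nil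
  then show ?case using assms by simp
next
  case (Cons k w)
  then have "reduced (w @ [l])" "k \<noteq> inv_letter (hd (w @ [l]))" by (auto simp: reduced_Cons)
  moreover have "moebius (rep L t (k # w)) u =
      moebius (letter_hol (transl L) (genB L t) k) (moebius (rep L t w) u)"
    using assms(2) by (simp add: moebius_mult)
  ultimately show ?case using Cons zone_step[of "moebius (rep L t w) u" t "hd (w @ [l])" k] assms(2) by simp
qed


text \<open>
  Initial powers of \<open>\<alpha>\<close> only rescale \<open>u\<close>; the first occurrence of \<open>\<beta>\<close> moves it into a zone, and
  from then on ping-pong keeps it in half-discs.
\<close>

lemma escape:
  assumes "reduced w" "w \<noteq> []" "Im u > 0" and free: "\<And>c. c \<in> edges L t \<Longrightarrow> edge_form L c u > 0"
  shows "(\<exists>n::int. n \<noteq> 0 \<and> moebius (rep L t w) u = of_real (exp (L * of_int n)) * u) \<or>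
    (\<exists>c\<in>edges L t. edge_form L c (moebius (rep L t w) u) < 0)"
proof (cases "\<forall>l\<in>set w. fst l = Alpha")
  case True
  then obtain b where b: "w = replicate (length w) (Alpha, b)" using reduced_Alpha_word assms(1) by blast
  define n where "n = (if b then int (length w) else - int (length w))"
  have "rep L t w = transl (L * of_int n)"
    by (subst b) (simp add: hol_replicate_Alpha n_def)
  moreover have "n \<noteq> 0" using assms(2) by (simp add: n_def)
  ultimately show ?thesis by (auto simp: moebius_transl)
next
  case False
  then obtain w1 l w2 where w: "w = w1 @ l # w2" "fst l \<noteq> Alpha" "\<forall>l\<in>set w2. \<not> fst l \<noteq> Alpha"
    using split_list_last_prop[of w "\<lambda>l. fst l \<noteq> Alpha"] by blast
  have red: "reduced (w1 @ [l])" "reduced w2"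
    using reduced_appendD[of "w1 @ [l]" w2] assms(1) w(1) by auto
  obtain b where b: "w2 = replicate (length w2) (Alpha, b)"
    using reduced_Alpha_word[OF red(2)] w(3) by blast
  define n where "n = (if b then int (length w2) else - int (length w2))"
  define v where "v = of_real (exp (L * of_int n)) * u"
  have "rep L t w2 = transl (L * of_int n)"
    by (subst b) (simp add: hol_replicate_Alpha n_def)
  then have v: "moebius (rep L t w2) u = v" by (simp add: v_def moebius_transl)
  have Im: "Im v > 0" using assms(3) by (simp add: v_def)
  have free': "edge_form L c v > 0" if c: "c \<in> edges L t" for c
  proof -
    obtain d k where "d \<in> edges L t" "k > 0" "edge_form L c v = k * edge_form L d u"
      using edge_form_scale_edges[OF c, of n u] unfolding v_def by blast
    with free show ?thesis by simp
  qed
  obtain b' where l: "l = (Beta, b')" using w(2) by (cases l; cases "fst l") auto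
  have "moebius (rep L t w) u = moebius (rep L t (w1 @ [l])) v"
    using hol_append_moebius[of "transl L" "genB L t" u "w1 @ [l]" w2] assms(3) w(1) v by simp
  also have "\<dots> = moebius (rep L t w1) (moebius (letter_hol (transl L) (genB L t) l) v)"
    using Im by (simp add: hol_snoc)
  finally have eq: "moebius (rep L t w) u = \<dots>" .
  have "zone L t l (moebius (letter_hol (transl L) (genB L t) l) v)"
    unfolding l using enter_zone[OF Im] free' one_in_edges minus_exp_in_edges
    by blast
  then have "zone L t (hd (w1 @ [l])) (moebius (rep L t w) u)"
    unfolding eq using Im by (intro ping_pong red) auto
  then show ?thesis using zone_edge by metis
qed

section \<open>Discreteness\<close>

text \<open>
  By \<open>escape\<close> the orbit of \<open>\<i>\<close> returns to the cell only along the imaginary axis, by factors that are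
  powers of \<open>exp L\<close>.  Around \<open>\<i>\<close>, a cone of the cell between the moduli \<open>exp (- L)\<close> and \<open>exp L\<close>
  contains no other point of the orbit.
\<close>

lemma near_basepoint:
  "\<forall>\<^sub>F z in nhds \<i>. \<forall>w. moebius (rep L t w) \<i> = z \<longrightarrow> rep L t w = mat 1"
proof -
  let ?C = "cosh (L/2)"
  let ?U = "{z. ?C * \<bar>Re z\<bar> < cmod z} \<inter> {z. exp (- L) < cmod z} \<inter> {z. cmod z < exp L}"
  have "open ?U" by (intro open_Int open_Collect_less continuous_intros)
  moreover have "\<i> \<in> ?U" using L_pos by simp
  moreover have "rep L t w = mat 1" if w: "moebius (rep L t w) \<i> \<in> ?U" for w
  proof -
    obtain w' where w': "reduced w'" "rep L t w' = rep L t w" using ex_reduced_word[of w] by fastforce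
    define z where "z = moebius (rep L t w') \<i>"
    have z: "z \<in> ?U" using w w'(2) by (simp add: z_def)
    have free: "edge_form L c \<i> > 0" if "c \<in> edges L t" for c
      using edges_nonzero[OF that] by (simp add: edge_form_def add_pos_nonneg)
    have 1: "\<not> (\<exists>n::int. n \<noteq> 0 \<and> z = of_real (exp (L * of_int n)) * \<i>)"
    proof clarify
      fix n :: int assume "n \<noteq> 0" "z = of_real (exp (L * of_int n)) * \<i>"
      then have "- L < L * of_int n" "L * of_int n < L" using z by (auto simp: norm_mult)
      then have "L * (-1) < L * of_int n" "L * of_int n < L * 1" by simp_all
      then have "-1 < n" "n < 1" using L_pos by (auto simp only: mult_less_cancel_left_pos)
      with \<open>n \<noteq> 0\<close> show False by simp
    qed
    have 2: "\<not> (edge_form L c z < 0)" if "c \<in> edges L t" for c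
    proof
      assume "edge_form L c z < 0"
      then have "(cmod z)\<^sup>2 + c\<^sup>2 < 2 * (?C * (c * Re z))" by (simp add: edge_form_def)
      also have "?C * (c * Re z) \<le> \<bar>c\<bar> * (?C * \<bar>Re z\<bar>)"
        by (metis abs_ge_self abs_mult cosh_real_nonneg mult.left_commute mult_left_mono)
      also have "\<dots> \<le> \<bar>c\<bar> * cmod z" using z by (intro mult_left_mono) auto
      finally have "(cmod z - \<bar>c\<bar>)\<^sup>2 < 0" by (simp add: power2_diff mult_ac)
      then show False by simp
    qed
    have "w' = []"
    proof (rule ccontr)
      assume "w' \<noteq> []"
      from escape[OF w'(1) this, of \<i> t] free 1 2 show False by (auto simp: z_def)
    qed
    with w'(2) show ?thesis by simp
  qed
  ultimately show ?thesis unfolding eventually_nhds by blast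
qed

text \<open>
  Allowing an arbitrary matrix \<open>X\<close>, not only elements of the group, gives at the same time that the
  group is discrete and that it has no accumulation points in \<open>SL(2,R)\<close>.  For \<open>M, N\<close> near \<open>X\<close> the
  matrix \<open>M\<^sup>-\<^sup>1 N\<close> moves \<open>\<i>\<close> only a little, so \<open>near_basepoint\<close> applies to it.
\<close>

lemma rep_locally_unique:
  assumes "X \<in> SL2"
  obtains U where "open U" "X \<in> U"
    "\<And>M N. M \<in> U \<inter> range (rep L t) \<Longrightarrow> N \<in> U \<inter> range (rep L t) \<Longrightarrow> M = N"
proof -
  \<comment> \<open>the action of \<open>M\<^sup>-\<^sup>1 N\<close> on \<open>\<i>\<close> as a function of the matrix entries, defined for all matrices near \<open>X\<close>\<close>
  define f where "f N = (of_real (N$1$1) * \<i> + of_real (N$1$2)) / (of_real (N$2$1) * \<i> + of_real (N$2$2))" for N :: mat2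
  define F where "F p = (of_real (fst p $2$2) * f (snd p) + of_real (- fst p $1$2)) /
     (of_real (- fst p $2$1) * f (snd p) + of_real (fst p $1$1))" for p :: "mat2 \<times> mat2"
  have F: "F (M, N) = moebius (matrix_inv M) (moebius N \<i>)" if "M \<in> SL2" for M N
    using that by (elim SL2_cases) (simp add: F_def f_def matrix_inv_SL2 moebius_mat22 moebius_def)
  obtain a b c d where X: "X = mat22 a b c d" "a*d - b*c = 1" using assms by (rule SL2_cases)
  have d1: "complex_of_real (X$2$1) * \<i> + of_real (X$2$2) \<noteq> 0"
    unfolding X using moebius_denom_nonzero[OF X(2), of \<i>] by simp
  have "f X = moebius X \<i>" by (simp add: f_def moebius_def)
  then have "Im (f X) > 0" using assms by simp
  then have d2: "of_real (- X$2$1) * f X + of_real (X$1$1) \<noteq> 0"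
    using X(2) unfolding X(1) by (intro moebius_denom_nonzero[where b = "- b" and a = d])
      (auto simp: mult.commute)
  have "isCont F (X, X)"
    unfolding F_def[abs_def] f_def[abs_def] using d1 d2
    by (intro continuous_intros) (auto simp: f_def)
  moreover have "F (X, X) = \<i>" using F assms by simp
  ultimately have lim: "filterlim F (nhds \<i>) (nhds (X, X))"
    by (metis isCont_def tendsto_at_iff_tendsto_nhds)
  have "\<forall>\<^sub>F p in nhds (X, X). \<forall>w. moebius (rep L t w) \<i> = F p \<longrightarrow> rep L t w = mat 1"
    using eventually_compose_filterlim[OF near_basepoint lim] .
  then obtain S where S: "open S" "(X, X) \<in> S"
    "\<And>p w. p \<in> S \<Longrightarrow> moebius (rep L t w) \<i> = F p \<Longrightarrow> rep L t w = mat 1"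
    unfolding eventually_nhds by blast
  then obtain U1 U2 where U: "open U1" "open U2" "X \<in> U1" "X \<in> U2" "U1 \<times> U2 \<subseteq> S"
    by (metis open_prod_elim mem_Times_iff fst_conv snd_conv)
  show thesis
  proof (rule that[of "U1 \<inter> U2"])
    fix M N assume "M \<in> U1 \<inter> U2 \<inter> range (rep L t)" "N \<in> U1 \<inter> U2 \<inter> range (rep L t)"
    then obtain v w where vw: "M = rep L t v" "N = rep L t w" and S': "(M, N) \<in> S" using U by auto
    have SL: "M \<in> SL2" "N \<in> SL2" using vw by simp_all
    have "rep L t (inv_word v @ w) = matrix_inv M ** N" by (simp add: vw hol_append hol_inv_word)
    moreover from this have "moebius (rep L t (inv_word v @ w)) \<i> = F (M, N)" using SL F by (simp add: moebius_mult)
    ultimately have "matrix_inv M ** N = mat 1" using S(3)[OF S'] by metis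
    then have "M ** (matrix_inv M ** N) = M" by simp
    with SL show "M = N" by (simp add: SL2_cancel)
  qed (use U in auto)
qed

lemma discrete_rep: "discrete (range (rep L t))"
proof (rule discreteI)
  fix x assume x: "x \<in> range (rep L t)"
  then have "x \<in> SL2" by auto
  then obtain U where "open U" "x \<in> U"
    "\<And>M N. M \<in> U \<inter> range (rep L t) \<Longrightarrow> N \<in> U \<inter> range (rep L t) \<Longrightarrow> M = N"
    by (rule rep_locally_unique[of _ t]) blast
  with x show "x isolated_in range (rep L t)" by (intro isolated_inI[of _ _ U]) auto
qed

lemma finite_rep_bounded:
  assumes "bounded S" "S \<subseteq> range (rep L t)"
  shows "finite S"
proof (rule ccontr)
  assume "infinite S"
  then obtain X where X: "X islimpt S"
    using assms(1) Heine_Borel_imp_Bolzano_Weierstrass[of "closure S" S]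
    by (metis closure_subset compact_closure)
  have "closed SL2" unfolding SL2_def det_2
    by (intro closed_Collect_eq continuous_intros)
  moreover have "S \<subseteq> SL2" using assms(2) by auto
  ultimately have "X \<in> SL2" using X by (meson closed_limpt islimpt_subset)
  then obtain U where U: "open U" "X \<in> U"
    "\<And>M N. M \<in> U \<inter> range (rep L t) \<Longrightarrow> N \<in> U \<inter> range (rep L t) \<Longrightarrow> M = N"
    by (rule rep_locally_unique[of _ t]) blast
  obtain M where M: "M \<in> S" "M \<in> U" "M \<noteq> X" using X U(1,2) by (auto simp: islimpt_def)
  obtain N where N: "N \<in> S" "N \<in> U - {M}" "N \<noteq> X"
    using islimptE[OF X, of "U - {M}"] U(1,2) M(3) open_Diff[OF U(1) closed_singleton] by blast
  with M U(3)[of M N] assms(2) show False by auto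
qed

text \<open>
  An affine function with real coefficients is determined by its value at a point off the real axis.
\<close>

lemma coeff_bound:
  assumes "Im z > 0" "cmod (of_real p * z + of_real q) \<le> K"
  shows "\<bar>p\<bar> \<le> K / Im z" "\<bar>q\<bar> \<le> K + K / Im z * cmod z"
proof -
  have "\<bar>p\<bar> * Im z = \<bar>Im (of_real p * z + of_real q)\<bar>" using assms by (simp add: abs_mult)
  also have "\<dots> \<le> K" using abs_Im_le_cmod[of "of_real p * z + of_real q"] assms(2) by linarith
  finally show p: "\<bar>p\<bar> \<le> K / Im z" using assms by (simp add: pos_le_divide_eq)
  have "\<bar>q\<bar> = cmod ((of_real p * z + of_real q) - of_real p * z)" by simp
  also have "\<dots> \<le> cmod (of_real p * z + of_real q) + cmod (of_real p * z)" by (rule norm_triangle_ineq4)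
  also have "\<dots> \<le> K + K / Im z * cmod z"
    using assms(2) mult_right_mono[OF p norm_ge_zero[of z]] unfolding norm_mult norm_of_real
    by (rule add_mono)
  finally show "\<bar>q\<bar> \<le> K + K / Im z * cmod z" .
qed

text \<open>
  Proper discontinuity: if \<open>z\<close> is fixed and \<open>M z\<close> stays in a compact subset of the plane, then the
  entries of \<open>M\<close> stay bounded.
\<close>

lemma finite_orbit_return:
  assumes "Im z > 0"
  shows "finite {M \<in> range (rep L t). 1 \<le> cmod (moebius M z) \<and> cmod (moebius M z) \<le> R \<and> tilt (moebius M z) \<le> \<tau>}"
    (is "finite ?S")
proof (rule finite_rep_bounded)
  define K where "K = sqrt ((\<bar>\<tau>\<bar> + 1) * Im z)"
  define K' where "K' = max K (R * K)"
  define Q where "Q = K' / Im z + (K' + K' / Im z * cmod z)"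
  have K: "K \<ge> 0" using assms by (simp add: K_def)
  then have K': "K' \<ge> 0" by (simp add: K'_def)
  have entries: "\<bar>M $ i $ j\<bar> \<le> Q" if "M \<in> ?S" for M i j
  proof -
    from that have "M \<in> SL2" by auto
    then obtain a b c d where M: "M = mat22 a b c d" "a*d - b*c = 1" by (rule SL2_cases)
    define u where "u = moebius M z"
    from that have u: "1 \<le> cmod u" "cmod u \<le> R" "tilt u \<le> \<tau>" by (auto simp: u_def)
    have Im: "Im u > 0" using \<open>M \<in> SL2\<close> assms by (simp add: u_def)
    define n where "n = cmod (of_real c * z + of_real d)"
    have n: "n > 0" using moebius_denom_nonzero[OF M(2) assms] by (simp add: n_def)
    have "\<bar>Re u\<bar> \<le> \<bar>\<tau>\<bar> * Im u"
      using u(3) Im by (simp add: tilt_def pos_divide_le_eq) (smt (verit) mult_right_mono)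
    then have "1 \<le> (\<bar>\<tau>\<bar> + 1) * Im u"
      using u(1) cmod_le[of u] Im by (simp add: algebra_simps)
    also have "Im u = Im z / n\<^sup>2" by (simp add: u_def M(1) Im_moebius[OF M(2)] n_def)
    finally have "n\<^sup>2 \<le> (\<bar>\<tau>\<bar> + 1) * Im z" using n by (simp add: pos_le_divide_eq)
    then have nK: "n \<le> K" unfolding K_def by (rule real_le_rsqrt)
    have "cmod (of_real a * z + of_real b) = cmod u * n"
      using n by (simp add: u_def M(1) moebius_mat22 norm_divide n_def)
    also have "\<dots> \<le> R * K" using nK u n K by (intro mult_mono) auto
    finally have ab: "cmod (of_real a * z + of_real b) \<le> K'" by (simp add: K'_def)
    have cd: "cmod (of_real c * z + of_real d) \<le> K'" using nK by (simp add: K'_def n_def)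
    have "K' / Im z \<ge> 0" "K' + K' / Im z * cmod z \<ge> 0" using K' assms by simp_all
    with coeff_bound[OF assms ab] coeff_bound[OF assms cd]
    have "\<bar>a\<bar> \<le> Q" "\<bar>b\<bar> \<le> Q" "\<bar>c\<bar> \<le> Q" "\<bar>d\<bar> \<le> Q" by (simp_all add: Q_def)
    then show ?thesis using exhaust_2[of i] exhaust_2[of j] by (auto simp: M(1))
  qed
  have "norm M \<le> (\<Sum>i\<in>(UNIV::2 set). \<Sum>j\<in>(UNIV::2 set). Q)" if "M \<in> ?S" for M
  proof -
    have "norm M \<le> (\<Sum>i\<in>UNIV. norm (M $ i))" by (simp add: norm_vec_def L2_set_le_sum)
    also have "\<dots> \<le> (\<Sum>i\<in>UNIV. \<Sum>j\<in>UNIV. \<bar>M $ i $ j\<bar>)"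
      by (intro sum_mono norm_le_l1_cart)
    also have "\<dots> \<le> (\<Sum>i\<in>(UNIV::2 set). \<Sum>j\<in>(UNIV::2 set). Q)" by (intro sum_mono entries[OF that])
    finally show ?thesis .
  qed
  then show "bounded ?S" unfolding bounded_iff by blast
qed auto

end

text \<open>
  The earthquake map on the basic cell, up to a common isometry.
\<close>

definition twist :: "real \<Rightarrow> complex \<Rightarrow> complex" where
  "twist d u = (if Re u > 0 then u else of_real (exp d) * u)"

lemma Im_twist [simp]: "Im (twist d u) > 0 \<longleftrightarrow> Im u > 0"
  by (simp add: twist_def zero_less_mult_iff)

lemma twist_scale: "twist d (of_real (exp s) * u) = of_real (exp s) * twist d u"
  by (simp add: twist_def zero_less_mult_iff)

context translation_length
begin

section \<open>Tessellation of the plane by translates of the cell\<close>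

lemma moebius_genB_twist:
  "moebius (genB L t') u = of_real (exp (t' - t)) * moebius (genB L t) u"
  "moebius (matrix_inv (genB L t')) (of_real (exp (t' - t)) * u) = moebius (matrix_inv (genB L t)) u"
proof -
  have "complex_of_real (exp t') = of_real (exp (t' - t)) * of_real (exp t)"
    by (simp flip: of_real_mult exp_add)
  then show "moebius (genB L t') u = of_real (exp (t' - t)) * moebius (genB L t) u"
    by (simp add: moebius_genB)
  have "of_real (exp (- t')) * (of_real (exp (t' - t)) * u) = of_real (exp (- t)) * u"
    unfolding mult.assoc[symmetric] of_real_mult[symmetric] exp_add[symmetric] by simp
  then show "moebius (matrix_inv (genB L t')) (of_real (exp (t' - t)) * u) = moebius (matrix_inv (genB L t)) u"
    unfolding moebius_genB_inv_reflect by (simp only:)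
qed

lemma cellD: "u \<in> cell L t \<Longrightarrow> Im u > 0" "u \<in> cell L t \<Longrightarrow> c \<in> edges L t \<Longrightarrow> edge_form L c u \<ge> 0"
  by (auto simp: cell_def)

lemma on_edge_in_cell:
  assumes "Im u > 0" "c \<in> edges L t" "edge_form L c u = 0"
  shows "u \<in> cell L t"
proof -
  have "edge_form L c' u \<ge> 0" if "c' \<in> edges L t" for c'
    using edge_unique[OF assms(1,2) that] assms(3) by fastforce
  with assms(1) show ?thesis by (simp add: cell_def)
qed

text \<open>
  The word \<open>w\<close> leads through the edge \<open>c\<close> to the neighbouring cell.  The last property is the
  compatibility of the earthquake with the new holonomy: since \<open>genB L t'\<close> and \<open>genB L t\<close> differ by
  \<open>transl (t' - t)\<close>, the change of holonomy compensates the change of side.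
\<close>

lemma edge_crossing:
  assumes "c \<in> edges L t"
  obtains w c' where "c' \<in> edges L t" "c * c' < 0"
    "\<And>u. Im u > 0 \<Longrightarrow> \<exists>k>0. edge_form L c' (moebius (rep L t w) u) = - k * edge_form L c u"
    "\<And>u. Im u > 0 \<Longrightarrow> edge_form L c u < 0 \<Longrightarrow> tilt (moebius (rep L t w) u) < tilt u"
    "\<And>t' u. Im u > 0 \<Longrightarrow> c * Re u > 0 \<Longrightarrow> c' * Re (moebius (rep L t w) u) > 0 \<Longrightarrow>
       moebius (rep L t' w) (twist (t' - t) u) = twist (t' - t) (moebius (rep L t w) u)"
proof -
  have apow: "moebius (rep L t' ((Beta, b) # apow n)) u =
      moebius (letter_hol (transl L) (genB L t') (Beta, b)) (of_real (exp (L * of_int n)) * u)"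
    if "Im u > 0" for t' b n u
    using that by (simp add: moebius_mult hol_apow moebius_transl)
  from assms consider n :: int where "c = exp (L * of_int n)" | n :: int where "c = - exp (t + L * of_int n)"
    by (auto simp: edges_def)
  then show thesis
  proof cases
    case (1 n)
    let ?w = "(Beta, True) # apow (- n)"
    let ?v = "\<lambda>u. of_real (exp (L * of_int (- n))) * u"
    have act: "moebius (rep L t' ?w) u = moebius (genB L t') (?v u)" if "Im u > 0" for t' u
      using apow[OF that, of t' True "- n"] by simp
    have form: "edge_form L 1 (?v u) = exp (2 * (L * of_int (- n))) * edge_form L c u" for u
      using edge_form_scale[of "L * of_int (- n)" c u] by (simp add: 1 flip: exp_add)
    show thesis
    proof (rule that[of "- exp t" ?w])
      show "- exp t \<in> edges L t" by (rule minus_exp_in_edges)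
      show "c * - exp t < 0" by (simp add: 1)
      show "\<exists>k>0. edge_form L (- exp t) (moebius (rep L t ?w) u) = - k * edge_form L c u"
        if "Im u > 0" for u
      proof -
        have "Im (?v u) > 0" using that by simp
        then obtain k where "k > 0" "edge_form L (- exp t) (moebius (genB L t) (?v u)) = - k * edge_form L 1 (?v u)"
          by (rule edge_form_genB)
        then show ?thesis unfolding act[OF that] form
          by (intro exI[of _ "k * exp (2 * (L * of_int (- n)))"]) simp
      qed
      show "tilt (moebius (rep L t ?w) u) < tilt u" if "Im u > 0" "edge_form L c u < 0" for u
      proof -
        have "edge_form L 1 (?v u) < 0" unfolding form using that by (simp add: mult_pos_neg)
        then have "tilt (moebius (genB L t) (?v u)) < tilt (?v u)"
          using that by (intro tilt_genB_less) simp_all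
        then show ?thesis unfolding act[OF that(1)] tilt_scale .
      qed
      show "moebius (rep L t' ?w) (twist (t' - t) u) = twist (t' - t) (moebius (rep L t ?w) u)"
        if "Im u > 0" "c * Re u > 0" "- exp t * Re (moebius (rep L t ?w) u) > 0" for t' u
      proof -
        have Re: "Re u > 0" "\<not> Re (moebius (genB L t) (?v u)) > 0"
          using that(2,3) unfolding act[OF that(1)] by (auto simp: 1 zero_less_mult_iff mult_less_0_iff)
        then have "twist (t' - t) u = u" by (simp add: twist_def)
        then show ?thesis unfolding act[OF that(1)] using Re(2) act[OF that(1), of t'] moebius_genB_twist(1)[of t' "?v u" t]
          by (simp only: twist_def if_False)
      qed
    qed
  next
    case (2 n)
    let ?w = "(Beta, False) # apow (- n)"
    let ?v = "\<lambda>u. of_real (exp (L * of_int (- n))) * u"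
    have act: "moebius (rep L t' ?w) u = moebius (matrix_inv (genB L t')) (?v u)" if "Im u > 0" for t' u
      using apow[OF that, of t' False "- n"] by simp
    have form: "edge_form L (- exp t) (?v u) = exp (2 * (L * of_int (- n))) * edge_form L c u" for u
      using edge_form_scale[of "L * of_int (- n)" c u] by (simp add: 2 flip: exp_add)
    show thesis
    proof (rule that[of 1 ?w])
      show "1 \<in> edges L t" by (rule one_in_edges)
      show "c * 1 < 0" by (simp add: 2)
      show "\<exists>k>0. edge_form L 1 (moebius (rep L t ?w) u) = - k * edge_form L c u"
        if "Im u > 0" for u
      proof -
        have "Im (?v u) > 0" using that by simp
        then obtain k where "k > 0"
          "edge_form L 1 (moebius (matrix_inv (genB L t)) (?v u)) = - k * edge_form L (- exp t) (?v u)"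
          by (rule edge_form_genB_inv)
        then show ?thesis unfolding act[OF that] form
          by (intro exI[of _ "k * exp (2 * (L * of_int (- n)))"]) simp
      qed
      show "tilt (moebius (rep L t ?w) u) < tilt u" if "Im u > 0" "edge_form L c u < 0" for u
      proof -
        have "edge_form L (- exp t) (?v u) < 0" unfolding form using that by (simp add: mult_pos_neg)
        then have "tilt (moebius (matrix_inv (genB L t)) (?v u)) < tilt (?v u)"
          using that by (intro tilt_genB_inv_less) simp_all
        then show ?thesis unfolding act[OF that(1)] tilt_scale .
      qed
      show "moebius (rep L t' ?w) (twist (t' - t) u) = twist (t' - t) (moebius (rep L t ?w) u)"
        if "Im u > 0" "c * Re u > 0" "1 * Re (moebius (rep L t ?w) u) > 0" for t' u
      proof -
        have Re: "\<not> Re u > 0" "Re (moebius (matrix_inv (genB L t)) (?v u)) > 0"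
          using that(2,3) unfolding act[OF that(1)] by (auto simp: 2 mult_less_0_iff)
        have tw: "twist (t' - t) u = of_real (exp (t' - t)) * u" using Re(1) by (simp add: twist_def)
        have "Im (twist (t' - t) u) > 0" using that(1) by simp
        from act[OF this] have "moebius (rep L t' ?w) (twist (t' - t) u) =
            moebius (matrix_inv (genB L t')) (of_real (exp (t' - t)) * ?v u)"
          unfolding tw by (simp only: mult.left_commute)
        then show ?thesis unfolding act[OF that(1)] moebius_genB_twist(2)
          using Re(2) by (simp only: twist_def if_True)
      qed
    qed
  qed
qed

lemma cross_letter:
  fixes t t' :: real and b :: bool and u :: complex
  defines "v \<equiv> moebius (letter_hol (transl L) (genB L t) (Beta, b)) u"
  assumes u: "u \<in> cell L t" and "\<not> zone L t (Beta, b) v"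
  shows "v \<in> cell L t" "Re u \<noteq> 0" "Re v \<noteq> 0"
    "moebius (letter_hol (transl L) (genB L t') (Beta, b)) (twist (t' - t) u) = twist (t' - t) v"
proof -
  have Im: "Im u > 0" "Im v > 0" using cellD(1)[OF u] by (simp_all add: v_def)
  define c c' where "c = (if b then 1 else - exp t)" and "c' = (if b then - exp t else 1)"
  have edges: "c \<in> edges L t" "c' \<in> edges L t"
    by (simp_all add: c_def c'_def one_in_edges minus_exp_in_edges)
  have "\<not> edge_form L c u > 0"
    using enter_zone[OF Im(1), of b t] assms(3) by (auto simp: c_def v_def split: if_splits)
  then have u0: "edge_form L c u = 0" using cellD(2)[OF u edges(1)] by linarith
  have v0: "edge_form L c' v = 0"
  proof (cases b)
    case True
    obtain k where "edge_form L (- exp t) (moebius (genB L t) u) = - k * edge_form L 1 u"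
      using edge_form_genB[OF Im(1)] by blast
    with True u0 show ?thesis by (simp add: c_def c'_def v_def)
  next
    case False
    obtain k where "edge_form L 1 (moebius (matrix_inv (genB L t)) u) = - k * edge_form L (- exp t) u"
      using edge_form_genB_inv[OF Im(1)] by blast
    with False u0 show ?thesis by (simp add: c_def c'_def v_def)
  qed
  show "v \<in> cell L t" using Im(2) edges(2) v0 by (rule on_edge_in_cell)
  have Re: "c * Re u > 0" "c' * Re v > 0"
    using edge_form_nonpos_imp(1)[OF Im(1) edges_nonzero[OF edges(1)]] u0
      edge_form_nonpos_imp(1)[OF Im(2) edges_nonzero[OF edges(2)]] v0 by simp_all
  then show "Re u \<noteq> 0" "Re v \<noteq> 0" by auto
  show "moebius (letter_hol (transl L) (genB L t') (Beta, b)) (twist (t' - t) u) = twist (t' - t) v"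
  proof (cases b)
    case True
    with Re have "Re u > 0" "\<not> Re v > 0" by (auto simp: c_def c'_def mult_less_0_iff)
    with True show ?thesis by (simp add: twist_def v_def moebius_genB_twist(1)[of t' u t])
  next
    case False
    with Re have "\<not> Re u > 0" "Re v > 0" by (auto simp: c_def c'_def mult_less_0_iff)
    with False show ?thesis by (simp add: twist_def v_def moebius_genB_twist(2))
  qed
qed

text \<open>
  Powers of \<open>\<alpha>\<close> preserve the cell.  Otherwise two cells have a common point only if it lies on a
  chain of edges that the word crosses one by one: an occurrence of \<open>\<beta>\<close> that does not start on an
  edge moves the point into a zone, and by ping-pong it never returns.  Along such a chain, the
  earthquake is consistent.
\<close>

lemma cell_transition:
  assumes "reduced w" "u \<in> cell L t" "moebius (rep L t w) u \<in> cell L t"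
  shows "(Re u = 0 \<longrightarrow> Re (moebius (rep L t w) u) = 0) \<and>
    (Re u \<noteq> 0 \<longrightarrow> moebius (rep L t' w) (twist (t' - t) u) = twist (t' - t) (moebius (rep L t w) u))"
  using assms
proof (induction w arbitrary: u rule: rev_induct)
  case Nil
  then show ?case by simp
next
  case (snoc l w)
  have Im: "Im u > 0" using snoc.prems cellD by blast
  define v where "v = moebius (letter_hol (transl L) (genB L t) l) u"
  have Imv: "Im v > 0" using Im by (simp add: v_def)
  have act: "moebius (rep L t (w @ [l])) u = moebius (rep L t w) v"
    using Im by (simp add: hol_snoc v_def)
  have act': "moebius (rep L t' (w @ [l])) (twist (t' - t) u) =
      moebius (rep L t' w) (moebius (letter_hol (transl L) (genB L t') l) (twist (t' - t) u))"
    using Im by (simp add: hol_snoc)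
  have red: "reduced w" using snoc.prems(1) reduced_appendD by blast
  have "v \<in> cell L t \<and> (Re u = 0 \<longleftrightarrow> Re v = 0) \<and>
    (Re u \<noteq> 0 \<longrightarrow> moebius (letter_hol (transl L) (genB L t') l) (twist (t' - t) u) = twist (t' - t) v)"
  proof (cases "fst l")
    case Alpha
    then obtain b where l: "l = (Alpha, b)" by (metis prod.collapse)
    define n :: int where "n = (if b then 1 else -1)"
    have *: "moebius (letter_hol (transl L) (genB L s) l) z = of_real (exp (L * of_int n)) * z" for s z
      by (simp add: l n_def matrix_inv_transl moebius_transl split: if_splits)
    show ?thesis using cell_scale[OF snoc.prems(2), of n] unfolding v_def * by (simp add: twist_scale)
  next
    case Beta
    then obtain b where l: "l = (Beta, b)" by (metis prod.collapse)
    have "\<not> zone L t (Beta, b) v"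
    proof
      assume "zone L t (Beta, b) v"
      then have "zone L t (hd (w @ [l])) (moebius (rep L t w) v)"
        using snoc.prems(1) Imv unfolding l by (intro ping_pong)
      then obtain c where "c \<in> edges L t" "edge_form L c (moebius (rep L t w) v) < 0"
        by (metis zone_edge)
      with snoc.prems(3) show False unfolding act by (auto simp: cell_def)
    qed
    from cross_letter[OF snoc.prems(2), of b, folded l, folded v_def, OF this[folded l]]
    show ?thesis by auto
  qed
  with snoc.IH[OF red, of v] snoc.prems(3) show ?case unfolding act act' by auto
qed

lemma ex_normalizing_scale:
  assumes "Im u > 0"
  obtains n :: int where "1 \<le> cmod (of_real (exp (L * of_int n)) * u)"
    "cmod (of_real (exp (L * of_int n)) * u) \<le> exp L"
proof -
  define n where "n = - \<lfloor>ln (cmod u) / L\<rfloor>"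
  have u: "cmod u > 0" using assms by auto
  have "of_int (- n) \<le> ln (cmod u) / L" "ln (cmod u) / L \<le> of_int (- n) + 1"
    unfolding n_def by linarith+
  then have "L * of_int (- n) \<le> ln (cmod u)" "ln (cmod u) \<le> L * (of_int (- n) + 1)"
    using L_pos by (simp_all add: pos_le_divide_eq pos_divide_le_eq mult.commute)
  then have "0 \<le> L * of_int n + ln (cmod u)" "L * of_int n + ln (cmod u) \<le> L"
    by (simp_all add: algebra_simps)
  moreover have "cmod (of_real (exp (L * of_int n)) * u) = exp (L * of_int n + ln (cmod u))"
    using u by (simp add: norm_mult exp_add)
  ultimately show thesis by (intro that[of n]) simp_all
qed

text \<open>
  Among the points of the orbit in a fundamental annulus of \<open>transl L\<close> that are not farther from
  the axis than \<open>z\<close> there are only finitely many, so one of them is nearest to the axis.  It lies in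
  the cell, since crossing an edge would bring it nearer.
\<close>

lemma covering:
  assumes "Im z > 0"
  obtains w where "moebius (rep L t w) z \<in> cell L t"
proof -
  let ?act = "\<lambda>w. moebius (rep L t w) z"
  have norm: "\<exists>w'. 1 \<le> cmod (?act w') \<and> cmod (?act w') \<le> exp L \<and> tilt (?act w') = tilt (?act w)" for w
  proof -
    have "Im (?act w) > 0" using assms by simp
    then obtain n :: int where n: "1 \<le> cmod (of_real (exp (L * of_int n)) * ?act w)"
      "cmod (of_real (exp (L * of_int n)) * ?act w) \<le> exp L" by (rule ex_normalizing_scale)
    have "?act (apow n @ w) = of_real (exp (L * of_int n)) * ?act w"
      using assms by (simp add: hol_append_moebius hol_apow moebius_transl)
    with n show ?thesis using tilt_scale by metis
  qed
  define S where "S = {M \<in> range (rep L t). 1 \<le> cmod (moebius M z) \<and> cmod (moebius M z) \<le> exp L \<and>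
    tilt (moebius M z) \<le> tilt z}"
  have fin: "finite S" unfolding S_def by (rule finite_orbit_return[OF assms])
  have "S \<noteq> {}" using norm[of "[]"] by (auto simp: S_def)
  then obtain M where M: "M \<in> S" "\<And>N. N \<in> S \<Longrightarrow> tilt (moebius M z) \<le> tilt (moebius N z)"
    using ex_min_if_finite[of "(\<lambda>N. tilt (moebius N z)) ` S"] fin by (auto simp: not_less)
  then obtain w where w: "M = rep L t w" by (auto simp: S_def)
  have Im: "Im (?act w) > 0" using assms by simp
  have "?act w \<in> cell L t"
  proof (rule ccontr)
    assume "?act w \<notin> cell L t"
    then obtain c where c: "c \<in> edges L t" "edge_form L c (?act w) < 0" using Im by (auto simp: cell_def not_le)
    obtain v where v: "tilt (moebius (rep L t v) (?act w)) < tilt (?act w)"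
      using edge_crossing[OF c(1)] c(2) Im by metis
    have "moebius (rep L t v) (?act w) = ?act (v @ w)" using assms by (simp add: hol_append_moebius)
    then obtain w' where w': "1 \<le> cmod (?act w')" "cmod (?act w') \<le> exp L" "tilt (?act w') < tilt (?act w)"
      using norm[of "v @ w"] v by auto
    moreover have "tilt (?act w) \<le> tilt z" using M(1) w by (auto simp: S_def)
    ultimately have "rep L t w' \<in> S" by (auto simp: S_def)
    with M(2) w w'(3) show False by force
  qed
  then show thesis by (rule that)
qed

lemma edges_locally_finite:
  assumes "Im u > 0"
  shows "\<forall>\<^sub>F v in nhds u. \<forall>c\<in>edges L t. edge_form L c u > 0 \<longrightarrow> edge_form L c v > 0"
proof -
  define F where "F = {c\<in>edges L t. \<bar>ln (cmod u) - ln \<bar>c\<bar>\<bar> < L/2 + 1}"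
  have fin: "finite {n::int. \<bar>a - L * of_int n\<bar> < K}" for a K
  proof (rule finite_subset)
    show "{n::int. \<bar>a - L * of_int n\<bar> < K} \<subseteq> {\<lfloor>(a - K) / L\<rfloor>..\<lceil>(a + K) / L\<rceil>}"
    proof clarify
      fix n :: int assume "\<bar>a - L * of_int n\<bar> < K"
      then have "(a - K) / L \<le> of_int n" "of_int n \<le> (a + K) / L"
        using L_pos by (simp_all add: pos_divide_le_eq pos_le_divide_eq mult.commute)
      then show "n \<in> {\<lfloor>(a - K) / L\<rfloor>..\<lceil>(a + K) / L\<rceil>}" by simp linarith
    qed
  qed simp
  have "F \<subseteq> (\<lambda>n::int. exp (L * of_int n)) ` {n. \<bar>ln (cmod u) - L * of_int n\<bar> < L/2 + 1} \<union>
      (\<lambda>n::int. - exp (t + L * of_int n)) ` {n. \<bar>(ln (cmod u) - t) - L * of_int n\<bar> < L/2 + 1}"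
    by (auto simp: F_def edges_def diff_diff_eq)
  then have "finite F" by (rule finite_subset) (intro finite_UnI finite_imageI fin)
  have cont: "isCont (edge_form L c) u" for c
    unfolding edge_form_def[abs_def] by (intro continuous_intros isCont_Re[OF continuous_ident])
  have "\<forall>\<^sub>F v in nhds u. \<forall>c\<in>F. edge_form L c u > 0 \<longrightarrow> edge_form L c v > 0"
  proof (rule eventually_ball_finite[OF \<open>finite F\<close>], rule ballI)
    fix c
    show "\<forall>\<^sub>F v in nhds u. edge_form L c u > 0 \<longrightarrow> edge_form L c v > 0"
    proof (cases "edge_form L c u > 0")
      case True
      then have "\<forall>\<^sub>F v in nhds u. edge_form L c v > 0"
        using cont by (intro eventually_isCont_gt)
      then show ?thesis by (rule eventually_mono) simp
    qed simp
  qed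
  moreover have "\<forall>\<^sub>F v in nhds u. \<bar>ln (cmod v) - ln (cmod u)\<bar> < 1"
  proof -
    have "isCont (\<lambda>v. 1 - \<bar>ln (cmod v) - ln (cmod u)\<bar>) u" using assms by (intro continuous_intros) auto
    from eventually_isCont_gt[OF this, of 0] show ?thesis by simp
  qed
  ultimately show ?thesis using eventually_upper[OF assms]
  proof eventually_elim
    case (elim v)
    show ?case
    proof (intro ballI impI)
      fix c assume c: "c \<in> edges L t" "edge_form L c u > 0"
      show "edge_form L c v > 0"
      proof (rule ccontr)
        assume "\<not> edge_form L c v > 0"
        then have "\<bar>ln (cmod v) - ln \<bar>c\<bar>\<bar> < L/2"
          using edge_form_nonpos_imp(2)[OF elim(3) edges_nonzero[OF c(1)]] by simp
        with elim(2) have "\<bar>ln (cmod u) - ln \<bar>c\<bar>\<bar> < L/2 + 1" by linarith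
        with c(1) have "c \<in> F" by (simp add: F_def)
        with elim(1) c(2) \<open>\<not> edge_form L c v > 0\<close> show False by blast
      qed
    qed
  qed
qed


section \<open>The lifts of the geodesic \<open>\<alpha>\<close>\<close>

lemma geodesic_length_transl: "geodesic_length (transl L) = L"
proof -
  have "trace (transl L) / 2 = cosh (L/2)"
    by (simp add: transl_eq_mat22 cosh_field_def)
  then show ?thesis using L_pos by (simp add: geodesic_length_def arcosh_cosh_real)
qed

lemma trace_transl: "trace (transl L) = 2 * cosh (L/2)"
  by (simp add: transl_eq_mat22 cosh_field_def)

lemma is_axis_transl_1: "is_axis (transl L) (mat 1)"
  using cosh_gt_1
  by (simp add: is_axis_def geodesic_length_transl transl_along_def trace_transl
      matrix_inv_eqI[of "mat 1" "mat 1"])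

text \<open>
  The axis is encoded only up to right multiplication by diagonal matrices.
\<close>

lemma is_axis_transl:
  assumes "is_axis (transl L) g"
  obtains a where "a \<noteq> 0" "g = mat22 a 0 0 (1 / a)"
proof -
  have g: "g \<in> SL2" "transl L = g ** transl L ** matrix_inv g"
    using assms by (simp_all add: is_axis_def transl_along_def geodesic_length_transl)
  then obtain a b c d where M: "g = mat22 a b c d" "a*d - b*c = 1" by (elim SL2_cases)
  have "transl L ** g = g ** transl L"
    by (metis SL2_inverse(3) g matrix_mul_assoc matrix_mul_rid)
  then have "exp (L/2) * b = b * exp (-L/2)" "exp (-L/2) * c = c * exp (L/2)"
    by (simp_all add: M transl_eq_mat22)
  moreover have "exp (L/2) \<noteq> exp (-L/2)" using L_pos by simp
  ultimately have "b = 0" "c = 0" by (auto simp: mult.commute)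
  with M show thesis by (intro that[of a]) (auto simp: eq_divide_eq mult.commute)
qed

lemma lifts_alphaE:
  assumes "h \<in> lifts_alpha (transl L) (genB L t)"
  obtains w where
    "geodesic h = moebius (rep L t w) ` {z \<in> upper_half_plane. Re z = 0}"
    "right_side h = moebius (rep L t w) ` {z \<in> upper_half_plane. Re z > 0}"
    "left_side h = moebius (rep L t w) ` {z \<in> upper_half_plane. Re z < 0}"
    "\<And>s. transl_along h s = rep L t w ** transl s ** matrix_inv (rep L t w)"
proof -
  obtain w g where h: "h = rep L t w ** g" "is_axis (transl L) g"
    using assms by (auto simp: lifts_alpha_def)
  then obtain a where a: "a \<noteq> 0" "g = mat22 a 0 0 (1 / a)" by (elim is_axis_transl)
  have g: "g \<in> SL2" using a by simp
  have act: "moebius g z = of_real (a\<^sup>2) * z" for z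
    using a by (simp add: moebius_mat22 power2_eq_square)
  have image: "moebius h ` {z \<in> upper_half_plane. P (Re z)} = moebius (rep L t w) ` {z \<in> upper_half_plane. P (Re z)}"
    if "\<And>k x::real. k > 0 \<Longrightarrow> P (k * x) = P x" for P
  proof -
    have "moebius g ` {z \<in> upper_half_plane. P (Re z)} = {z \<in> upper_half_plane. P (Re z)}"
    proof (intro equalityI subsetI)
      fix z assume "z \<in> {z \<in> upper_half_plane. P (Re z)}"
      then have "moebius g (of_real (1 / a\<^sup>2) * z) = z" "of_real (1 / a\<^sup>2) * z \<in> {z \<in> upper_half_plane. P (Re z)}"
        using a(1) that[of "1 / a\<^sup>2" "Re z"] by (simp_all add: act upper_half_plane_def)
      then show "z \<in> moebius g ` {z \<in> upper_half_plane. P (Re z)}" 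
        by (intro rev_image_eqI[of "of_real (1 / a\<^sup>2) * z"]) simp_all
    next
      fix z assume "z \<in> moebius g ` {z \<in> upper_half_plane. P (Re z)}"
      then obtain z' where "z = of_real (a\<^sup>2) * z'" "Im z' > 0" "P (Re z')"
        unfolding act upper_half_plane_def by blast
      then show "z \<in> {z \<in> upper_half_plane. P (Re z)}"
        using a(1) that[of "a\<^sup>2" "Re z'"] unfolding upper_half_plane_def mem_Collect_eq
        by (simp only: times_complex.sel Re_complex_of_real Im_complex_of_real) simp
    qed
    moreover have "moebius h ` {z \<in> upper_half_plane. P (Re z)} =
        moebius (rep L t w) ` moebius g ` {z \<in> upper_half_plane. P (Re z)}"
      unfolding image_image by (rule image_cong) (auto simp: h g moebius_mult upper_half_plane_def)
    ultimately show ?thesis by simp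
  qed
  show thesis
  proof (rule that[of w])
    show "geodesic h = moebius (rep L t w) ` {z \<in> upper_half_plane. Re z = 0}"
      unfolding geodesic_def by (rule image) auto
    show "right_side h = moebius (rep L t w) ` {z \<in> upper_half_plane. Re z > 0}"
      unfolding right_side_def by (rule image) (auto simp: zero_less_mult_iff)
    show "left_side h = moebius (rep L t w) ` {z \<in> upper_half_plane. Re z < 0}"
      unfolding left_side_def by (rule image) (auto simp: mult_less_0_iff)
    fix s
    have "g ** transl s ** matrix_inv g = transl s"
      using a by (simp add: transl_eq_mat22 matrix_inv_SL2)
    then show "transl_along h s = rep L t w ** transl s ** matrix_inv (rep L t w)"
      using g unfolding transl_along_def h
      by (simp add: matrix_inv_mult_SL2) (metis matrix_mul_assoc)
  qed
qed

lemma lift_of_word: "rep L t w \<in> lifts_alpha (transl L) (genB L t)"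
proof -
  have "rep L t w = rep L t w ** mat 1" by simp
  with is_axis_transl_1 show ?thesis unfolding lifts_alpha_def by blast
qed

lemma geodesic_rep: "geodesic (rep L t w) = moebius (rep L t w) ` {z \<in> upper_half_plane. Re z = 0}"
  by (simp add: geodesic_def)

text \<open>
  The cone is the neighbourhood of the imaginary axis that touches every edge in its midpoint.
\<close>

lemma thin_cone_in_cell:
  assumes "Im v > 0" "sinh (L/2) * \<bar>Re v\<bar> \<le> Im v"
  shows "v \<in> cell L t"
proof -
  have "(cosh (L/2) * \<bar>Re v\<bar>)\<^sup>2 = (sinh (L/2) * \<bar>Re v\<bar>)\<^sup>2 + (Re v)\<^sup>2"
    by (simp add: power_mult_distrib cosh_sq algebra_simps)
  also have "\<dots> \<le> (Im v)\<^sup>2 + (Re v)\<^sup>2"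
    using assms sinh_pos by (intro add_right_mono power_mono) auto
  also have "\<dots> = (cmod v)\<^sup>2" by (simp add: cmod_power2)
  finally have *: "cosh (L/2) * \<bar>Re v\<bar> \<le> cmod v" by (rule power2_le_imp_le) simp
  have "edge_form L c v \<ge> 0" for c
  proof -
    have "cosh (L/2) * (c * Re v) \<le> \<bar>c\<bar> * (cosh (L/2) * \<bar>Re v\<bar>)"
      by (metis abs_ge_self abs_mult cosh_real_nonneg mult.left_commute mult_left_mono)
    also have "\<dots> \<le> \<bar>c\<bar> * cmod v" using * by (intro mult_left_mono) auto
    finally have "edge_form L c v \<ge> (cmod v - \<bar>c\<bar>)\<^sup>2"
      by (simp add: edge_form_def power2_diff mult_ac)
    then show ?thesis using zero_le_power2[of "cmod v - \<bar>c\<bar>"] by linarith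
  qed
  with assms(1) show ?thesis by (simp add: cell_def)
qed

text \<open>
  Distinct lifts of \<open>\<alpha>\<close> run in the interiors of distinct cells.
\<close>

lemma cell_in_cut_plane:
  assumes "u \<in> cell L t" "Re u \<noteq> 0"
  shows "moebius (rep L t w) u \<in> cut_plane (transl L) (genB L t)"
proof -
  have Im: "Im u > 0" using assms(1) by (rule cellD)
  have "moebius (rep L t w) u \<notin> geodesic h" if h: "h \<in> lifts_alpha (transl L) (genB L t)" for h
  proof
    assume "moebius (rep L t w) u \<in> geodesic h"
    moreover obtain v where "geodesic h = moebius (rep L t v) ` {z \<in> upper_half_plane. Re z = 0}"
      using h by (rule lifts_alphaE)
    ultimately obtain z where z: "Im z > 0" "Re z = 0" "moebius (rep L t w) u = moebius (rep L t v) z"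
      by (auto simp: upper_half_plane_def)
    obtain x where x: "reduced x" "rep L t x = rep L t (inv_word w @ v)"
      using ex_reduced_word[of "inv_word w @ v"] by fastforce
    have "moebius (rep L t x) z = moebius (matrix_inv (rep L t w)) (moebius (rep L t v) z)"
      using z(1) by (simp add: x(2) hol_append_moebius hol_inv_word)
    also have "\<dots> = u" using Im unfolding z(3)[symmetric] by simp
    finally have "moebius (rep L t x) z = u" .
    moreover have "z \<in> cell L t" using z by (intro thin_cone_in_cell) auto
    ultimately show False using cell_transition[OF x(1), of z t] z(2) assms by auto
  qed
  with Im show ?thesis by (auto simp: cut_plane_def upper_half_plane_def)
qed

lemma cut_planeE:
  assumes "z \<in> cut_plane (transl L) (genB L t)"
  obtains w u where "u \<in> cell L t" "Re u \<noteq> 0" "z = moebius (rep L t w) u"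
proof -
  have Im: "Im z > 0" using assms by (simp add: cut_plane_def upper_half_plane_def)
  then obtain w where w: "moebius (rep L t w) z \<in> cell L t" by (rule covering)
  let ?u = "moebius (rep L t w) z"
  have z: "z = moebius (rep L t (inv_word w)) ?u" using Im by (simp add: hol_inv_word)
  have "Re ?u \<noteq> 0"
  proof
    assume "Re ?u = 0"
    then have "z \<in> geodesic (rep L t (inv_word w))"
      using z cellD(1)[OF w] unfolding geodesic_rep upper_half_plane_def by blast
    with assms lift_of_word show False by (auto simp: cut_plane_def)
  qed
  from w this z show thesis by (rule that)
qed

section \<open>The earthquake map\<close>

text \<open>
  The graph of the equivariant extension of \<open>twist\<close>.  As a relation it is equivariant by
  construction, and the covering property and the consistency along edges appear separately, as
  totality and as uniqueness.
\<close>

definition developed :: "real \<Rightarrow> real \<Rightarrow> complex \<Rightarrow> complex \<Rightarrow> bool" where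
  "developed t t' v y \<longleftrightarrow> (\<exists>w u. u \<in> cell L t \<and> Re u \<noteq> 0 \<and>
     v = moebius (rep L t w) u \<and> y = moebius (rep L t' w) (twist (t' - t) u))"

lemma developed_hol:
  assumes "developed t t' v y"
  shows "developed t t' (moebius (rep L t w) v) (moebius (rep L t' w) y)"
proof -
  obtain x u where *: "u \<in> cell L t" "Re u \<noteq> 0" "v = moebius (rep L t x) u"
    "y = moebius (rep L t' x) (twist (t' - t) u)"
    using assms unfolding developed_def by blast
  then have "moebius (rep L t w) v = moebius (rep L t (w @ x)) u"
    "moebius (rep L t' w) y = moebius (rep L t' (w @ x)) (twist (t' - t) u)"
    using cellD(1) by (simp_all add: hol_append_moebius)
  with *(1,2) show ?thesis unfolding developed_def by blast
qed

lemma developed_cell: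
  assumes "u \<in> cell L t" "Re u \<noteq> 0"
  shows "developed t t' u (twist (t' - t) u)"
  unfolding developed_def using assms by (intro exI[of _ "[]"] exI[of _ u]) simp

lemma developed_unique:
  assumes "developed t t' v y1" "developed t t' v y2"
  shows "y1 = y2"
proof -
  obtain w1 u1 where 1: "u1 \<in> cell L t" "Re u1 \<noteq> 0" "v = moebius (rep L t w1) u1"
    "y1 = moebius (rep L t' w1) (twist (t' - t) u1)"
    using assms(1) unfolding developed_def by blast
  obtain w2 u2 where 2: "u2 \<in> cell L t" "v = moebius (rep L t w2) u2"
    "y2 = moebius (rep L t' w2) (twist (t' - t) u2)"
    using assms(2) unfolding developed_def by blast
  note Im = cellD(1)[OF 1(1)] cellD(1)[OF 2(1)]
  obtain x where x: "reduced x" "\<And>A B. A \<in> SL2 \<Longrightarrow> B \<in> SL2 \<Longrightarrow> hol A B x = hol A B (inv_word w2 @ w1)"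
    using ex_reduced_word[of "inv_word w2 @ w1"] by blast
  have "moebius (rep L t x) u1 = moebius (matrix_inv (rep L t w2)) v"
    using Im by (simp add: x(2) hol_append_moebius hol_inv_word 1(3))
  also have "\<dots> = u2" using Im by (simp add: 2(2))
  finally have u2: "moebius (rep L t x) u1 = u2" .
  then have "moebius (rep L t' x) (twist (t' - t) u1) = twist (t' - t) u2"
    using cell_transition[OF x(1) 1(1)] 1(2) 2(1) by auto
  then have "y2 = moebius (rep L t' w2) (moebius (rep L t' x) (twist (t' - t) u1))" by (simp add: 2(3))
  also have "\<dots> = y1" using Im by (simp add: x(2) hol_append_moebius hol_inv_word 1(4))
  finally show ?thesis by simp
qed

text \<open>
  On a small neighbourhood of a point of an edge, the points beyond the edge belong to the
  neighbouring cell, and there the extension is given by the same formula.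
\<close>

lemma developed_near:
  assumes u: "u \<in> cell L t" "Re u \<noteq> 0"
  shows "\<forall>\<^sub>F v in nhds u. developed t t' v (twist (t' - t) v)"
proof -
  have Im: "Im u > 0" using u(1) by (rule cellD)
  have Re_near: "\<forall>\<^sub>F v in nhds z. c * Re v > 0" if "c * Re z > 0" for c z
  proof -
    have "isCont (\<lambda>v. c * Re v) z" by (intro continuous_intros isCont_Re[OF continuous_ident])
    from eventually_isCont_gt[OF this that] show ?thesis .
  qed
  show ?thesis
  proof (cases "\<exists>c\<in>edges L t. edge_form L c u = 0")
    case False
    then have pos: "edge_form L c u > 0" if "c \<in> edges L t" for c
      using cellD(2)[OF u(1) that] that by fastforce
    have "Re u * Re u > 0" using u(2) by (simp add: zero_less_mult_iff) linarith
    from Re_near[OF this] edges_locally_finite[OF Im, of t] eventually_upper[OF Im] show ?thesis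
    proof eventually_elim
      case (elim v)
      then have "v \<in> cell L t" "Re v \<noteq> 0" using pos by (auto simp: cell_def less_imp_le)
      then show ?case by (rule developed_cell)
    qed
  next
    case True
    then obtain c where c: "c \<in> edges L t" "edge_form L c u = 0" by blast
    obtain w c' where c': "c' \<in> edges L t"
      and form: "\<And>v. Im v > 0 \<Longrightarrow> \<exists>k>0. edge_form L c' (moebius (rep L t w) v) = - k * edge_form L c v"
      and cross: "\<And>v. Im v > 0 \<Longrightarrow> c * Re v > 0 \<Longrightarrow> c' * Re (moebius (rep L t w) v) > 0 \<Longrightarrow>
        moebius (rep L t' w) (twist (t' - t) v) = twist (t' - t) (moebius (rep L t w) v)"
      using edge_crossing[OF c(1)] by metis
    let ?T = "moebius (rep L t w)"
    have ImT: "Im (?T v) > 0" if "Im v > 0" for v using that by simp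
    have Tu: "edge_form L c' (?T u) = 0" using form[OF Im] c(2) by auto
    have Re: "c * Re u > 0" "c' * Re (?T u) > 0"
      using edge_form_nonpos_imp(1)[OF Im edges_nonzero[OF c(1)]] c(2)
        edge_form_nonpos_imp(1)[OF ImT[OF Im] edges_nonzero[OF c']] Tu by simp_all
    have others: "edge_form L c1 z > 0"
      if "Im z > 0" "c0 \<in> edges L t" "edge_form L c0 z = 0" "c1 \<in> edges L t" "c1 \<noteq> c0" for z c0 c1
      using edge_unique[OF that(1,2,4)] that(3,5) by fastforce
    note Re_near[OF Re(1)] edges_locally_finite[OF Im, of t] eventually_upper[OF Im]
    moreover have "\<forall>\<^sub>F v in nhds u. c' * Re (?T v) > 0"
      by (rule eventually_moebius[OF _ Im Re_near[OF Re(2)]]) simp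
    moreover have "\<forall>\<^sub>F v in nhds u. \<forall>c\<in>edges L t. edge_form L c (?T u) > 0 \<longrightarrow> edge_form L c (?T v) > 0"
      by (rule eventually_moebius[OF _ Im edges_locally_finite[OF ImT[OF Im]]]) simp
    ultimately show ?thesis
    proof eventually_elim
      case (elim v)
      show ?case
      proof (cases "edge_form L c v \<ge> 0")
        case True
        then have "edge_form L c1 v \<ge> 0" if "c1 \<in> edges L t" for c1
          using elim(2) others[OF Im c that] that by (cases "c1 = c") (auto simp: less_imp_le)
        then have "v \<in> cell L t" using elim(3) by (simp add: cell_def)
        moreover have "Re v \<noteq> 0" using elim(1) by auto
        ultimately show ?thesis by (rule developed_cell)
      next
        case False
        obtain k where "k > 0" "edge_form L c' (?T v) = - k * edge_form L c v" using form[OF elim(3)] by blast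
        with False have "edge_form L c' (?T v) \<ge> 0" by (simp add: mult_nonneg_nonpos)
        then have "edge_form L c1 (?T v) \<ge> 0" if "c1 \<in> edges L t" for c1
          using elim(5) others[OF ImT[OF Im] c' Tu that] that by (cases "c1 = c'") (auto simp: less_imp_le)
        then have "?T v \<in> cell L t" using elim(3) by (simp add: cell_def)
        moreover have "Re (?T v) \<noteq> 0" using elim(4) by auto
        ultimately have "developed t t' (?T v) (twist (t' - t) (?T v))" by (rule developed_cell)
        then have "developed t t' (?T v) (moebius (rep L t' w) (twist (t' - t) v))"
          using cross[OF elim(3,1,4)] by simp
        from developed_hol[OF this, of "inv_word w"] show ?thesis
          using elim(3) by (simp add: hol_inv_word)
      qed
    qed
  qed
qed

lemma ex_earthquake_map:
  "\<exists>E. earthquake_map r (transl L) (genB L t) (transl L) (genB L (t - r * L)) E"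
proof
  define t' where "t' = t - r * L"
  define d where "d = t' - t"
  define E where "E v = (THE y. developed t t' v y)" for v
  have E: "E v = y" if "developed t t' v y" for v y
    unfolding E_def using that developed_unique by blast
  have dev: "developed t t' z (E z)" if z: "z \<in> cut_plane (transl L) (genB L t)" for z
  proof -
    obtain w u where "u \<in> cell L t" "Re u \<noteq> 0" "z = moebius (rep L t w) u" using z by (rule cut_planeE)
    then have "developed t t' z (moebius (rep L t' w) (twist (t' - t) u))"
      unfolding developed_def by blast
    with E show ?thesis by simp
  qed
  show "earthquake_map r (transl L) (genB L t) (transl L) (genB L (t - r * L)) E"
    unfolding earthquake_map_def geodesic_length_transl t'_def[symmetric]
  proof (intro conjI ballI allI)
    fix z assume z: "z \<in> cut_plane (transl L) (genB L t)"
    then obtain w u where u: "u \<in> cell L t" "Re u \<noteq> 0" "z = moebius (rep L t w) u" by (rule cut_planeE)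
    have Im: "Im u > 0" using u(1) by (rule cellD)
    define N where "N = (if Re u > 0 then mat 1 else transl d)"
    have N: "N \<in> SL2" by (simp add: N_def)
    have "\<forall>\<^sub>F v in nhds u. Re v * Re u > 0"
    proof -
      have "isCont (\<lambda>v. Re v * Re u) u" by (intro continuous_intros isCont_Re[OF continuous_ident])
      moreover have "Re u * Re u > 0" using u(2) by (simp add: zero_less_mult_iff) linarith
      ultimately show ?thesis by (rule eventually_isCont_gt)
    qed
    with developed_near[OF u(1,2), of t'] eventually_upper[OF Im]
    have near: "\<forall>\<^sub>F v in nhds u. Im v > 0 \<and> developed t t' v (moebius N v)"
    proof eventually_elim
      case (elim v)
      then have "twist (t' - t) v = moebius N v"
        by (auto simp: twist_def N_def d_def moebius_transl zero_less_mult_iff)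
      with elim show ?case by simp
    qed
    let ?W = "rep L t w" and ?V = "rep L t' w"
    have pull: "moebius (matrix_inv ?W) z = u" using Im by (simp add: u(3))
    have Imz: "Im z > 0" using Im by (simp add: u(3))
    have "\<forall>\<^sub>F v in nhds z. Im (moebius (matrix_inv ?W) v) > 0 \<and>
        developed t t' (moebius (matrix_inv ?W) v) (moebius N (moebius (matrix_inv ?W) v))"
      by (rule eventually_moebius) (use near pull Imz in simp_all)
    with eventually_upper[OF Imz] have "\<forall>\<^sub>F v in nhds z. E v = moebius (?V ** N ** matrix_inv ?W) v"
    proof eventually_elim
      case (elim v)
      then have "developed t t' (moebius (matrix_inv ?W) v) (moebius N (moebius (matrix_inv ?W) v))" by simp
      from developed_hol[OF this, of w] E elim(1) N show ?case by (simp add: moebius_mult)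
    qed
    then show "\<exists>M\<in>SL2. \<forall>\<^sub>F v in nhds z. E v = moebius M v"
      using N by (intro bexI[of _ "?V ** N ** matrix_inv ?W"]) simp_all
  next
    fix h z assume h: "h \<in> lifts_alpha (transl L) (genB L t)" and z: "z \<in> geodesic h"
    obtain w where w: "geodesic h = moebius (rep L t w) ` {z \<in> upper_half_plane. Re z = 0}"
      "right_side h = moebius (rep L t w) ` {z \<in> upper_half_plane. Re z > 0}"
      "left_side h = moebius (rep L t w) ` {z \<in> upper_half_plane. Re z < 0}"
      "\<And>s. transl_along h s = rep L t w ** transl s ** matrix_inv (rep L t w)"
      using h by (rule lifts_alphaE) blast
    let ?W = "rep L t w" and ?V = "rep L t' w"
    obtain u where u: "Im u > 0" "Re u = 0" "z = moebius ?W u"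
      using z unfolding w(1) by (auto simp: upper_half_plane_def)
    have Imz: "Im z > 0" using u by simp
    have "\<forall>\<^sub>F v in nhds u. sinh (L/2) * \<bar>Re v\<bar> < Im v"
    proof -
      have "open {v. sinh (L/2) * \<bar>Re v\<bar> < Im v}" by (intro open_Collect_less continuous_intros)
      from eventually_nhds_in_open[OF this, of u] u show ?thesis by simp
    qed
    then have "\<forall>\<^sub>F v in nhds z. sinh (L/2) * \<bar>Re (moebius (matrix_inv ?W) v)\<bar> < Im (moebius (matrix_inv ?W) v)"
      by (intro eventually_moebius) (use u in simp_all)
    with eventually_upper[OF Imz]
    have "\<forall>\<^sub>F v in nhds z. (v \<in> right_side h \<longrightarrow> E v = moebius (?V ** matrix_inv ?W) v) \<and>
        (v \<in> left_side h \<longrightarrow> E v = moebius (?V ** matrix_inv ?W ** transl_along h (- (r * L))) v)"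
    proof eventually_elim
      case (elim v)
      define u1 where "u1 = moebius (matrix_inv ?W) v"
      have Im1: "Im u1 > 0" using elim by (simp add: u1_def)
      have v: "v = moebius ?W u1" using elim by (simp add: u1_def)
      have cell: "u1 \<in> cell L t" using elim Im1 by (intro thin_cone_in_cell) (auto simp: u1_def)
      have Ev: "E v = moebius ?V (twist d u1)" if "Re u1 \<noteq> 0"
        using developed_hol[OF developed_cell[OF cell that, of t'], of w] E v by (simp add: d_def)
      have side: "\<exists>x. Im x > 0 \<and> P (Re x) \<and> v = moebius ?W x \<Longrightarrow> P (Re u1)" for P
        using elim by (auto simp: u1_def)
      have "E v = moebius (?V ** matrix_inv ?W) v" if "v \<in> right_side h"
      proof -
        have "Re u1 > 0" using that side[of "\<lambda>x. x > 0"] unfolding w(2) by (auto simp: upper_half_plane_def)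
        then have "E v = moebius ?V u1" using Ev by (simp add: twist_def)
        also have "\<dots> = moebius (?V ** matrix_inv ?W) v" using elim(1) by (simp add: u1_def moebius_mult)
        finally show ?thesis .
      qed
      moreover have "E v = moebius (?V ** matrix_inv ?W ** transl_along h (- (r * L))) v" if "v \<in> left_side h"
      proof -
        have "Re u1 < 0" using that side[of "\<lambda>x. x < 0"] unfolding w(3) by (auto simp: upper_half_plane_def)
        then have "E v = moebius ?V (moebius (transl d) u1)" using Ev by (simp add: twist_def moebius_transl)
        also have "\<dots> = moebius (?V ** (transl d ** matrix_inv ?W)) v"
          using elim(1) by (simp add: u1_def moebius_mult)
        also have "?V ** (transl d ** matrix_inv ?W) = ?V ** matrix_inv ?W ** transl_along h (- (r * L))"
          unfolding w(4) by (simp add: d_def t'_def SL2_cancel flip: matrix_mul_assoc)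
        finally show ?thesis .
      qed
      ultimately show ?case by blast
    qed
    moreover have "?V ** matrix_inv ?W \<in> SL2" by simp
    ultimately show "\<exists>M\<in>SL2. \<forall>\<^sub>F u in nhds z.
        (u \<in> right_side h \<longrightarrow> E u = moebius M u) \<and>
        (u \<in> left_side h \<longrightarrow> E u = moebius (M ** transl_along h (- (r * L))) u)" by blast
  next
    fix w z assume "z \<in> cut_plane (transl L) (genB L t)"
    from developed_hol[OF dev[OF this], of w] E
    show "E (moebius (rep L t w) z) = moebius (rep L t' w) (E z)" by simp
  qed
qed

end

section \<open>The normal form is a marked structure\<close>

lemma Re_moebius_rotation:
  "Re (moebius (mat22 c s (- s) c) (of_real e * \<i>)) = c * s * (1 - e\<^sup>2) / (c\<^sup>2 + (s * e)\<^sup>2)"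
proof -
  have "s * c - c * e * (s * e) = c * s * (1 - e\<^sup>2)" by (simp add: algebra_simps power2_eq_square)
  then show ?thesis by (simp add: moebius_mat22 Re_divide)
qed

lemma rotation_fixes_i: "c\<^sup>2 + s\<^sup>2 = 1 \<Longrightarrow> moebius (mat22 c s (- s) c) \<i> = \<i>"
proof -
  assume "c\<^sup>2 + s\<^sup>2 = 1"
  then have "complex_of_real (- s) * \<i> + of_real c \<noteq> 0"
    by (intro moebius_denom_nonzero[of c c s]) (auto simp: power2_eq_square)
  then show ?thesis by (simp add: moebius_mat22 divide_eq_eq algebra_simps)
qed

lemma fixes_i_rotation:
  assumes "M \<in> SL2" "moebius M \<i> = \<i>"
  obtains c s where "M = mat22 c s (- s) c" "c\<^sup>2 + s\<^sup>2 = 1"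
proof -
  obtain a b c d where M: "M = mat22 a b c d" "a*d - b*c = 1" using assms(1) by (rule SL2_cases)
  have "complex_of_real c * \<i> + of_real d \<noteq> 0" using moebius_denom_nonzero[OF M(2)] by simp
  then have "complex_of_real a * \<i> + of_real b = \<i> * (of_real c * \<i> + of_real d)"
    using assms(2) by (simp add: M(1) moebius_mat22 divide_eq_eq)
  then have "b = - c" "a = d" by (simp_all add: complex_eq_iff)
  with M that[of a b] show thesis by (simp add: power2_eq_square)
qed

lemma rotation_conj_transl:
  assumes "c\<^sup>2 + s\<^sup>2 = 1"
  shows "mat22 c s (- s) c ** transl l ** matrix_inv (mat22 c s (- s) c) =
    mat22 (cosh (l/2) + (c\<^sup>2 - s\<^sup>2) * sinh (l/2)) (- (2 * c * s * sinh (l/2)))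
      (- (2 * c * s * sinh (l/2))) (cosh (l/2) - (c\<^sup>2 - s\<^sup>2) * sinh (l/2))"
proof -
  have det: "c * c - s * (- s) = 1" using assms by (simp add: power2_eq_square)
  have c2: "c\<^sup>2 = 1 - s\<^sup>2" using assms by simp
  have e: "exp (l/2) = cosh (l/2) + sinh (l/2)" "exp (-l/2) = cosh (l/2) - sinh (l/2)"
    by (simp_all add: cosh_plus_sinh cosh_minus_sinh)
  show ?thesis
    unfolding matrix_inv_SL2[OF det] transl_eq_mat22 e mat22_mult mat22_eq_iff
    using c2 by (simp add: algebra_simps power2_eq_square) algebra
qed

lemma transl_conj_mat22:
  "transl s ** mat22 a b c d ** transl (- s) = mat22 a (exp s * b) (exp (- s) * c) d"
proof -
  define e m where em: "e = exp (s/2)" "m = exp (- (s/2))"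
  have e: "exp s = e * e" "exp (- s) = m * m" by (simp_all add: em flip: exp_add)
  have "e * m = 1" by (simp add: em flip: exp_add)
  then have "e * a * m = a" "m * d * e = d" by (metis mult.assoc mult.commute mult.right_neutral)+
  then show ?thesis unfolding e by (simp add: transl_eq_mat22 em[symmetric])
qed

definition coords :: "real \<Rightarrow> real \<Rightarrow> real \<times> real \<times> real" where
  "coords L t = (2 * cosh (L/2), 2 * (cosh (L/2) / sinh (L/2)) * cosh (t/2),
     2 * (cosh (L/2) / sinh (L/2)) * cosh ((L + t)/2))"

context translation_length
begin

lemma trace_genB: "trace (genB L t) = 2 * (cosh (L/2) / sinh (L/2)) * cosh (t/2)"
  by (simp add: genB_def cosh_field_def[of "t/2"] add_divide_distrib algebra_simps)

lemma trace_genB_gt_2: "trace (genB L t) > 2"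
proof -
  have "cosh (L/2) / sinh (L/2) > 1" using sinh_pos sinh_less_cosh_real[of "L/2"] by simp
  then have "2 * 1 < 2 * (cosh (L/2) / sinh (L/2))" by (intro mult_strict_left_mono) auto
  also have "2 * (cosh (L/2) / sinh (L/2)) * 1 \<le> 2 * (cosh (L/2) / sinh (L/2)) * cosh (t/2)"
    using sinh_pos cosh_real_ge_1[of "t/2"] by (intro mult_left_mono) auto
  finally show ?thesis by (simp add: trace_genB)
qed

lemma trace_coords_normal_form: "trace_coords (transl L) (genB L t) = coords L t"
  by (simp add: trace_coords_def coords_def trace_transl trace_genB transl_genB)

lemma faithful_rep:
  assumes "reduced w" "w \<noteq> []"
  shows "rep L t w \<noteq> mat 1" "rep L t w \<noteq> - mat 1"
proof -
  have free: "edge_form L c \<i> > 0" if "c \<in> edges L t" for c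
    using edges_nonzero[OF that] by (simp add: edge_form_def add_pos_nonneg)
  have "moebius (rep L t w) \<i> \<noteq> \<i>"
  proof
    assume eq: "moebius (rep L t w) \<i> = \<i>"
    then consider n :: int where "n \<noteq> 0" "\<i> = of_real (exp (L * of_int n)) * \<i>"
      | c where "c \<in> edges L t" "edge_form L c \<i> < 0"
      using escape[OF assms, of \<i> t] free by auto
    then show False
    proof cases
      case (1 n)
      then have "Im \<i> = exp (L * of_int n)" by (metis Im_i_times Re_complex_of_real mult.commute)
      with 1(1) L_pos show False by simp
    qed (use free in force)
  qed
  then show "rep L t w \<noteq> mat 1" "rep L t w \<noteq> - mat 1" by (metis moebius_1 moebius_uminus)+
qed

text \<open>
  The trace of the commutator is \<open>- 2\<close> by computation; that it is not minus the identity is a case of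
  faithfulness.
\<close>

lemma parabolic_commutator:
  "parabolic (transl L ** genB L t ** matrix_inv (transl L) ** matrix_inv (genB L t))"
proof -
  let ?C = "cosh (L/2)" and ?S = "sinh (L/2)"
  let ?w = "[(Alpha, True), (Beta, True), (Alpha, False), (Beta, False)]"
  let ?K = "transl L ** genB L t ** matrix_inv (transl L) ** matrix_inv (genB L t)"
  have K: "rep L t ?w = ?K" by (simp add: matrix_mul_assoc)
  have "reduced ?w" by (simp add: reduced_def)
  then have ne: "?K \<noteq> mat 1" "?K \<noteq> - mat 1" using faithful_rep[of ?w t] unfolding K by simp_all
  define p q u v where pquv: "p = exp (t/2) * ?C / ?S" "q = - exp (t/2) / ?S" "u = - exp (-t/2) / ?S"
    "v = exp (-t/2) * ?C / ?S"
  have B: "genB L t = mat22 p q u v" by (simp add: genB_def pquv)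
  have det: "p * v - q * u = 1" using genB_SL2[of t] unfolding B by simp
  have qu: "q * u = 1 / ?S\<^sup>2" using exp_half_mult[of t] by (simp add: pquv power2_eq_square)
  define l m where lm: "l = exp (L/2)" "m = exp (-L/2)"
  have A: "transl L = mat22 l 0 0 m" by (simp add: transl_eq_mat22 lm)
  have lm1: "l * m = 1" unfolding lm by (rule exp_half_mult)
  have det_A: "l * m - 0 * 0 = 1" using lm1 by simp
  have "trace ?K = (l * m) * (p * v) * 2 - (l * l + m * m) * (q * u)"
    unfolding matrix_inv_SL2[OF det] A matrix_inv_SL2[OF det_A] B mat22_mult trace_mat22
    by (simp add: algebra_simps)
  also have "p * v = 1 + q * u" using det by simp
  also have "(l * m) * (1 + q * u) * 2 - (l * l + m * m) * (q * u) = 2 - (l - m)\<^sup>2 * (q * u)"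
    using lm1 by (simp add: algebra_simps power2_eq_square)
  also have "l - m = 2 * ?S" by (simp add: lm sinh_field_def)
  finally have "trace ?K = -2" using sinh_pos by (simp add: qu power_mult_distrib)
  with ne show ?thesis by (simp add: parabolic_def)
qed

lemma positively_crossing_normal_form: "positively_crossing (transl L) (genB L t)"
proof -
  let ?C = "cosh (L/2)" and ?S = "sinh (L/2)"
  define a d where ad: "a = exp (t/2) * ?C / ?S" "d = exp (-t/2) * ?C / ?S"
  define l where "l = geodesic_length (genB L t)"
  have tr: "trace (genB L t) = a + d" by (simp add: genB_def ad)
  have "l/2 = arcosh ((a + d) / 2)" by (simp add: l_def geodesic_length_def tr)
  then have ch: "cosh (l/2) = (a + d) / 2" using trace_genB_gt_2[of t] by (simp add: tr)
  have "l \<ge> 0" using trace_genB_gt_2[of t] by (simp add: l_def geodesic_length_def)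
  moreover have "l \<noteq> 0" using ch trace_genB_gt_2[of t] tr by auto
  ultimately have l: "sinh (l/2) > 0" by simp
  define N where "N = 2 * sinh (l/2)"
  have N: "N > 0" using l by (simp add: N_def)
  have prod: "a * d = 1 + 1 / ?S\<^sup>2"
  proof -
    have "a * d = (exp (t/2) * exp (-t/2)) * (?C\<^sup>2 / ?S\<^sup>2)" by (simp add: ad power2_eq_square)
    also have "\<dots> = 1 + 1 / ?S\<^sup>2" using sinh_pos unfolding exp_half_mult cosh_sq by (simp add: field_simps)
    finally show ?thesis .
  qed
  have N2: "N\<^sup>2 = (a - d)\<^sup>2 + (2 / ?S)\<^sup>2"
  proof -
    have "N\<^sup>2 = 4 * ((cosh (l/2))\<^sup>2 - 1)" by (simp add: N_def power_mult_distrib sinh_square_eq)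
    also have "\<dots> = (a + d)\<^sup>2 - 4" by (simp add: ch power_divide)
    also have "\<dots> = (a - d)\<^sup>2 + 4 * (a * d) - 4" by (simp add: algebra_simps power2_eq_square)
    finally show ?thesis by (simp add: prod power_divide)
  qed
  \<comment> \<open>\<open>q\<close> is the cosine of the angle between the two axes, and \<open>c, s\<close> are the cosine and the sine of
    half this angle; \<open>transl (t/2)\<close> moves \<open>\<i>\<close> to the point where they cross\<close>
  define q where "q = (a - d) / N"
  define c s where cs: "c = sqrt ((1 + q) / 2)" "s = sqrt ((1 - q) / 2)"
  have "\<bar>a - d\<bar>\<^sup>2 < N\<^sup>2" using N2 sinh_pos by simp
  then have "\<bar>a - d\<bar> < N" by (rule power2_less_imp_less) (use N in simp)
  then have q: "\<bar>q\<bar> < 1" using N by (simp add: q_def abs_divide)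
  then have c2: "c\<^sup>2 = (1 + q) / 2" "s\<^sup>2 = (1 - q) / 2" and pos: "c > 0" "s > 0"
    unfolding cs by (simp_all add: abs_less_iff)
  have sum1: "c\<^sup>2 + s\<^sup>2 = 1" and diff: "c\<^sup>2 - s\<^sup>2 = q" unfolding c2 by (simp_all add: field_simps)
  have "(c * s * N)\<^sup>2 = (1 / ?S)\<^sup>2"
  proof -
    have "(c * s * N)\<^sup>2 = c\<^sup>2 * s\<^sup>2 * N\<^sup>2" by (simp add: power_mult_distrib)
    also have "\<dots> = (1 - q\<^sup>2) / 4 * N\<^sup>2" unfolding c2 by (simp add: algebra_simps power2_eq_square)
    also have "\<dots> = (N\<^sup>2 - (q * N)\<^sup>2) / 4" by (simp add: algebra_simps)
    also have "q * N = a - d" using N by (simp add: q_def)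
    finally show ?thesis by (simp add: N2 power_divide)
  qed
  then have csN: "c * s * N = 1 / ?S" using pos N sinh_pos by (simp add: power2_eq_iff_nonneg)
  let ?R = "mat22 c s (- s) c" and ?P = "transl (t/2)"
  have R: "?R \<in> SL2" using sum1 by (simp add: power2_eq_square)
  have "q * sinh (l/2) = (a - d) / 2" using N by (simp add: q_def N_def)
  then have conj: "?R ** transl l ** matrix_inv ?R = mat22 a (- 1 / ?S) (- 1 / ?S) d"
    unfolding rotation_conj_transl[OF sum1] ch diff using csN by (simp add: N_def field_simps)
  have B: "genB L t = ?P ** (?R ** transl l ** matrix_inv ?R) ** matrix_inv ?P"
  proof -
    show ?thesis unfolding conj matrix_inv_transl transl_conj_mat22 genB_def ad by simp
  qed
  show ?thesis unfolding positively_crossing_def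
  proof (rule exI[of _ ?P], rule exI[of _ "?P ** ?R"], intro conjI allI impI)
    have "?P ** transl L ** matrix_inv ?P = transl L" by (simp add: matrix_inv_transl transl_add)
    then show "is_axis (transl L) ?P"
      using cosh_gt_1 by (simp add: is_axis_def transl_along_def geodesic_length_transl trace_transl)
    have "genB L t = (?P ** ?R) ** transl l ** matrix_inv (?P ** ?R)"
      using R by (subst B) (simp add: matrix_inv_mult_SL2 matrix_mul_assoc)
    moreover have "?P ** ?R \<in> SL2" using R by simp
    ultimately show "is_axis (genB L t) (?P ** ?R)"
      using trace_genB_gt_2 unfolding is_axis_def transl_along_def l_def[symmetric] by blast
    show "moebius ?P \<i> = moebius (?P ** ?R) \<i>"
      using R by (simp add: moebius_mult rotation_fixes_i[OF sum1])
    have act: "moebius (?P ** ?R ** transl \<tau>) \<i> = moebius ?P (moebius ?R (of_real (exp \<tau>) * \<i>))" for \<tau>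
      using R by (simp add: moebius_mult moebius_transl)
    have up: "moebius ?R (of_real (exp \<tau>) * \<i>) \<in> upper_half_plane" for \<tau>
      using R unfolding upper_half_plane_def mem_Collect_eq by (intro moebius_upper) simp_all
    have D: "c\<^sup>2 + (s * exp \<tau>)\<^sup>2 > 0" for \<tau> using pos by (intro add_pos_nonneg) auto
    show "moebius (?P ** ?R ** transl \<tau>) \<i> \<in> left_side ?P" if "\<tau> > 0" for \<tau>
    proof -
      have "(exp \<tau>)\<^sup>2 > 1" using that by (simp add: one_less_power)
      then have "Re (moebius ?R (of_real (exp \<tau>) * \<i>)) < 0"
        unfolding Re_moebius_rotation using pos D[of \<tau>] by (intro divide_neg_pos mult_pos_neg) auto
      with up show ?thesis unfolding act left_side_def by blast
    qed
    show "moebius (?P ** ?R ** transl \<tau>) \<i> \<in> right_side ?P" if "\<tau> < 0" for \<tau>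
    proof -
      have "(exp \<tau>)\<^sup>2 < 1" using that by (simp add: power_less_one_iff)
      then have "Re (moebius ?R (of_real (exp \<tau>) * \<i>)) > 0"
        unfolding Re_moebius_rotation using pos D[of \<tau>] by (intro divide_pos_pos mult_pos_pos) auto
      with up show ?thesis unfolding act right_side_def by blast
    qed
  qed
qed

lemma marked_structure_normal_form: "marked_structure (transl L) (genB L t)"
proof -
  have "trace (genB L s) > 0" for s using trace_genB_gt_2[of s] by simp
  then have "trace (genB L t) > 0" "trace (transl L ** genB L t) > 0" by (simp_all add: transl_genB)
  moreover have "trace (transl L) > 0" by (simp add: trace_transl)
  ultimately show ?thesis
    unfolding marked_structure_def
    using discrete_rep faithful_rep parabolic_commutator positively_crossing_normal_form by simp
qed

text \<open>
  Move the axis of \<open>A\<close> to the imaginary axis and its crossing point with the axis of \<open>B\<close> to \<open>\<i>\<close>.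
  Then \<open>B\<close> becomes a symmetric matrix.  Its diagonal is determined by the traces of \<open>B\<close> and \<open>A B\<close>,
  and the off-diagonal entry by the determinant up to its sign; the sign is fixed by the direction
  in which \<open>B\<close> crosses \<open>A\<close>.
\<close>

lemma marked_structure_conj_normal_form:
  assumes "marked_structure A B" "trace_coords A B = coords L t"
  obtains P where "P \<in> SL2" "A = P ** transl L ** matrix_inv P" "B = P ** genB L t ** matrix_inv P"
proof -
  let ?C = "cosh (L/2)" and ?S = "sinh (L/2)"
  have tr: "trace A = 2 * ?C" "trace B = 2 * (?C / ?S) * cosh (t/2)"
    "trace (A ** B) = 2 * (?C / ?S) * cosh ((L + t)/2)"
    using assms(2) by (simp_all add: trace_coords_def coords_def)
  have AB: "A \<in> SL2" "B \<in> SL2" and cross: "positively_crossing A B"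
    using assms(1) by (simp_all add: marked_structure_def)
  obtain g k where axes: "is_axis A g" "is_axis B k" and pt: "moebius g \<i> = moebius k \<i>"
    and left: "\<And>\<tau>. \<tau> > 0 \<Longrightarrow> moebius (k ** transl \<tau>) \<i> \<in> left_side g"
    using cross unfolding positively_crossing_def by blast
  have g: "g \<in> SL2" and k: "k \<in> SL2" using axes by (simp_all add: is_axis_def)
  have "geodesic_length A = L" using L_pos by (simp add: geodesic_length_def tr arcosh_cosh_real)
  then have A: "A = g ** transl L ** matrix_inv g" using axes(1) by (simp add: is_axis_def transl_along_def)
  define l where "l = geodesic_length B"
  have B: "B = k ** transl l ** matrix_inv k" and "trace B > 2"
    using axes(2) by (simp_all add: is_axis_def transl_along_def l_def)
  then have "l \<ge> 0" "cosh (l/2) = trace B / 2" by (simp_all add: l_def geodesic_length_def)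
  then have l: "sinh (l/2) > 0" using \<open>trace B > 2\<close> by (cases "l = 0") auto
  define R where "R = matrix_inv g ** k"
  have R: "R \<in> SL2" using g k by (simp add: R_def)
  have "moebius R \<i> = \<i>" using g k by (simp add: R_def moebius_mult flip: pt)
  then obtain c s where cs: "R = mat22 c s (- s) c" "c\<^sup>2 + s\<^sup>2 = 1" using R by (elim fixes_i_rotation)
  have "moebius g (moebius R (of_real (exp 1) * \<i>)) = moebius (k ** transl 1) \<i>"
    using g k by (simp add: R_def moebius_mult moebius_transl)
  then obtain x where x: "Im x > 0" "Re x < 0" "moebius g (moebius R (of_real (exp 1) * \<i>)) = moebius g x"
    using left[of 1] by (auto simp: left_side_def upper_half_plane_def)
  have "Im (moebius R (of_real (exp 1) * \<i>)) > 0" using R by simp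
  then have "moebius R (of_real (exp 1) * \<i>) = x" using x(1,3) g by (metis moebius_inverse(2))
  with x(2) cs(1) have "Re (moebius (mat22 c s (- s) c) (of_real (exp 1) * \<i>)) < 0" by simp
  then have "c * s * (1 - (exp 1)\<^sup>2) / (c\<^sup>2 + (s * exp 1)\<^sup>2) < 0"
    unfolding Re_moebius_rotation .
  moreover have "(exp 1 :: real)\<^sup>2 > 1" by (simp add: one_less_power)
  ultimately have cs_pos: "c * s > 0"
    by (smt (verit) divide_nonneg_nonneg mult_nonpos_nonpos zero_le_power2)
  define B1 where "B1 = matrix_inv g ** B ** g"
  define a d b where abd: "a = cosh (l/2) + (c\<^sup>2 - s\<^sup>2) * sinh (l/2)"
    "d = cosh (l/2) - (c\<^sup>2 - s\<^sup>2) * sinh (l/2)" "b = - (2 * c * s * sinh (l/2))"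
  have "B1 = R ** transl l ** matrix_inv R"
    using g k by (simp add: B1_def B R_def matrix_inv_mult_SL2 matrix_mul_assoc)
  then have B1: "B1 = mat22 a b b d" unfolding cs(1) rotation_conj_transl[OF cs(2)] abd .
  have b_neg: "b < 0" using mult_pos_pos[OF cs_pos l] by (simp add: abd mult.assoc)
  have B_B1: "B = g ** B1 ** matrix_inv g"
    using g by (simp add: B1_def SL2_cancel flip: matrix_mul_assoc)
  have "B1 \<in> SL2" using g AB by (simp add: B1_def)
  then have det: "a * d - b * b = 1" by (simp add: B1)
  define a0 d0 where ad0: "a0 = exp (t/2) * ?C / ?S" "d0 = exp (-t/2) * ?C / ?S"
  have "trace B = trace B1" unfolding B_B1 using g by (rule trace_conj)
  moreover have "a0 + d0 = trace (genB L t)" by (simp add: genB_def ad0)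
  ultimately have eq1: "a + d = a0 + d0" by (simp add: tr B1 trace_genB)
  have "A ** B = g ** (transl L ** B1) ** matrix_inv g"
    unfolding A B_B1 using g by (simp add: SL2_cancel flip: matrix_mul_assoc)
  then have "trace (A ** B) = trace (transl L ** B1)" using trace_conj[OF g] by simp
  moreover have "2 * (?C / ?S) * cosh ((L + t)/2) = exp (L/2) * a0 + exp (-L/2) * d0"
  proof -
    have "2 * (?C / ?S) * cosh ((L + t)/2) = trace (transl L ** genB L t)"
      by (simp add: transl_genB trace_genB)
    then show ?thesis by (simp add: genB_def transl_eq_mat22 ad0)
  qed
  ultimately have eq2: "exp (L/2) * a + exp (-L/2) * d = exp (L/2) * a0 + exp (-L/2) * d0"
    by (simp add: tr B1 transl_eq_mat22)
  have "(exp (L/2) - exp (-L/2)) * (a - a0) = 0"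
  proof -
    have "d = a0 + d0 - a" using eq1 by simp
    with eq2 show ?thesis by (simp add: algebra_simps)
  qed
  moreover have "exp (L/2) - exp (-L/2) \<noteq> 0" using L_pos by simp
  ultimately have a: "a = a0" and d: "d = d0" using eq1 by auto
  have "a0 * d0 = (exp (t/2) * exp (-t/2)) * (?C\<^sup>2 / ?S\<^sup>2)" by (simp add: ad0 power2_eq_square)
  also have "\<dots> = 1 + (1 / ?S)\<^sup>2" using sinh_pos unfolding exp_half_mult cosh_sq by (simp add: field_simps)
  finally have "b\<^sup>2 = (1 / ?S)\<^sup>2" using det a d by (simp add: power2_eq_square)
  then have b: "b = - 1 / ?S" using b_neg sinh_pos by (auto simp: power2_eq_iff)
  let ?P = "g ** transl (- t/2)"
  have conj: "transl (- t/2) ** genB L t ** transl (t/2) = B1"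
  proof -
    have "transl (t/2) ** B1 ** transl (- (t/2)) = genB L t"
      unfolding B1 a d b transl_conj_mat22 genB_def ad0 by simp
    then have "transl (- t/2) ** (transl (t/2) ** B1 ** transl (- (t/2))) ** transl (t/2) =
        transl (- t/2) ** genB L t ** transl (t/2)" by simp
    then show ?thesis
      by (simp add: matrix_mul_assoc transl_add transl_0) (simp add: transl_add transl_0 flip: matrix_mul_assoc)
  qed
  then have 2: "B = ?P ** genB L t ** matrix_inv ?P"
    unfolding B_B1 conj[symmetric] using g
    by (simp add: matrix_inv_mult_SL2 matrix_inv_transl matrix_mul_assoc)
  have "transl (- t/2) ** transl L ** transl (t/2) = transl L" by (simp add: transl_add)
  then have 1: "A = ?P ** transl L ** matrix_inv ?P"
    unfolding A using g by (simp add: matrix_inv_mult_SL2 matrix_inv_transl) (metis matrix_mul_assoc)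
  show thesis using that[of ?P] 1 2 g by simp
qed

end

section \<open>Conjugation of earthquake maps\<close>

lemma transl_along_conj:
  assumes "P \<in> SL2" "g \<in> SL2"
  shows "transl_along (P ** g) s = P ** transl_along g s ** matrix_inv P"
  using assms by (simp add: transl_along_def matrix_inv_mult_SL2 matrix_mul_assoc)

lemma is_axis_conj:
  assumes "P \<in> SL2" "is_axis A g"
  shows "is_axis (P ** A ** matrix_inv P) (P ** g)"
proof -
  have g: "g \<in> SL2" "trace A > 2" "A = transl_along g (geodesic_length A)"
    using assms(2) by (simp_all add: is_axis_def)
  have tr: "trace (P ** A ** matrix_inv P) = trace A" using assms(1) by (rule trace_conj)
  then have "geodesic_length (P ** A ** matrix_inv P) = geodesic_length A"
    by (simp add: geodesic_length_def)
  with g tr assms(1) show ?thesis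
    unfolding is_axis_def by (simp add: transl_along_conj)
qed

lemma moebius_mult_image:
  assumes "P \<in> SL2" "g \<in> SL2" "S \<subseteq> upper_half_plane"
  shows "moebius (P ** g) ` S = moebius P ` moebius g ` S"
  unfolding image_image using assms
  by (intro image_cong refl) (auto simp: moebius_mult upper_half_plane_def)

lemma sides_mult:
  assumes "P \<in> SL2" "g \<in> SL2"
  shows "geodesic (P ** g) = moebius P ` geodesic g"
    "left_side (P ** g) = moebius P ` left_side g"
    "right_side (P ** g) = moebius P ` right_side g"
  unfolding geodesic_def left_side_def right_side_def
  by (rule moebius_mult_image[OF assms]; blast)+

lemma lifts_alpha_conj:
  assumes "P \<in> SL2" "A \<in> SL2" "B \<in> SL2" "h \<in> lifts_alpha A B"
  shows "h \<in> SL2" "P ** h \<in> lifts_alpha (P ** A ** matrix_inv P) (P ** B ** matrix_inv P)"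
proof -
  obtain w g where h: "h = hol A B w ** g" "is_axis A g" using assms(4) by (auto simp: lifts_alpha_def)
  have "g \<in> SL2" using h(2) by (simp add: is_axis_def)
  with h assms show "h \<in> SL2" by simp
  have "P ** h = hol (P ** A ** matrix_inv P) (P ** B ** matrix_inv P) w ** (P ** g)"
    unfolding hol_conj[OF assms(2,3,1)] h(1) using assms(1)
    by (simp add: SL2_cancel flip: matrix_mul_assoc)
  with is_axis_conj[OF assms(1) h(2)]
  show "P ** h \<in> lifts_alpha (P ** A ** matrix_inv P) (P ** B ** matrix_inv P)"
    unfolding lifts_alpha_def by blast
qed

lemma conj_inverse:
  assumes "P \<in> SL2"
  shows "matrix_inv P ** (P ** A ** matrix_inv P) ** matrix_inv (matrix_inv P) = A"
  using assms by (simp add: SL2_cancel flip: matrix_mul_assoc)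

lemma cut_plane_conj:
  assumes P: "P \<in> SL2" and A: "A \<in> SL2" and B: "B \<in> SL2" and z: "z \<in> cut_plane A B"
  shows "moebius P z \<in> cut_plane (P ** A ** matrix_inv P) (P ** B ** matrix_inv P)"
proof -
  have Im: "Im z > 0" using z by (simp add: cut_plane_def upper_half_plane_def)
  have "moebius P z \<notin> geodesic h"
    if h: "h \<in> lifts_alpha (P ** A ** matrix_inv P) (P ** B ** matrix_inv P)" for h
  proof
    assume zh: "moebius P z \<in> geodesic h"
    note * = lifts_alpha_conj[OF SL2_inverse(1)[OF P] _ _ h]
    have "h \<in> SL2" "matrix_inv P ** h \<in> lifts_alpha A B"
      using * P A B unfolding conj_inverse[OF P] by simp_all
    moreover from this(1) have "geodesic (matrix_inv P ** h) = moebius (matrix_inv P) ` geodesic h"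
      using P by (intro sides_mult) simp_all
    then have "moebius (matrix_inv P) (moebius P z) \<in> geodesic (matrix_inv P ** h)" using zh by blast
    ultimately show False using z Im P by (auto simp: cut_plane_def)
  qed
  with Im P show ?thesis by (auto simp: cut_plane_def upper_half_plane_def)
qed

lemma geodesic_upper: "h \<in> SL2 \<Longrightarrow> z \<in> geodesic h \<Longrightarrow> Im z > 0"
  by (auto simp: geodesic_def upper_half_plane_def)

text \<open>
  Precomposing with an isometry of the plane conjugates the source holonomy and leaves the target
  alone.  This reduces uniqueness to structures in normal form.
\<close>

lemma earthquake_map_conj:
  assumes P: "P \<in> SL2" and A: "A \<in> SL2" and B: "B \<in> SL2"
    and E: "earthquake_map r (P ** A ** matrix_inv P) (P ** B ** matrix_inv P) A' B' E"
  shows "earthquake_map r A B A' B' (E \<circ> moebius P)"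
proof -
  let ?A = "P ** A ** matrix_inv P" and ?B = "P ** B ** matrix_inv P"
  have len: "geodesic_length ?A = geodesic_length A"
    using P by (simp add: geodesic_length_def trace_conj)
  note E' = E[unfolded earthquake_map_def len]
  show ?thesis unfolding earthquake_map_def
  proof (intro conjI ballI allI)
    fix z assume z: "z \<in> cut_plane A B"
    then have Im: "Im z > 0" by (simp add: cut_plane_def upper_half_plane_def)
    obtain M where M: "M \<in> SL2" "\<forall>\<^sub>F u in nhds (moebius P z). E u = moebius M u"
      using E' cut_plane_conj[OF P A B z] by blast
    have "\<forall>\<^sub>F u in nhds z. (E \<circ> moebius P) u = moebius (M ** P) u"
      using eventually_moebius[OF P Im M(2)] eventually_upper[OF Im]
      by eventually_elim (simp add: moebius_mult M(1) P)
    moreover have "M ** P \<in> SL2" using M P by simp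
    ultimately show "\<exists>M\<in>SL2. \<forall>\<^sub>F u in nhds z. (E \<circ> moebius P) u = moebius M u" by blast
  next
    fix h z assume h: "h \<in> lifts_alpha A B" and z: "z \<in> geodesic h"
    note h' = lifts_alpha_conj[OF P A B h]
    note sides = sides_mult[OF P h'(1)]
    have Im: "Im z > 0" using geodesic_upper[OF h'(1) z] .
    have "moebius P z \<in> geodesic (P ** h)" using z sides by blast
    then obtain M where M: "M \<in> SL2" "\<forall>\<^sub>F u in nhds (moebius P z).
        (u \<in> right_side (P ** h) \<longrightarrow> E u = moebius M u) \<and>
        (u \<in> left_side (P ** h) \<longrightarrow>
          E u = moebius (M ** transl_along (P ** h) (- (r * geodesic_length A))) u)"
      using E' h'(2) by blast
    define T where "T = transl_along h (- (r * geodesic_length A))"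
    have T: "T \<in> SL2" using h'(1) by (simp add: T_def transl_along_def)
    have "M ** transl_along (P ** h) (- (r * geodesic_length A)) ** P = M ** P ** T"
      unfolding transl_along_conj[OF P h'(1)] T_def[symmetric] using P
      by (simp add: SL2_cancel flip: matrix_mul_assoc)
    then have eq: "moebius (M ** transl_along (P ** h) (- (r * geodesic_length A))) (moebius P u) =
        moebius (M ** P ** T) u" if "Im u > 0" for u
      using that M(1) P T h'(1) by (simp add: moebius_mult[symmetric] transl_along_def)
    have "\<forall>\<^sub>F u in nhds z.
        (u \<in> right_side h \<longrightarrow> (E \<circ> moebius P) u = moebius (M ** P) u) \<and>
        (u \<in> left_side h \<longrightarrow> (E \<circ> moebius P) u = moebius (M ** P ** T) u)"
      using eventually_moebius[OF P Im M(2)] eventually_upper[OF Im]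
    proof eventually_elim
      case (elim u)
      show ?case
      proof (intro conjI impI)
        assume "u \<in> right_side h"
        then have "moebius P u \<in> right_side (P ** h)" unfolding sides by blast
        then show "(E \<circ> moebius P) u = moebius (M ** P) u"
          using elim by (simp add: moebius_mult M(1) P)
      next
        assume "u \<in> left_side h"
        then have "moebius P u \<in> left_side (P ** h)" unfolding sides by blast
        then show "(E \<circ> moebius P) u = moebius (M ** P ** T) u"
          using elim eq by simp
      qed
    qed
    moreover have "M ** P \<in> SL2" using M P by simp
    ultimately show "\<exists>M\<in>SL2. \<forall>\<^sub>F u in nhds z.
        (u \<in> right_side h \<longrightarrow> (E \<circ> moebius P) u = moebius M u) \<and>
        (u \<in> left_side h \<longrightarrow> (E \<circ> moebius P) u =
          moebius (M ** transl_along h (- (r * geodesic_length A))) u)"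
      unfolding T_def by blast
  next
    fix w z assume z: "z \<in> cut_plane A B"
    then have Im: "Im z > 0" by (simp add: cut_plane_def upper_half_plane_def)
    have "E (moebius (hol ?A ?B w) (moebius P z)) = moebius (hol A' B' w) (E (moebius P z))"
      using E' cut_plane_conj[OF P A B z] by blast
    moreover have "moebius (hol ?A ?B w) (moebius P z) = moebius P (moebius (hol A B w) z)"
      using P A B Im by (simp add: hol_conj moebius_mult)
    ultimately show "(E \<circ> moebius P) (moebius (hol A B w) z) = moebius (hol A' B' w) ((E \<circ> moebius P) z)"
      by simp
  qed
qed

section \<open>Uniqueness of the earthquake\<close>

lemma uminus_matrix_mult: "(- X) ** Y = - (X ** Y)" "X ** (- Y) = - (X ** Y)" for X Y :: mat2
  by (simp_all add: mat2_eq_iff matrix_matrix_mult_def sum_2)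

context translation_length
begin

text \<open>
  The connected set \<open>J\<close> joins the right side of the imaginary axis to the left side of its neighbour
  within the cut plane.  It consists of a cone to the right of the axis, of the preimage under \<open>B\<close> of
  a cone to its left, and of the midpoint \<open>m\<close> of the edge \<open>1\<close>, where their closures meet.
\<close>

lemma earthquake_trace_coords:
  assumes E: "earthquake_map r (transl L) (genB L t) A' B' E"
    and SL2: "A' \<in> SL2" "B' \<in> SL2"
    and pos: "trace A' > 0" "trace B' > 0" "trace (A' ** B') > 0"
  shows "trace_coords A' B' = coords L (t - r * L)"
proof -
  let ?S = "sinh (L/2)" and ?C = "cosh (L/2)" and ?A = "transl L" and ?B = "genB L t"
  define KR where "KR = {u. Re u > 0} \<inter> {u. ?S * Re u < Im u}"
  define KL where "KL = {u. Re u < 0} \<inter> {u. - (?S * Re u) < Im u}"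
  define m where "m = Complex (1 / ?C) (?S / ?C)"
  define m' where "m' = moebius ?B m"
  define KB where "KB = moebius (matrix_inv ?B) ` KL"
  define J where "J = KR \<union> {m} \<union> KB"
  have loc: "\<exists>M\<in>SL2. \<forall>\<^sub>F u in nhds z. E u = moebius M u" if "z \<in> cut_plane ?A ?B" for z
    using E that unfolding earthquake_map_def by blast
  have equiv: "E (moebius (rep L t w) z) = moebius (hol A' B' w) (E z)"
    if "z \<in> cut_plane ?A ?B" for w z
    using E that unfolding earthquake_map_def by blast
  have openK: "open KR" "open KL"
    unfolding KR_def KL_def by (intro open_Int open_Collect_less continuous_intros)+
  have KR_up: "Im u > 0" if "u \<in> KR" for u
  proof -
    have "?S * Re u > 0" using that sinh_pos by (simp add: KR_def)
    then show ?thesis using that by (simp add: KR_def)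
  qed
  have KL_up: "Im u > 0" if "u \<in> KL" for u
  proof -
    have "?S * Re u < 0" using that sinh_pos by (simp add: KL_def mult_pos_neg)
    then show ?thesis using that by (simp add: KL_def)
  qed
  have KR_cell: "u \<in> cell L t" "Re u \<noteq> 0" if "u \<in> KR" for u
    using that KR_up[OF that] by (auto simp: KR_def intro!: thin_cone_in_cell)
  have KL_cell: "u \<in> cell L t" "Re u \<noteq> 0" if "u \<in> KL" for u
    using that KL_up[OF that] by (auto simp: KL_def intro!: thin_cone_in_cell)
  have m_up: "Im m > 0" using sinh_pos by (simp add: m_def)
  have m_cell: "m \<in> cell L t" "Re m \<noteq> 0"
    using m_up by (auto simp: m_def intro!: thin_cone_in_cell)
  have cell_cut: "u \<in> cut_plane ?A ?B" if "u \<in> cell L t" "Re u \<noteq> 0" for u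
    using cell_in_cut_plane[OF that, of "[]"] by simp
  have B_inv: "moebius (matrix_inv ?B) u = moebius (rep L t [(Beta, False)]) u" for u by simp
  have J_cut: "z \<in> cut_plane ?A ?B" if "z \<in> J" for z
    using that cell_cut KR_cell m_cell cell_in_cut_plane[OF KL_cell]
    unfolding J_def KB_def B_inv by blast
  have J_up: "Im z > 0" if "z \<in> J" for z
    using J_cut[OF that] by (simp add: cut_plane_def upper_half_plane_def)
  have m_closure: "m \<in> closure KR"
  proof -
    have "((\<lambda>x. m + of_real x * \<i>) \<longlongrightarrow> m + of_real 0 * \<i>) (at_right 0)" by (intro tendsto_intros)
    moreover have "\<forall>\<^sub>F x in at_right 0. m + of_real x * \<i> \<in> closure KR"
      unfolding eventually_at_right_field
    proof (intro exI[of _ 1] conjI allI impI)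
      fix x :: real assume "0 < x"
      then have "m + of_real x * \<i> \<in> KR" by (simp add: KR_def m_def)
      then show "m + of_real x * \<i> \<in> closure KR" using closure_subset by blast
    qed simp
    ultimately show ?thesis by (intro Lim_in_closed_set[OF closed_closure, of _ _ "at_right 0"]) simp_all
  qed
  have m': "m' = of_real (exp t) * Complex (- 1 / ?C) (?S / ?C)"
  proof -
    have C: "complex_of_real ?C \<noteq> 0" by simp
    have n: "complex_of_real ?C - m = Complex (?S\<^sup>2 / ?C) (- ?S / ?C)"
      using cosh_sq by (simp add: m_def complex_eq_iff field_simps power2_eq_square)
    have "complex_of_real ?C * m - 1 = Complex 0 ?S" by (simp add: m_def complex_eq_iff)
    also have "\<dots> = Complex (- 1 / ?C) (?S / ?C) * (of_real ?C - m)"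
    proof -
      have "1 / ?C * (?S / ?C) + ?S / ?C * (?S\<^sup>2 / ?C) = ?S * (1 + ?S\<^sup>2) / ?C\<^sup>2"
        by (simp add: distrib_left add_divide_distrib power2_eq_square)
      also have "1 + ?S\<^sup>2 = ?C\<^sup>2" using cosh_sq by simp
      also have "?S * ?C\<^sup>2 / ?C\<^sup>2 = ?S" by simp
      finally show ?thesis unfolding n by (simp add: complex_eq_iff power2_eq_square)
    qed
    finally have "complex_of_real ?C * m - 1 = Complex (- 1 / ?C) (?S / ?C) * (of_real ?C - m)" .
    moreover have "complex_of_real ?C - m \<noteq> 0" using sinh_pos unfolding n by (simp add: complex_eq_iff)
    ultimately show ?thesis by (simp add: m'_def moebius_genB)
  qed
  have m_closure': "m \<in> closure KB"
  proof -
    have up: "Im m' > 0" using m_up by (simp add: m'_def)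
    have back_m: "moebius (matrix_inv ?B) m' = m" using m_up by (simp add: m'_def)
    have "((\<lambda>x. m' + of_real x * \<i>) \<longlongrightarrow> m' + of_real 0 * \<i>) (at_right 0)" by (intro tendsto_intros)
    then have lim: "((\<lambda>x. m' + of_real x * \<i>) \<longlongrightarrow> m') (at_right 0)" by simp
    have "((\<lambda>x. moebius (matrix_inv ?B) (m' + of_real x * \<i>)) \<longlongrightarrow> moebius (matrix_inv ?B) m') (at_right 0)"
      using continuous_moebius[OF SL2_inverse(1)[OF genB_SL2] up] lim by (rule isCont_tendsto_compose)
    moreover have "\<forall>\<^sub>F x in at_right 0. moebius (matrix_inv ?B) (m' + of_real x * \<i>) \<in> closure KB"
      unfolding eventually_at_right_field
    proof (intro exI[of _ 1] conjI allI impI)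
      fix x :: real assume "0 < x"
      then have "m' + of_real x * \<i> \<in> KL" by (simp add: KL_def m' mult.commute[of "?S" "exp t"])
      then show "moebius (matrix_inv ?B) (m' + of_real x * \<i>) \<in> closure KB"
        unfolding KB_def by (intro subsetD[OF closure_subset] imageI)
    qed simp
    ultimately show ?thesis unfolding back_m
      by (intro Lim_in_closed_set[OF closed_closure, of _ _ "at_right 0"]) simp_all
  qed
  have conn: "connected KR" "connected KL"
  proof -
    have lin: "convex {u. (a::complex) \<bullet> u < b}" for a b by (rule convex_halfspace_lt)
    have "KR = {u. Complex (-1) 0 \<bullet> u < 0} \<inter> {u. Complex ?S (-1) \<bullet> u < 0}"
      by (auto simp: KR_def inner_complex_def)
    then show "connected KR" using lin by (metis convex_Int convex_connected)
    have "KL = {u. Complex 1 0 \<bullet> u < 0} \<inter> {u. Complex (- ?S) (-1) \<bullet> u < 0}"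
      by (auto simp: KL_def inner_complex_def)
    then show "connected KL" using lin by (metis convex_Int convex_connected)
  qed
  have "continuous_on KL (moebius (matrix_inv ?B))"
    using KL_up by (intro continuous_at_imp_continuous_on ballI continuous_moebius) simp_all
  then have "connected KB" unfolding KB_def using conn(2) by (rule connected_continuous_image)
  have "connected (KR \<union> {m})" using m_closure closure_subset[of KR]
    by (intro connected_intermediate_closure[OF conn(1)]) auto
  moreover have "connected (KB \<union> {m})" using m_closure' closure_subset[of KB]
    by (intro connected_intermediate_closure[OF \<open>connected KB\<close>]) auto
  ultimately have "connected ((KR \<union> {m}) \<union> (KB \<union> {m}))" by (rule connected_Un) blast
  then have "connected J" by (simp add: J_def Un_ac insert_absorb)
  moreover have "J \<noteq> {}" by (simp add: J_def)
  ultimately obtain M where M: "M \<in> SL2" "\<And>z. z \<in> J \<Longrightarrow> \<forall>\<^sub>F u in nhds z. E u = moebius M u"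
    using locally_moebius_connected[of J E] J_up loc J_cut by metis
  have EM: "E z = moebius M z" if "z \<in> J" for z using M(2)[OF that] by (rule eventually_nhds_x_imp_x)

  \<comment> \<open>equivariance under \<open>A\<close> on the right cone, which \<open>A\<close> preserves\<close>
  have "A' ** M = M ** ?A \<or> A' ** M = - (M ** ?A)"
  proof (rule moebius_eq_on_open[OF _ _ openK(1)])
    define p where "p = Complex 1 (?S + 1)"
    show "p \<in> KR" by (simp add: KR_def p_def)
    then show "Im p > 0" by (rule KR_up)
    fix u assume u: "u \<in> KR" and Im: "Im u > 0"
    have Au: "moebius ?A u = of_real (exp L) * u" by (rule moebius_transl)
    have "moebius ?A u \<in> KR" using u by (simp add: KR_def Au mult_less_cancel_left_pos mult.left_commute)
    then have "E (moebius ?A u) = moebius M (moebius ?A u)" using EM by (simp add: J_def)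
    moreover have "E (moebius ?A u) = moebius A' (E u)"
      using equiv[OF cell_cut[OF KR_cell[OF u]], of "[(Alpha, True)]"] by simp
    moreover have "E u = moebius M u" using EM u by (simp add: J_def)
    ultimately show "moebius (A' ** M) u = moebius (M ** ?A) u"
      using Im M(1) SL2 by (simp add: moebius_mult)
  qed (use M(1) SL2 in simp_all)
  then have A': "A' = M ** ?A ** matrix_inv M \<or> A' = - (M ** ?A ** matrix_inv M)"
  proof -
    have "A' = A' ** M ** matrix_inv M" using M(1) by (simp flip: matrix_mul_assoc)
    then show ?thesis using \<open>A' ** M = M ** ?A \<or> A' ** M = - (M ** ?A)\<close>
      by (metis uminus_matrix_mult(1))
  qed

  \<comment> \<open>the jump across the imaginary axis, read off at the point \<open>\<i>\<close>\<close>
  have "mat 1 \<in> lifts_alpha ?A ?B" using lift_of_word[of t "[]"] by simp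
  moreover have "\<i> \<in> geodesic (mat 1)" by (simp add: geodesic_def upper_half_plane_def)
  ultimately have "\<exists>M\<in>SL2. \<forall>\<^sub>F u in nhds \<i>.
      (u \<in> right_side (mat 1) \<longrightarrow> E u = moebius M u) \<and>
      (u \<in> left_side (mat 1) \<longrightarrow> E u = moebius (M ** transl_along (mat 1) (- (r * L))) u)"
    using E unfolding earthquake_map_def geodesic_length_transl by blast
  moreover have "transl_along (mat 1) s = transl s" for s
    by (simp add: transl_along_def matrix_inv_eqI[of "mat 1" "mat 1"])
  ultimately obtain M' where M': "M' \<in> SL2" "\<forall>\<^sub>F u in nhds \<i>.
      (u \<in> right_side (mat 1) \<longrightarrow> E u = moebius M' u) \<and>
      (u \<in> left_side (mat 1) \<longrightarrow> E u = moebius (M' ** transl (- (r * L))) u)" by auto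
  then obtain U where U: "open U" "\<i> \<in> U"
    "\<And>u. u \<in> U \<Longrightarrow> Im u > 0 \<Longrightarrow> Re u > 0 \<Longrightarrow> E u = moebius M' u"
    "\<And>u. u \<in> U \<Longrightarrow> Im u > 0 \<Longrightarrow> Re u < 0 \<Longrightarrow> E u = moebius (M' ** transl (- (r * L))) u"
    unfolding eventually_nhds by (auto simp: right_side_def left_side_def upper_half_plane_def)
  obtain e where e: "e > 0" "ball \<i> e \<subseteq> U" using U(1,2) open_contains_ball by blast
  \<comment> \<open>small enough for \<open>\<i> + x\<close> and \<open>\<i> - x\<close> to lie in the two cones and in \<open>U\<close>\<close>
  define x where "x = min (e/2) (1 / (2 * (?S + 1)))"
  have x: "x > 0" "x < e" "?S * x < 1"
  proof -
    have "2 * (?S + 1) > 0" using add_pos_pos[OF sinh_pos zero_less_one] by (rule mult_pos_pos[OF zero_less_numeral])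
    then show "x > 0" "x < e" using e(1) by (auto simp: x_def simp del: distrib_left_numeral)
    have "?S * x \<le> ?S * (1 / (2 * (?S + 1)))" using sinh_pos by (intro mult_left_mono) (auto simp: x_def)
    also have "\<dots> < 1"
    proof -
      have "s * (1 / (2 * (s + 1))) < 1" if "s > 0" for s :: real using that by (simp add: field_simps)
      with sinh_pos show ?thesis by blast
    qed
    finally show "?S * x < 1" .
  qed
  have near: "\<i> + of_real x \<in> U \<inter> KR" "\<i> - of_real x \<in> U \<inter> KL"
    using e(2) x by (auto simp: KR_def KL_def dist_norm subset_iff)
  have "M' = M \<or> M' = - M"
  proof (rule moebius_eq_on_open[OF M'(1) M(1) open_Int[OF U(1) openK(1)] near(1)])
    show "moebius M' u = moebius M u" if "u \<in> U \<inter> KR" "Im u > 0" for u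
      using U(3)[of u] EM[of u] that by (simp add: J_def KR_def)
  qed simp
  then have M'_eq: "moebius (M' ** transl s) u = moebius (M ** transl s) u" if "Im u > 0" for s u
    using that M(1) M'(1) by (auto simp: moebius_mult)
  let ?T = "transl (- (r * L))"
  \<comment> \<open>a point slightly to the left of \<open>\<i>\<close> is the image under \<open>B\<close> of a point of \<open>J\<close>\<close>
  have "B' ** (M ** matrix_inv ?B) = M ** ?T \<or> B' ** (M ** matrix_inv ?B) = - (M ** ?T)"
  proof (rule moebius_eq_on_open[OF _ _ open_Int[OF U(1) openK(2)] near(2)])
    fix u assume u: "u \<in> U \<inter> KL" and Im: "Im u > 0"
    define v where "v = moebius (matrix_inv ?B) u"
    have v: "v \<in> J" using u by (auto simp: J_def KB_def v_def)
    have "moebius ?B v = u" using Im by (simp add: v_def)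
    then have "E u = moebius B' (E v)" using equiv[OF J_cut[OF v], of "[(Beta, True)]"] by simp
    also have "\<dots> = moebius (B' ** (M ** matrix_inv ?B)) u"
      using EM[OF v] Im M(1) SL2 by (simp add: moebius_mult v_def)
    finally show "moebius (B' ** (M ** matrix_inv ?B)) u = moebius (M ** ?T) u"
      using U(4)[of u] u Im M'_eq by (simp add: KL_def)
  qed (use M(1) SL2 in simp_all)
  then have B': "B' = M ** genB L (t - r * L) ** matrix_inv M \<or> B' = - (M ** genB L (t - r * L) ** matrix_inv M)"
  proof -
    have "B' = B' ** (M ** matrix_inv ?B) ** (?B ** matrix_inv M)"
      using M(1) by (simp add: SL2_cancel flip: matrix_mul_assoc)
    moreover have "M ** ?T ** (?B ** matrix_inv M) = M ** genB L (t - r * L) ** matrix_inv M"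
      using transl_genB[of "- (r * L)" t] by (simp add: matrix_mul_assoc) (simp flip: matrix_mul_assoc)
    ultimately show ?thesis
      using \<open>B' ** (M ** matrix_inv ?B) = M ** ?T \<or> B' ** (M ** matrix_inv ?B) = - (M ** ?T)\<close>
      by (metis uminus_matrix_mult(1))
  qed

  have abs_eq: "a = b" if "a = b \<or> a = - b" "a > 0" "b > 0" for a b :: real using that by auto
  let ?B' = "genB L (t - r * L)"
  have "trace A' = trace ?A"
    using A' trace_conj[OF M(1), of ?A] pos(1) by (intro abs_eq) (auto simp: trace_uminus trace_transl)
  moreover have "trace B' = trace ?B'"
    using B' trace_conj[OF M(1), of ?B'] pos(2) trace_genB_gt_2[of "t - r * L"]
    by (intro abs_eq) (auto simp: trace_uminus)
  moreover have "trace (A' ** B') = trace (?A ** ?B')"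
  proof -
    have "(M ** ?A ** matrix_inv M) ** (M ** ?B' ** matrix_inv M) = M ** (?A ** ?B') ** matrix_inv M"
      using M(1) by (simp add: SL2_cancel flip: matrix_mul_assoc)
    then have "trace (A' ** B') = trace (M ** (?A ** ?B') ** matrix_inv M) \<or>
        trace (A' ** B') = - trace (M ** (?A ** ?B') ** matrix_inv M)"
      using A' B' by (auto simp: uminus_matrix_mult trace_uminus)
    then have "trace (A' ** B') = trace (?A ** ?B') \<or> trace (A' ** B') = - trace (?A ** ?B')"
      unfolding trace_conj[OF M(1)] .
    moreover have "trace (?A ** ?B') > 0"
      using trace_genB_gt_2[of "L + (t - r * L)"] by (simp add: transl_genB)
    ultimately show ?thesis using pos(3) by (intro abs_eq)
  qed
  ultimately show ?thesis using trace_coords_normal_form[of "t - r * L"] by (simp add: trace_coords_def)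
qed

lemma earthquake_tr_coords: "earthquake_tr (coords L t) r = coords L (t - r * L)"
  unfolding earthquake_tr_def
proof (rule the_equality)
  obtain E where "earthquake_map r (transl L) (genB L t) (transl L) (genB L (t - r * L)) E"
    using ex_earthquake_map by blast
  then have "left_earthquake r (transl L) (genB L t) (transl L) (genB L (t - r * L))"
    using marked_structure_normal_form by (auto simp: left_earthquake_def)
  then show "\<exists>A B A' B'. left_earthquake r A B A' B' \<and> trace_coords A B = coords L t \<and>
      trace_coords A' B' = coords L (t - r * L)"
    using trace_coords_normal_form by blast
next
  fix v' assume "\<exists>A B A' B'. left_earthquake r A B A' B' \<and> trace_coords A B = coords L t \<and>
      trace_coords A' B' = v'"
  then obtain A B A' B' E where *: "marked_structure A B" "marked_structure A' B'"
    "earthquake_map r A B A' B' E" "trace_coords A B = coords L t" "trace_coords A' B' = v'"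
    by (auto simp: left_earthquake_def)
  obtain P where P: "P \<in> SL2" "A = P ** transl L ** matrix_inv P" "B = P ** genB L t ** matrix_inv P"
    using *(1,4) by (rule marked_structure_conj_normal_form)
  have "earthquake_map r (transl L) (genB L t) A' B' (E \<circ> moebius P)"
    using *(3) P by (intro earthquake_map_conj) simp_all
  then have "trace_coords A' B' = coords L (t - r * L)"
    using *(2) by (intro earthquake_trace_coords) (auto simp: marked_structure_def)
  with *(5) show "v' = coords L (t - r * L)" by simp
qed

end

section \<open>Trace coordinates\<close>

text \<open>
  The equation forces \<open>x > 2\<close>, because \<open>y\<^sup>2 + z\<^sup>2 \<ge> 2 y z\<close>, and it says that the product of the
  diagonal entries \<open>a, d\<close> of the holonomy of \<open>\<beta>\<close> is \<open>(cosh (L/2) / sinh (L/2))\<^sup>2\<close>.  The twist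
  parameter is the logarithm of their ratio.
\<close>

lemma T_tr_coords:
  assumes "v \<in> T_tr"
  obtains L t where "L > 0" "v = coords L t"
proof -
  obtain x y z where v: "v = (x, y, z)" "x > 0" "y > 0" "z > 0" and eq: "x\<^sup>2 + y\<^sup>2 + z\<^sup>2 = x * y * z"
    using assms by (auto simp: T_tr_def)
  have "x > 2"
  proof (rule ccontr)
    assume "\<not> x > 2"
    then have "x * (y * z) \<le> 2 * (y * z)" using v by (intro mult_right_mono) auto
    moreover have "(y - z)\<^sup>2 \<ge> 0" "x\<^sup>2 > 0" using v by simp_all
    ultimately show False using eq by (simp add: power2_diff algebra_simps)
  qed
  define L where "L = 2 * arcosh (x / 2)"
  have ch: "cosh (L/2) = x / 2" using \<open>x > 2\<close> by (simp add: L_def)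
  have "L \<ge> 0" "L \<noteq> 0" using \<open>x > 2\<close> by (simp_all add: L_def)
  then have L: "L > 0" by simp
  interpret translation_length L using L by unfold_locales
  define S where "S = sinh (L/2)"
  have S: "S > 0" using sinh_pos by (simp add: S_def)
  have S2: "4 * S\<^sup>2 = x\<^sup>2 - 4" using cosh_sq by (simp add: ch S_def power_divide)
  define l where "l = exp (L/2)"
  have l: "l > 0" "l = x/2 + S" "exp (-L/2) = x/2 - S"
    using cosh_plus_sinh[of "L/2"] cosh_minus_sinh[of "L/2"] by (simp_all add: l_def ch S_def)
  \<comment> \<open>the diagonal entries of the holonomy of \<open>\<beta>\<close> when that of \<open>\<alpha>\<close> is diagonal\<close>
  define a d where ad: "a = (z - (x/2 - S) * y) / (2 * S)" "d = ((x/2 + S) * y - z) / (2 * S)"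
  have sum1: "a + d = y" and sum2: "(x/2 + S) * a + (x/2 - S) * d = z"
    using S by (simp_all add: ad field_simps)
  have "4 * S\<^sup>2 * (a * d) = x * y * z - z\<^sup>2 - (x\<^sup>2 / 4 - S\<^sup>2) * y\<^sup>2"
    using S by (simp add: ad field_simps power2_eq_square)
  also have "x\<^sup>2 / 4 - S\<^sup>2 = 1" using S2 by simp
  finally have prod: "4 * S\<^sup>2 * (a * d) = x\<^sup>2" using eq by simp
  then have "a * d > 0" using S v by (metis zero_less_mult_iff zero_less_power zero_less_numeral less_asym not_less_iff_gr_or_eq power2_less_0 zero_eq_power2 mult_eq_0_iff)
  then have ad_pos: "a > 0" "d > 0" using sum1 v by (auto simp: zero_less_mult_iff)
  define k where "k = x / (2 * S)"
  have k: "k > 0" using S v by (simp add: k_def)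
  have kk: "a * d = k\<^sup>2" using prod S by (simp add: k_def power_divide power_mult_distrib eq_divide_eq mult.commute)
  define t where "t = 2 * ln (a / k)"
  have a: "exp (t/2) = a / k" using ad_pos k by (simp add: t_def)
  have "exp (-t/2) = k / a" using a by (simp add: exp_minus)
  also have "\<dots> = d / k" using kk ad_pos k by (simp add: field_simps power2_eq_square)
  finally have d: "exp (-t/2) = d / k" .
  have ck: "cosh (L/2) / sinh (L/2) = k" by (simp add: ch k_def S_def)
  have "2 * k * cosh (t/2) = y" using a d k sum1 by (simp add: cosh_field_def field_simps)
  moreover have "2 * k * cosh ((L + t)/2) = z"
  proof -
    have "exp ((L + t)/2) = (x/2 + S) * (a / k)" "exp (- ((L + t)/2)) = (x/2 - S) * (d / k)"
      unfolding l(2,3)[symmetric] a[symmetric] d[symmetric] l_def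
      by (simp_all add: add_divide_distrib diff_divide_distrib flip: exp_add)
    then show ?thesis using k sum2 by (simp add: cosh_field_def field_simps)
  qed
  ultimately have "v = coords L t" unfolding coords_def ck v by (simp add: ch)
  with L show thesis by (rule that)
qed

lemma (in translation_length) F_tr_coords: "F_tr (coords L t) r = coords L (t - r * L)"
proof -
  define x where "x = 2 * cosh (L/2)"
  define S where "S = sinh (L/2)"
  define k where "k = cosh (L/2) / S"
  define y z where yz: "y = 2 * k * cosh (t/2)" "z = 2 * k * cosh ((L + t)/2)"
  have v: "coords L t = (x, y, z)" by (simp add: coords_def x_def yz k_def S_def)
  have S: "S > 0" using sinh_pos by (simp add: S_def)
  have x2: "x\<^sup>2 - 4 = (2 * S)\<^sup>2" using cosh_sq by (simp add: x_def S_def power_mult_distrib)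
  have sq: "sqrt (x\<^sup>2 - 4) = 2 * S" unfolding x2 real_sqrt_abs using S by simp
  have "S_plus x = x/2 + S" "S_minus x = x/2 - S"
    unfolding S_plus_def S_minus_def sq by simp_all
  then have Sp: "S_plus x = exp (L/2)" "S_minus x = exp (-L/2)"
    using cosh_plus_sinh[of "L/2"] cosh_minus_sinh[of "L/2"]
    by (simp_all add: x_def S_def)
  have kS: "k * (2 * S) = x" using S by (simp add: k_def x_def)
  have "z = 2 * k * (cosh (L/2) * cosh (t/2) + S * sinh (t/2))"
    by (simp add: yz S_def add_divide_distrib cosh_add)
  then have diff: "x * y - 2 * z = - (4 * S) * (k * sinh (t/2))"
    by (simp add: x_def yz algebra_simps)
  have frac: "(y * (2 * S)\<^sup>2 + (- (4 * S) * w) * (2 * S)) / (2 * (2 * S)\<^sup>2) = y/2 - w"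
    "(y * (2 * S)\<^sup>2 - (- (4 * S) * w) * (2 * S)) / (2 * (2 * S)\<^sup>2) = y/2 + w" for w
    using S by (simp_all add: field_simps power2_eq_square)
  have "C_plus x y z = y/2 - k * sinh (t/2)" "C_minus x y z = y/2 + k * sinh (t/2)"
    unfolding C_plus_def C_minus_def sq diff unfolding x2 by (rule frac)+
  then have C: "C_plus x y z = k * exp (-t/2)" "C_minus x y z = k * exp (t/2)"
    using cosh_plus_sinh[of "t/2"] cosh_minus_sinh[of "t/2"]
    by (simp_all add: yz flip: distrib_left right_diff_distrib)
  have y_alpha: "y_alpha (x, y, z) q = 2 * k * cosh ((t - q * L)/2)" for q
  proof -
    have "exp (- t/2) * exp (L/2) powr q = exp (- ((t - q * L)/2))"
      "exp (t/2) * exp (-L/2) powr q = exp ((t - q * L)/2)"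
      by (simp_all add: powr_def diff_divide_distrib flip: exp_add)
    then show ?thesis
      by (simp add: y_alpha_def C Sp cosh_field_def[of "(t - q * L)/2"] mult.assoc distrib_left)
  qed
  have shift: "t - (r - 1) * L = L + (t - r * L)" by (simp add: algebra_simps)
  show ?thesis unfolding v F_tr_def y_alpha shift by (simp add: coords_def x_def k_def S_def)
qed

theorem corollary3p2p4:
  fixes v :: "real \<times> real \<times> real"
  assumes "v \<in> T_tr"
  shows "earthquake_tr v = F_tr v"
proof
  fix r
  obtain L t where L: "L > 0" and v: "v = coords L t" using assms by (rule T_tr_coords)
  interpret translation_length L using L by unfold_locales
  show "earthquake_tr v r = F_tr v r" by (simp add: v earthquake_tr_coords F_tr_coords)
qed

end
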